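(* Let $\mathcal{M},\mathcal{N}$ be von Neumann algebras and let $\tau$ be a $*$-anti-automorphism of $\mathcal{N}$. For $\omega\in(\mathcal{M}\overline{\otimes}\mathcal{N})_*$ let $\phi=\Lambda_\tau(\omega):\mathcal{M}\to\mathcal{N}_*$ be the map given by $\phi(x)(y)=\omega(x\otimes\tau^{-1}(y))$ for $x\in\mathcal{M}$, $y\in\mathcal{N}$. Then $\omega\ge 0$ if and only if $\phi$ is completely positive.
   Context: $\mathcal{M}\overline{\otimes}\mathcal{N}$ is the spatial von Neumann tensor product and ${}_*$ denotes the predual (normal functionals). A $*$-anti-automorphism of $\mathcal{N}$ is a linear bijection $\tau:\mathcal{N}\to\mathcal{N}$ with $\tau(y^* )=\tau(y)^*$ and $\tau(y_1y_2)=\tau(y_2)\tau(y_1)$; $\tau^2=\mathrm{id}$ is not assumed (such a $\tau$ is automatically isometric and normal). Matrix order on $\mathcal{N}_*$: $M_n(\mathcal{N}_* )$ is identified with $(M_n(\mathcal{N}))_*$ through the trace pairing $\langle[\psi_{ij}],[b_{ij}]\rangle=\sum_{i,j=1}^n\psi_{ij}(b_{ji})$, and $M_n(\mathcal{N}_* )^+$ is the preimage of the cone of positive normal functionals on $M_n(\mathcal{N})$. A linear map $\phi:\mathcal{M}\to\mathcal{N}_*$ is completely positive if $\phi^{(n)}(M_n(\mathcal{M})^+)\subseteq M_n(\mathcal{N}_* )^+$ for every $n\in\mathbb{N}$, where $\phi^{(n)}([x_{ij}])=[\phi(x_{ij})]$. *)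

theory Defs
  imports "HOL-Analysis.Analysis"
begin

section \<open>Complex Hilbert spaces\<close>

class complex_vector = real_vector +
  fixes scaleC :: "complex \<Rightarrow> 'a \<Rightarrow> 'a"  (infixr "*\<^sub>C" 75)
  assumes scaleC_add_right: "c *\<^sub>C (x + y) = c *\<^sub>C x + c *\<^sub>C y"
    and scaleC_add_left: "(c + d) *\<^sub>C x = c *\<^sub>C x + d *\<^sub>C x"
    and scaleC_scaleC: "c *\<^sub>C d *\<^sub>C x = (c * d) *\<^sub>C x"
    and scaleC_one: "1 *\<^sub>C x = x"
    and scaleR_scaleC: "r *\<^sub>R x = complex_of_real r *\<^sub>C x"

text \<open>The inner product is linear in the first argument.  Definiteness is contained in
  the last axiom, completeness in the superclass \<^class>\<open>banach\<close>.\<close>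

class chilbert_space = banach + complex_vector +
  fixes cinner :: "'a \<Rightarrow> 'a \<Rightarrow> complex"
  assumes cinner_commute: "cinner x y = cnj (cinner y x)"
    and cinner_add_left: "cinner (x + y) z = cinner x z + cinner y z"
    and cinner_scaleC_left: "cinner (c *\<^sub>C x) y = c * cinner x y"
    and cinner_self: "cinner x x = complex_of_real ((norm x)\<^sup>2)"

lemma norm_scaleC: "norm (c *\<^sub>C x) = cmod c * norm (x :: 'a :: chilbert_space)"
proof -
  have "cinner (c *\<^sub>C x) (c *\<^sub>C x) = c * cnj (c * cinner x x)"
    by (metis cinner_commute cinner_scaleC_left)
  also have "\<dots> = (c * cnj c) * complex_of_real ((norm x)\<^sup>2)"
    by (simp add: cinner_self)
  also have "\<dots> = complex_of_real ((cmod c * norm x)\<^sup>2)"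
    by (simp only: complex_norm_square [symmetric] of_real_mult [symmetric] power_mult_distrib
        of_real_power [symmetric])
  finally have "complex_of_real ((norm (c *\<^sub>C x))\<^sup>2) = complex_of_real ((cmod c * norm x)\<^sup>2)"
    by (simp only: cinner_self)
  then have "(norm (c *\<^sub>C x))\<^sup>2 = (cmod c * norm x)\<^sup>2"
    by (simp only: of_real_eq_iff)
  then show ?thesis
    by (simp add: power2_eq_iff_nonneg)
qed

lemma bounded_linear_scaleC: "bounded_linear (\<lambda>x :: 'a :: chilbert_space. c *\<^sub>C x)"
proof (rule bounded_linear_intro[where K = "cmod c"])
  show "c *\<^sub>C r *\<^sub>R x = r *\<^sub>R c *\<^sub>C x" for r and x :: 'a
    by (simp add: scaleR_scaleC scaleC_scaleC mult.commute)
qed (simp_all add: scaleC_add_right norm_scaleC)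

instantiation blinfun :: (real_normed_vector, chilbert_space) complex_vector
begin

definition scaleC_blinfun :: "complex \<Rightarrow> ('a \<Rightarrow>\<^sub>L 'b) \<Rightarrow> ('a \<Rightarrow>\<^sub>L 'b)"
  where "scaleC_blinfun c a = Blinfun (\<lambda>\<xi>. c *\<^sub>C blinfun_apply a \<xi>)"

lemma blinfun_apply_scaleC: "blinfun_apply (c *\<^sub>C a) \<xi> = c *\<^sub>C blinfun_apply a \<xi>"
  for a :: "'a \<Rightarrow>\<^sub>L 'b"
proof -
  have "bounded_linear (\<lambda>\<xi>. c *\<^sub>C blinfun_apply a \<xi>)"
    using bounded_linear_compose[OF bounded_linear_scaleC blinfun.bounded_linear_right] .
  then show ?thesis
    by (simp add: scaleC_blinfun_def bounded_linear_Blinfun_apply)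
qed

instance
  by standard
    (auto intro!: blinfun_eqI simp: blinfun_apply_scaleC blinfun.add_left blinfun.scaleR_left
      scaleC_add_right scaleC_add_left scaleC_scaleC scaleC_one scaleR_scaleC)

end


section \<open>Von Neumann algebras\<close>

text \<open>Members of \<open>'h \<Rightarrow>\<^sub>L 'h\<close> are only real-linear, so complex linearity is required separately.\<close>

definition bounded_ops :: "('h::chilbert_space \<Rightarrow>\<^sub>L 'h) set"  where
  "bounded_ops = {a. \<forall>c \<xi>. blinfun_apply a (c *\<^sub>C \<xi>) = c *\<^sub>C blinfun_apply a \<xi>}"

definition adj :: "('h::chilbert_space \<Rightarrow>\<^sub>L 'h) \<Rightarrow> ('h \<Rightarrow>\<^sub>L 'h)" where
  "adj a = (THE b. \<forall>\<xi> \<eta>. cinner (blinfun_apply a \<xi>) \<eta> = cinner \<xi> (blinfun_apply b \<eta>))"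

definition commutant :: "('h::chilbert_space \<Rightarrow>\<^sub>L 'h) set \<Rightarrow> ('h \<Rightarrow>\<^sub>L 'h) set" where
  "commutant S = {a \<in> bounded_ops. \<forall>s\<in>S. a o\<^sub>L s = s o\<^sub>L a}"

definition von_neumann_algebra :: "('h::chilbert_space \<Rightarrow>\<^sub>L 'h) set \<Rightarrow> bool" where
  "von_neumann_algebra A \<longleftrightarrow>
     A \<subseteq> bounded_ops \<and> (\<forall>a\<in>A. adj a \<in> A) \<and> commutant (commutant A) = A"

definition positive_op :: "('h::chilbert_space \<Rightarrow>\<^sub>L 'h) \<Rightarrow> bool" where
  "positive_op a \<longleftrightarrow> (\<forall>\<xi>. cinner (blinfun_apply a \<xi>) \<xi> \<in> \<real>\<^sub>\<ge>\<^sub>0)"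

definition star_anti_automorphism ::
    "('h::chilbert_space \<Rightarrow>\<^sub>L 'h) set \<Rightarrow> (('h \<Rightarrow>\<^sub>L 'h) \<Rightarrow> ('h \<Rightarrow>\<^sub>L 'h)) \<Rightarrow> bool" where
  "star_anti_automorphism A \<tau> \<longleftrightarrow>
     bij_betw \<tau> A A \<and>
     (\<forall>a\<in>A. \<forall>b\<in>A. \<tau> (a + b) = \<tau> a + \<tau> b) \<and>
     (\<forall>c. \<forall>a\<in>A. \<tau> (c *\<^sub>C a) = c *\<^sub>C \<tau> a) \<and>
     (\<forall>a\<in>A. \<tau> (adj a) = adj (\<tau> a)) \<and>
     (\<forall>a\<in>A. \<forall>b\<in>A. \<tau> (a o\<^sub>L b) = \<tau> b o\<^sub>L \<tau> a)"


section \<open>Normal functionals\<close>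

definition square_summable :: "(nat \<Rightarrow> 'h::chilbert_space) \<Rightarrow> bool" where
  "square_summable \<xi> \<longleftrightarrow> summable (\<lambda>k. (norm (\<xi> k))\<^sup>2)"

text \<open>The \<open>\<sigma>\<close>-weak topology: the coarsest one making all the functionals
  \<open>a \<mapsto> \<Sum>k. \<langle>a \<xi>\<^sub>k, \<eta>\<^sub>k\<rangle>\<close> with square-summable \<open>\<xi>, \<eta>\<close> continuous.\<close>

definition ultraweak_topology :: "('h::chilbert_space \<Rightarrow>\<^sub>L 'h) topology" where
  "ultraweak_topology = topology_generated_by
     {{a. (\<Sum>k. cinner (blinfun_apply a (\<xi> k)) (\<eta> k)) \<in> U} | \<xi> \<eta> U.
        square_summable \<xi> \<and> square_summable \<eta> \<and> open U}"

text \<open>A functional on \<open>A\<close> is a function on all operators of which only the values on \<open>A\<close> matter.\<close>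

definition predual :: "('h::chilbert_space \<Rightarrow>\<^sub>L 'h) set \<Rightarrow> (('h \<Rightarrow>\<^sub>L 'h) \<Rightarrow> complex) set" where
  "predual A = {\<psi>.
     (\<forall>a\<in>A. \<forall>b\<in>A. \<psi> (a + b) = \<psi> a + \<psi> b) \<and>
     (\<forall>c. \<forall>a\<in>A. \<psi> (c *\<^sub>C a) = c * \<psi> a) \<and>
     continuous_map (subtopology ultraweak_topology A) euclidean \<psi>}"

definition positive_functional ::
    "('h::chilbert_space \<Rightarrow>\<^sub>L 'h) set \<Rightarrow> (('h \<Rightarrow>\<^sub>L 'h) \<Rightarrow> complex) \<Rightarrow> bool" where
  "positive_functional A \<psi> \<longleftrightarrow> (\<forall>a\<in>A. positive_op a \<longrightarrow> \<psi> a \<in> \<real>\<^sub>\<ge>\<^sub>0)"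


section \<open>Tensor products\<close>

text \<open>\<open>t\<close> exhibits \<open>'l\<close> as the Hilbert space tensor product of \<open>'h\<close> and \<open>'k\<close>, which determines
  \<open>('l, t)\<close> up to a unique unitary.  The real span suffices, since the elementary tensors are
  closed under complex multiples.\<close>

definition hilbert_tensor ::
    "('h::chilbert_space \<Rightarrow> 'k::chilbert_space \<Rightarrow> 'l::chilbert_space) \<Rightarrow> bool" where
  "hilbert_tensor t \<longleftrightarrow>
     (\<forall>\<xi> \<xi>' \<eta>. t (\<xi> + \<xi>') \<eta> = t \<xi> \<eta> + t \<xi>' \<eta>) \<and>
     (\<forall>\<xi> \<eta> \<eta>'. t \<xi> (\<eta> + \<eta>') = t \<xi> \<eta> + t \<xi> \<eta>') \<and>
     (\<forall>c \<xi> \<eta>. t (c *\<^sub>C \<xi>) \<eta> = c *\<^sub>C t \<xi> \<eta> \<and> t \<xi> (c *\<^sub>C \<eta>) = c *\<^sub>C t \<xi> \<eta>) \<and>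
     (\<forall>\<xi> \<eta> \<xi>' \<eta>'. cinner (t \<xi> \<eta>) (t \<xi>' \<eta>') = cinner \<xi> \<xi>' * cinner \<eta> \<eta>') \<and>
     closure (span {t \<xi> \<eta> | \<xi> \<eta>. True}) = UNIV"

definition op_tensor ::
    "('h::chilbert_space \<Rightarrow> 'k::chilbert_space \<Rightarrow> 'l::chilbert_space) \<Rightarrow>
     ('h \<Rightarrow>\<^sub>L 'h) \<Rightarrow> ('k \<Rightarrow>\<^sub>L 'k) \<Rightarrow> ('l \<Rightarrow>\<^sub>L 'l)" where
  "op_tensor t x y = (THE z. z \<in> bounded_ops \<and>
     (\<forall>\<xi> \<eta>. blinfun_apply z (t \<xi> \<eta>) = t (blinfun_apply x \<xi>) (blinfun_apply y \<eta>)))"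

text \<open>The von Neumann algebra generated by the elementary tensors; the bicommutant suffices
  because they form a self-adjoint set.\<close>

definition vn_tensor ::
    "('h::chilbert_space \<Rightarrow> 'k::chilbert_space \<Rightarrow> 'l::chilbert_space) \<Rightarrow>
     ('h \<Rightarrow>\<^sub>L 'h) set \<Rightarrow> ('k \<Rightarrow>\<^sub>L 'k) set \<Rightarrow> ('l \<Rightarrow>\<^sub>L 'l) set" where
  "vn_tensor t M N = commutant (commutant {op_tensor t x y | x y. x \<in> M \<and> y \<in> N})"


section \<open>Matrix order and complete positivity\<close>

text \<open>An \<open>n \<times> n\<close> matrix is a function of two indices, of which only the values below \<open>n\<close> matter.
  Positivity in \<open>M\<^sub>n(A)\<close> is positivity as an operator on the \<open>n\<close>-fold direct sum of \<open>'h\<close>.\<close>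

definition mat_pos ::
    "nat \<Rightarrow> ('h::chilbert_space \<Rightarrow>\<^sub>L 'h) set \<Rightarrow> (nat \<Rightarrow> nat \<Rightarrow> 'h \<Rightarrow>\<^sub>L 'h) set" where
  "mat_pos n A = {x. (\<forall>i<n. \<forall>j<n. x i j \<in> A) \<and>
     (\<forall>\<xi>. (\<Sum>i<n. \<Sum>j<n. cinner (blinfun_apply (x i j) (\<xi> j)) (\<xi> i)) \<in> \<real>\<^sub>\<ge>\<^sub>0)}"

definition trace_pairing :: "nat \<Rightarrow> (nat \<Rightarrow> nat \<Rightarrow> 'a \<Rightarrow> complex) \<Rightarrow> (nat \<Rightarrow> nat \<Rightarrow> 'a) \<Rightarrow> complex" where
  "trace_pairing n \<psi> b = (\<Sum>i<n. \<Sum>j<n. \<psi> i j (b j i))"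

text \<open>The trace pairing with a matrix of normal functionals is automatically a normal functional
  on \<open>M\<^sub>n(A)\<close>, so only its positivity is demanded.\<close>

definition predual_mat_pos ::
    "nat \<Rightarrow> ('h::chilbert_space \<Rightarrow>\<^sub>L 'h) set \<Rightarrow> (nat \<Rightarrow> nat \<Rightarrow> ('h \<Rightarrow>\<^sub>L 'h) \<Rightarrow> complex) set" where
  "predual_mat_pos n A = {\<psi>. (\<forall>i<n. \<forall>j<n. \<psi> i j \<in> predual A) \<and>
     (\<forall>b\<in>mat_pos n A. trace_pairing n \<psi> b \<in> \<real>\<^sub>\<ge>\<^sub>0)}"

definition linear_to_predual ::
    "('h::chilbert_space \<Rightarrow>\<^sub>L 'h) set \<Rightarrow> ('k::chilbert_space \<Rightarrow>\<^sub>L 'k) set \<Rightarrow>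
     (('h \<Rightarrow>\<^sub>L 'h) \<Rightarrow> ('k \<Rightarrow>\<^sub>L 'k) \<Rightarrow> complex) \<Rightarrow> bool" where
  "linear_to_predual M N \<phi> \<longleftrightarrow>
     (\<forall>x\<in>M. \<phi> x \<in> predual N) \<and>
     (\<forall>x\<in>M. \<forall>x'\<in>M. \<forall>y\<in>N. \<phi> (x + x') y = \<phi> x y + \<phi> x' y) \<and>
     (\<forall>c. \<forall>x\<in>M. \<forall>y\<in>N. \<phi> (c *\<^sub>C x) y = c * \<phi> x y)"

definition completely_positive ::
    "('h::chilbert_space \<Rightarrow>\<^sub>L 'h) set \<Rightarrow> ('k::chilbert_space \<Rightarrow>\<^sub>L 'k) set \<Rightarrow>
     (('h \<Rightarrow>\<^sub>L 'h) \<Rightarrow> ('k \<Rightarrow>\<^sub>L 'k) \<Rightarrow> complex) \<Rightarrow> bool" where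
  "completely_positive M N \<phi> \<longleftrightarrow> linear_to_predual M N \<phi> \<and>
     (\<forall>n. \<forall>x\<in>mat_pos n M. (\<lambda>i j. \<phi> (x i j)) \<in> predual_mat_pos n N)"

definition Lambda_map ::
    "('h::chilbert_space \<Rightarrow> 'k::chilbert_space \<Rightarrow> 'l::chilbert_space) \<Rightarrow> ('k \<Rightarrow>\<^sub>L 'k) set \<Rightarrow>
     (('k \<Rightarrow>\<^sub>L 'k) \<Rightarrow> ('k \<Rightarrow>\<^sub>L 'k)) \<Rightarrow> (('l \<Rightarrow>\<^sub>L 'l) \<Rightarrow> complex) \<Rightarrow>
     ('h \<Rightarrow>\<^sub>L 'h) \<Rightarrow> ('k \<Rightarrow>\<^sub>L 'k) \<Rightarrow> complex" where
  "Lambda_map t N \<tau> \<omega> x y = \<omega> (op_tensor t x (the_inv_into N \<tau> y))"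

end

theory Submission
  imports Defs
begin

text \<open>If \<open>\<omega> \<ge> 0\<close> and \<open>[x\<^sub>i\<^sub>j] = r\<^sup>* r\<close>, \<open>[b\<^sub>i\<^sub>j] = s\<^sup>* s\<close>, then, \<open>\<tau>\<close> being anti-multiplicative, the trace pairing of
  \<open>[\<phi> x\<^sub>i\<^sub>j]\<close> with \<open>[b\<^sub>i\<^sub>j]\<close> is a sum of values \<open>\<omega> (z\<^sup>* z)\<close>.  Conversely, complete positivity applied to
  \<open>[x\<^sub>i\<^sup>* x\<^sub>j]\<close> and \<open>[\<tau> y\<^sub>i (\<tau> y\<^sub>j)\<^sup>*]\<close> says \<open>\<omega> (z\<^sup>* z) \<ge> 0\<close> for \<open>z = \<Sum> x\<^sub>i \<otimes> y\<^sub>i\<close>, and these \<open>z\<close> are dense in the von Neumann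
  tensor product strongly enough for \<open>\<omega>\<close>, which is a vector functional \<open>\<langle>\<cdot> \<zeta>, \<eta>\<rangle>\<close> of the infinite
  amplification.

  The remaining point is that \<open>\<phi> x\<close> is normal, that is, that \<open>\<tau>\<^sup>-\<^sup>1\<close> does not destroy normality.  For \<open>x \<ge> 0\<close>
  the functional \<open>f = \<phi> x\<close> is positive, and it preserves suprema of bounded chains, because \<open>\<tau>\<^sup>-\<^sup>1\<close> is an
  order isomorphism.  Take a maximal \<open>0 \<le> a \<le> 1\<close> for which \<open>f (\<cdot> a)\<close> is normal.  If \<open>a \<noteq> 1\<close>, choose \<open>\<xi>\<close> with
  \<open>f (1 - a) < \<langle>(1 - a) \<xi>, \<xi>\<rangle>\<close>; a second maximality argument gives \<open>0 \<noteq> c \<le> 1 - a\<close> with \<open>f \<le> \<langle>\<cdot> \<xi>, \<xi>\<rangle>\<close> below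
  \<open>c\<close>, so \<open>f (\<cdot> c)\<close> is normal and \<open>a + c\<close> contradicts the maximality of \<open>a\<close>.\<close>

section \<open>Complex Hilbert spaces and the Riesz representation\<close>

text \<open>Normality is an obstacle because \<open>\<tau>\<close> is given purely algebraically,
  whereas \<open>completely_positive\<close> demands values in \<open>predual N\<close>, a
  topological condition. Suprema of chains mediate: they are determined by the order, and at the
  same time they are strong limits, which \<open>\<omega>\<close> can see. That order continuity
  implies ultraweak continuity is classically proved with projections. Positive contractions take
  their place here: adding some \<open>c\<close> below \<open>1 - a\<close> to \<open>a\<close>
  gives a positive contraction again, so that square roots inside the algebra are the only
  functional calculus involved. Continuity is handled as one estimate: a linear functional is normal
  iff its modulus at \<open>a\<close> is at most the norm of \<open>amp a\<close> at a single vector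
  of \<open>l2\<close>. Such bounds can be added, and even summed over a sequence, by packing the
  vectors into one, and Riesz representation turns the estimate back into a vector
  functional.\<close>

lemma scaleC_of_real: "complex_of_real r *\<^sub>C (x :: 'a :: complex_vector) = r *\<^sub>R x"
  by (simp add: scaleR_scaleC)

lemma scaleC_minus1: "(-1) *\<^sub>C (x :: 'a :: complex_vector) = - x"
  using scaleC_of_real[of "-1" x] by simp

lemma scaleC_zero_left [simp]: "0 *\<^sub>C (x :: 'a :: complex_vector) = 0"
  using scaleC_of_real[of 0 x] by simp

lemma scaleC_zero_right [simp]: "c *\<^sub>C (0 :: 'a :: complex_vector) = 0"
  by (metis scaleC_scaleC scaleC_zero_left mult_zero_right)

lemma scaleC_minus_right: "c *\<^sub>C (- x) = - (c *\<^sub>C (x :: 'a :: complex_vector))"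
  by (metis scaleC_minus1 scaleC_scaleC mult.commute)

lemma scaleC_diff_right: "c *\<^sub>C (x - y) = c *\<^sub>C x - c *\<^sub>C (y :: 'a :: complex_vector)"
  by (simp add: diff_conv_add_uminus scaleC_add_right scaleC_minus_right del: add_uminus_conv_diff)

lemma scaleC_sum_right: "c *\<^sub>C (\<Sum>i\<in>I. f i) = (\<Sum>i\<in>I. c *\<^sub>C (f i :: 'a :: complex_vector))"
  by (induction I rule: infinite_finite_induct) (auto simp: scaleC_add_right)

lemma scaleC_scaleR_commute: "c *\<^sub>C r *\<^sub>R x = r *\<^sub>R c *\<^sub>C (x :: 'a :: complex_vector)"
  by (simp add: scaleR_scaleC scaleC_scaleC mult.commute)

lemma tendsto_scaleC [tendsto_intros]:
  "(f \<longlongrightarrow> l) F \<Longrightarrow> ((\<lambda>x. c *\<^sub>C (f x :: 'a :: chilbert_space)) \<longlongrightarrow> c *\<^sub>C l) F"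
  using bounded_linear.tendsto[OF bounded_linear_scaleC] .

lemma cinner_add_right: "cinner x (y + z) = cinner x y + cinner x z"
  by (metis cinner_commute cinner_add_left complex_cnj_add)

lemma cinner_scaleC_right: "cinner x (c *\<^sub>C y) = cnj c * cinner x y"
  by (metis cinner_commute cinner_scaleC_left complex_cnj_mult)

lemma cinner_scaleR_left: "cinner (r *\<^sub>R x) y = r *\<^sub>R cinner x y"
  by (simp add: scaleR_scaleC cinner_scaleC_left scaleR_conv_of_real)

lemma cinner_scaleR_right: "cinner x (r *\<^sub>R y) = r *\<^sub>R cinner x y"
  by (simp add: scaleR_scaleC cinner_scaleC_right scaleR_conv_of_real)

lemma Re_cinner_self: "Re (cinner x x) = (norm x)\<^sup>2"
  by (simp add: cinner_self)

lemma Re_cinner_commute: "Re (cinner x y) = Re (cinner y x)"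
  by (subst cinner_commute) simp

lemma norm_add_scaleC_square:
  "(norm (x + cnj c *\<^sub>C y))\<^sup>2 = (norm x)\<^sup>2 + 2 * Re (c * cinner x y) + (cmod c)\<^sup>2 * (norm y)\<^sup>2"
  for x y :: "'a :: chilbert_space"
proof -
  have "Re (cinner (x + cnj c *\<^sub>C y) (x + cnj c *\<^sub>C y)) =
      Re (cinner x x) + Re (c * cinner x y) + Re (cnj (c * cinner x y)) + (cmod c)\<^sup>2 * Re (cinner y y)"
    unfolding cinner_add_left cinner_add_right cinner_scaleC_left cinner_scaleC_right cinner_commute[of y x]
    by (simp add: cmod_power2 cinner_self algebra_simps) (simp add: power2_eq_square algebra_simps)
  then show ?thesis
    by (simp add: Re_cinner_self)
qed

lemma norm_add_square:
  "(norm (x + y))\<^sup>2 = (norm x)\<^sup>2 + 2 * Re (cinner x y) + (norm y)\<^sup>2" for x y :: "'a :: chilbert_space"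
  using norm_add_scaleC_square[of x 1 y] by (simp add: scaleC_one)

text \<open>All Cauchy--Schwarz inequalities below are instances: \<open>p + 2 Re (c z) + |c|\<^sup>2 q\<close> is the value
  of a positive semidefinite form at \<open>x + \<cc> y\<close>, and \<open>z\<close> its mixed term.\<close>

lemma cmod_square_le_if_quadratic_nonneg:
  assumes "\<And>c. 0 \<le> p + 2 * Re (c * z) + (cmod c)\<^sup>2 * q" and "0 \<le> q"
  shows "(cmod z)\<^sup>2 \<le> p * q"
proof (cases "q = 0")
  case True
  have "z = 0"
  proof (rule ccontr)
    assume z: "z \<noteq> 0"
    \<comment> \<open>A real multiple of \<open>cnj z\<close> that makes the form, affine when
      \<open>q = 0\<close>, equal to \<open>p - 2 * (\<bar>p\<bar> + 1)\<close>, which is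
      negative.\<close>
    define s where "s = - (\<bar>p\<bar> + 1) / (cmod z)\<^sup>2"
    have "Re (complex_of_real s * cnj z * z) = s * (cmod z)\<^sup>2"
      unfolding cmod_power2 by (simp add: power2_eq_square algebra_simps)
    also have "\<dots> = - (\<bar>p\<bar> + 1)"
      using z by (simp add: s_def)
    finally show False
      using assms(1)[of "complex_of_real s * cnj z", unfolded True mult_zero_right add_0_right]
      by linarith
  qed
  then show ?thesis using True by simp
next
  case False
  then have q: "0 < q" using assms by simp
  \<comment> \<open>The minimiser of the quadratic form; the minimum is
    \<open>p - (cmod z)\<^sup>2 / q\<close>.\<close>
  define c where "c = - cnj z / complex_of_real q"
  have "c * z = complex_of_real (- (cmod z)\<^sup>2 / q)"
    using complex_norm_square[of z] by (simp add: c_def mult.commute)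
  then have "Re (c * z) = - (cmod z)\<^sup>2 / q"
    by (metis Re_complex_of_real)
  moreover have "(cmod c)\<^sup>2 * q = (cmod z)\<^sup>2 / q"
    using q by (simp add: c_def norm_divide power_divide power2_eq_square)
  ultimately have "0 \<le> p - (cmod z)\<^sup>2 / q"
    using assms(1)[of c] by simp
  then show ?thesis using q by (simp add: field_simps)
qed

lemma cinner_Cauchy_Schwarz: "cmod (cinner x y) \<le> norm x * norm y"
proof -
  have "(cmod (cinner x y))\<^sup>2 \<le> (norm x)\<^sup>2 * (norm y)\<^sup>2"
    by (rule cmod_square_le_if_quadratic_nonneg) (simp_all only: norm_add_scaleC_square[symmetric] zero_le_power2)
  then show ?thesis
    by (simp add: power_mult_distrib[symmetric] power2_le_iff_abs_le)
qed

global_interpretation cinner: bounded_bilinear "cinner :: 'a::chilbert_space \<Rightarrow> 'a \<Rightarrow> complex"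
  by standard (auto simp: cinner_add_left cinner_add_right cinner_scaleR_left cinner_scaleR_right
      intro!: exI[of _ 1] cinner_Cauchy_Schwarz)

lemmas tendsto_cinner [tendsto_intros] = cinner.tendsto

lemma cinner_eq_zero_imp: "(\<And>v. cinner v u = 0) \<Longrightarrow> u = 0"
  using cinner_self[of u] by simp

lemma cinner_ext: "(\<And>v. cinner v u = cinner v w) \<Longrightarrow> u = w"
  using cinner_eq_zero_imp[of "u - w"] by (simp add: cinner.diff_right)

lemma cinner_closure_zero:
  assumes "\<And>v. v \<in> D \<Longrightarrow> cinner v u = 0" and "w \<in> closure D"
  shows "cinner w u = 0"
proof -
  obtain f where f: "\<And>n. f n \<in> D" "f \<longlonglongrightarrow> w"
    using assms(2) by (auto simp: closure_sequential)
  have "(\<lambda>n. cinner (f n) u) \<longlonglongrightarrow> cinner w u"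
    by (intro tendsto_intros f)
  then show ?thesis
    using f(1) assms(1) by (simp add: LIMSEQ_const_iff)
qed

lemma closure_add_scaleC:
  fixes D :: "'h::chilbert_space set"
  assumes D: "\<And>v w. v \<in> D \<Longrightarrow> w \<in> D \<Longrightarrow> v + w \<in> D" "\<And>c v. v \<in> D \<Longrightarrow> c *\<^sub>C v \<in> D"
  shows "v \<in> closure D \<Longrightarrow> w \<in> closure D \<Longrightarrow> v + w \<in> closure D"
    and "v \<in> closure D \<Longrightarrow> c *\<^sub>C v \<in> closure D"
proof -
  assume "v \<in> closure D" "w \<in> closure D"
  then obtain f g where fg: "\<And>n. f n \<in> D" "f \<longlonglongrightarrow> v" "\<And>n. g n \<in> D" "g \<longlonglongrightarrow> w"
    by (auto simp: closure_sequential)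
  then have "(\<lambda>n. f n + g n) \<longlonglongrightarrow> v + w" by (intro tendsto_intros)
  then show "v + w \<in> closure D"
    using fg(1,3) D(1) by (auto simp: closure_sequential intro!: exI[of _ "\<lambda>n. f n + g n"])
next
  assume "v \<in> closure D"
  then obtain f where f: "\<And>n. f n \<in> D" "f \<longlonglongrightarrow> v"
    by (auto simp: closure_sequential)
  then have "(\<lambda>n. c *\<^sub>C f n) \<longlonglongrightarrow> c *\<^sub>C v" by (intro tendsto_intros)
  then show "c *\<^sub>C v \<in> closure D"
    using f(1) D(2) by (auto simp: closure_sequential intro!: exI[of _ "\<lambda>n. c *\<^sub>C f n"])
qed

text \<open>\<open>x - y\<close> lies in the closure of \<open>D\<close> and is orthogonal to
  \<open>D\<close>, hence to itself. Vectors found by Riesz representation are identified in this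
  way below.\<close>

lemma closure_subspace_eqI:
  fixes D :: "'h::chilbert_space set"
  assumes D: "\<And>v w. v \<in> D \<Longrightarrow> w \<in> D \<Longrightarrow> v + w \<in> D" "\<And>c v. v \<in> D \<Longrightarrow> c *\<^sub>C v \<in> D"
    and xy: "x \<in> closure D" "y \<in> closure D" "\<And>d. d \<in> D \<Longrightarrow> cinner d x = cinner d y"
  shows "x = y"
proof -
  have "x + (-1) *\<^sub>C y \<in> closure D"
    by (intro closure_add_scaleC D xy)
  then have "x - y \<in> closure D" by (simp add: scaleC_minus1)
  then have "cinner (x - y) (x - y) = 0"
    by (rule cinner_closure_zero[rotated]) (use xy(3) in \<open>auto simp: cinner.diff_right\<close>)
  then show ?thesis by (simp add: cinner_self)
qed

text \<open>Riesz representation for a functional given by its graph, which makes well-definedness part of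
  the conclusion; the representing vector minimises \<open>|v|\<^sup>2 - 2 Re \<alpha>\<close> over the graph.\<close>

lemma Riesz_graph:
  fixes G :: "('h::chilbert_space \<times> complex) set"
  assumes zero: "(0, 0) \<in> G"
    and add: "\<And>v a w b. (v, a) \<in> G \<Longrightarrow> (w, b) \<in> G \<Longrightarrow> (v + w, a + b) \<in> G"
    and scale: "\<And>c v a. (v, a) \<in> G \<Longrightarrow> (c *\<^sub>C v, c * a) \<in> G"
    and B: "\<And>v a. (v, a) \<in> G \<Longrightarrow> cmod a \<le> B * norm v"
  obtains \<eta> where "\<eta> \<in> closure (fst ` G)" "norm \<eta> \<le> B \<or> \<eta> = 0"
    "\<And>v a. (v, a) \<in> G \<Longrightarrow> a = cinner v \<eta>"
proof -
  define Q where "Q p = (norm (fst p))\<^sup>2 - 2 * Re (snd p)" for p :: "'h \<times> complex"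
  define m where "m = Inf (Q ` G)"
  have "- B\<^sup>2 \<le> Q p" if "p \<in> G" for p
  proof -
    have "Re (snd p) \<le> B * norm (fst p)"
      using B[of "fst p" "snd p"] that complex_Re_le_cmod[of "snd p"] by simp
    then show ?thesis
      unfolding Q_def using zero_le_power2[of "norm (fst p) - B"]
      by (simp add: power2_diff algebra_simps)
  qed
  then have bdd: "bdd_below (Q ` G)" by (rule bdd_belowI2)
  then have mQ: "m \<le> Q p" if "p \<in> G" for p
    unfolding m_def using that by (auto intro: cINF_lower)
  have "\<exists>p\<in>G. Q p < m + 1 / Suc n" for n
  proof -
    have "\<exists>x\<in>Q ` G. x < m + 1 / Suc n"
      by (rule cInf_lessD) (use zero in \<open>auto simp: m_def\<close>)
    then show ?thesis by auto
  qed
  then obtain p where p: "\<And>n. p n \<in> G" "\<And>n. Q (p n) < m + 1 / Suc n"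
    by metis
  have Qlim: "(\<lambda>n. Q (p n)) \<longlonglongrightarrow> m"
  proof (rule tendsto_sandwich)
    show "\<forall>\<^sub>F n in sequentially. m \<le> Q (p n)" using mQ p(1) by simp
    show "\<forall>\<^sub>F n in sequentially. Q (p n) \<le> m + 1 / Suc n" using p(2) by (simp add: less_imp_le)
    show "(\<lambda>n. m + 1 / Suc n) \<longlonglongrightarrow> m"
      using tendsto_add[OF tendsto_const LIMSEQ_inverse_real_of_nat, of m] by (simp add: inverse_eq_divide)
  qed auto
  \<comment> \<open>Parallelogram law: the midpoint of two points of the graph is in the graph, so
    its \<open>Q\<close> is at least \<open>m\<close>, and almost minimal points are close to each
    other.\<close>
  have dist: "(norm (fst (p n) - fst (p k)))\<^sup>2 \<le> 2 * Q (p n) + 2 * Q (p k) - 4 * m" for n k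
  proof -
    obtain v a w b where vw: "p n = (v, a)" "p k = (w, b)" by (metis surj_pair)
    have "((1/2) *\<^sub>C (v + w), (1/2) * (a + b)) \<in> G"
      using p(1)[of n] p(1)[of k] by (intro scale add) (auto simp: vw)
    then have "m \<le> Q ((1/2) *\<^sub>C (v + w), (1/2) * (a + b))" by (rule mQ)
    then have "4 * m \<le> (norm (v + w))\<^sup>2 - 4 * Re (a + b)"
      by (simp add: Q_def norm_scaleC power_mult_distrib norm_divide power2_eq_square field_simps)
    moreover have "(norm (v - w))\<^sup>2 + (norm (v + w))\<^sup>2 = 2 * (norm v)\<^sup>2 + 2 * (norm w)\<^sup>2"
      using norm_add_square[of v "- w"] norm_add_square[of v w] by (simp add: cinner.minus_right)
    ultimately show ?thesis
      by (simp add: vw Q_def)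
  qed
  have "Cauchy (\<lambda>n. fst (p n))"
  proof (rule metric_CauchyI)
    fix e :: real assume e: "0 < e"
    then have "\<forall>\<^sub>F n in sequentially. Q (p n) < m + e\<^sup>2 / 4"
      using order_tendstoD(2)[OF Qlim, of "m + e\<^sup>2 / 4"] by simp
    then obtain N where N: "\<And>n. n \<ge> N \<Longrightarrow> Q (p n) < m + e\<^sup>2 / 4"
      by (auto simp: eventually_sequentially)
    have "dist (fst (p n)) (fst (p k)) < e" if "n \<ge> N" "k \<ge> N" for n k
    proof -
      have "(norm (fst (p n) - fst (p k)))\<^sup>2 < e\<^sup>2"
        using dist[of n k] N[OF that(1)] N[OF that(2)] by simp
      then show ?thesis
        using e by (simp add: dist_norm power2_less_imp_less)
    qed
    then show "\<exists>M. \<forall>n\<ge>M. \<forall>k\<ge>M. dist (fst (p n)) (fst (p k)) < e" by blast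
  qed
  then obtain \<eta> where \<eta>: "(\<lambda>n. fst (p n)) \<longlonglongrightarrow> \<eta>"
    by (auto simp: Cauchy_convergent_iff convergent_def)
  \<comment> \<open>First variation: moving the minimizing sequence by a real multiple of
    \<open>(v, a)\<close> cannot push \<open>Q\<close> below \<open>m\<close>, so the linear term
    vanishes.\<close>
  have Re_eq: "Re (cinner v \<eta>) = Re a" if "(v, a) \<in> G" for v a
  proof -
    have pos: "0 \<le> 2 * t * (Re (cinner \<eta> v) - Re a) + t\<^sup>2 * (norm v)\<^sup>2" for t
    proof -
      have "m \<le> Q (p n) + 2 * t * (Re (cinner (fst (p n)) v) - Re a) + t\<^sup>2 * (norm v)\<^sup>2" for n
      proof -
        have "(fst (p n) + complex_of_real t *\<^sub>C v, snd (p n) + complex_of_real t * a) \<in> G"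
          using p(1)[of n] that by (intro scale add) auto
        then have "m \<le> Q (fst (p n) + complex_of_real t *\<^sub>C v, snd (p n) + complex_of_real t * a)"
          by (rule mQ)
        then show ?thesis
          by (simp add: Q_def norm_add_square scaleC_of_real cinner_scaleR_right power_mult_distrib
              algebra_simps)
      qed
      moreover have "(\<lambda>n. Q (p n) + 2 * t * (Re (cinner (fst (p n)) v) - Re a) + t\<^sup>2 * (norm v)\<^sup>2)
        \<longlonglongrightarrow> m + 2 * t * (Re (cinner \<eta> v) - Re a) + t\<^sup>2 * (norm v)\<^sup>2"
        by (intro tendsto_intros Qlim \<eta>)
      ultimately have "m \<le> m + 2 * t * (Re (cinner \<eta> v) - Re a) + t\<^sup>2 * (norm v)\<^sup>2"
        by (meson LIMSEQ_le_const)
      then show ?thesis by simp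
    qed
    define d where "d = Re (cinner \<eta> v) - Re a"
    \<comment> \<open>With constant term 0 the quadratic lemma forces \<open>d = 0\<close>.\<close>
    have "(cmod (complex_of_real d))\<^sup>2 \<le> 0 * (norm v)\<^sup>2"
    proof (rule cmod_square_le_if_quadratic_nonneg)
      fix c :: complex
      have "0 \<le> 2 * Re c * d + (Re c)\<^sup>2 * (norm v)\<^sup>2" using pos[of "Re c"] by (simp add: d_def)
      also have "\<dots> \<le> 2 * Re c * d + (cmod c)\<^sup>2 * (norm v)\<^sup>2"
        by (intro add_left_mono mult_right_mono) (auto simp: cmod_power2)
      finally show "0 \<le> 0 + 2 * Re (c * complex_of_real d) + (cmod c)\<^sup>2 * (norm v)\<^sup>2" by simp
    qed simp
    then show ?thesis by (simp add: d_def Re_cinner_commute[of v])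
  qed
  \<comment> \<open>The imaginary part comes from the real part at
    \<open>\<i> *\<^sub>C v\<close>.\<close>
  have eq: "a = cinner v \<eta>" if "(v, a) \<in> G" for v a
    using Re_eq[OF that] Re_eq[OF scale[OF that, of \<i>]]
    by (simp add: cinner_scaleC_left complex_eq_iff)
  have "\<eta> \<in> closure (fst ` G)"
    using \<eta> p(1) by (auto simp: closure_sequential intro!: exI[of _ "\<lambda>n. fst (p n)"])
  \<comment> \<open>No sign of \<open>B\<close> is known: for negative \<open>B\<close> every first
    component of \<open>G\<close> is zero, and then so is \<open>\<eta>\<close>. The bound itself
    comes from testing the functional on \<open>\<eta>\<close>, a limit of first components.\<close>
  moreover have "norm \<eta> \<le> B \<or> \<eta> = 0"
  proof -
    have "cmod (cinner (fst (p n)) \<eta>) \<le> B * norm (fst (p n))" for n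
      using B[of "fst (p n)" "snd (p n)"] eq[of "fst (p n)" "snd (p n)"] p(1)[of n] by simp
    moreover have "(\<lambda>n. cmod (cinner (fst (p n)) \<eta>)) \<longlonglongrightarrow> cmod (cinner \<eta> \<eta>)"
      "(\<lambda>n. B * norm (fst (p n))) \<longlonglongrightarrow> B * norm \<eta>"
      by (intro tendsto_intros \<eta>)+
    ultimately have "cmod (cinner \<eta> \<eta>) \<le> B * norm \<eta>"
      by (meson LIMSEQ_le)
    then show ?thesis
      by (auto simp: cinner_self norm_mult power2_eq_square mult_le_cancel_right)
  qed
  ultimately show ?thesis using that eq by blast
qed

lemma bounded_ops_apply_scaleC: "a \<in> bounded_ops \<Longrightarrow> blinfun_apply a (c *\<^sub>C v) = c *\<^sub>C blinfun_apply a v"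
  by (simp add: bounded_ops_def)

text \<open>\<open>G\<close> is a bounded, possibly only partially defined operator given by its
  graph, and \<open>S\<close> is its adjoint: \<open>S w\<close> represents the functional taking
  \<open>v\<close> to \<open>cinner a w\<close>. Adjoints, orthogonal projections, the Radon-Nikodym
  derivative and tensor products of operators all arise from this one construction.\<close>

lemma graph_operator:
  fixes G :: "('h::chilbert_space \<times> 'h) set"
  assumes zero: "(0, 0) \<in> G"
    and add: "\<And>v a w b. (v, a) \<in> G \<Longrightarrow> (w, b) \<in> G \<Longrightarrow> (v + w, a + b) \<in> G"
    and scale: "\<And>c v a. (v, a) \<in> G \<Longrightarrow> (c *\<^sub>C v, c *\<^sub>C a) \<in> G"
    and C: "0 \<le> C" "\<And>v a. (v, a) \<in> G \<Longrightarrow> norm a \<le> C * norm v"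
  obtains S where "S \<in> bounded_ops" "\<And>w. blinfun_apply S w \<in> closure (fst ` G)" "norm S \<le> C"
    "\<And>v a w. (v, a) \<in> G \<Longrightarrow> cinner a w = cinner v (blinfun_apply S w)"
proof -
  have D: "\<And>v w. v \<in> fst ` G \<Longrightarrow> w \<in> fst ` G \<Longrightarrow> v + w \<in> fst ` G"
    "\<And>c v. v \<in> fst ` G \<Longrightarrow> c *\<^sub>C v \<in> fst ` G"
    using add scale by (force simp: image_iff)+
  have "\<exists>u. u \<in> closure (fst ` G) \<and> norm u \<le> C * norm w \<and> (\<forall>v a. (v, a) \<in> G \<longrightarrow> cinner a w = cinner v u)" for w
  proof (rule Riesz_graph[of "(\<lambda>(v, a). (v, cinner a w)) ` G" "C * norm w"], goal_cases)
    case 1 show ?case using zero by (force simp: image_iff cinner.zero_left)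
  next
    case (2 v a v' b)
    then show ?case using add by (force simp: image_iff cinner.add_left)
  next
    case (3 c v a)
    then show ?case using scale by (force simp: image_iff cinner_scaleC_left)
  next
    case (4 v a)
    then obtain a' where "(v, a') \<in> G" "a = cinner a' w" by auto
    then have "cmod a \<le> norm a' * norm w" "norm a' \<le> C * norm v"
      using cinner_Cauchy_Schwarz C by auto
    then show ?case
      by (smt (verit) mult.assoc mult.commute mult_right_mono norm_ge_zero)
  next
    case (5 \<eta>)
    have "fst ` (\<lambda>(v, a). (v, cinner a w)) ` G = fst ` G" by force
    with 5 show ?case using C(1) by (intro exI[of _ \<eta>]) (force simp: image_iff)
  qed
  then obtain u where u: "\<And>w. u w \<in> closure (fst ` G)" "\<And>w. norm (u w) \<le> C * norm w"
    "\<And>w v a. (v, a) \<in> G \<Longrightarrow> cinner a w = cinner v (u w)"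
    by metis
  have uniq: "x = y" if "x \<in> closure (fst ` G)" "y \<in> closure (fst ` G)"
    "\<And>v a. (v, a) \<in> G \<Longrightarrow> cinner v x = cinner v y" for x y
    by (rule closure_subspace_eqI[OF D that(1,2)]) (use that(3) in auto)
  have uadd: "u (x + y) = u x + u y" for x y
    by (rule uniq) (auto intro!: closure_add_scaleC D u simp: cinner.add_right simp flip: u(3))
  have uscale: "u (c *\<^sub>C x) = c *\<^sub>C u x" for c x
    by (rule uniq) (auto intro!: closure_add_scaleC D u simp: cinner_scaleC_right simp flip: u(3))
  have "bounded_linear u"
    by (rule bounded_linear_intro[where K = C]) (auto simp: uadd uscale scaleR_scaleC u(2) mult.commute)
  then have S: "blinfun_apply (Blinfun u) = u" by (rule bounded_linear_Blinfun_apply)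
  show ?thesis
  proof (rule that)
    show "Blinfun u \<in> bounded_ops" by (simp add: bounded_ops_def S uscale)
    show "norm (Blinfun u) \<le> C" by (rule norm_blinfun_bound) (simp_all add: C S u(2))
  qed (simp_all only: S u)
qed

lemma adj_eqI:
  assumes "\<And>\<xi> \<eta>. cinner (blinfun_apply a \<xi>) \<eta> = cinner \<xi> (blinfun_apply b \<eta>)"
  shows "adj a = b"
  unfolding adj_def
proof (rule the_equality)
  show "b' = b" if "\<forall>\<xi> \<eta>. cinner (blinfun_apply a \<xi>) \<eta> = cinner \<xi> (blinfun_apply b' \<eta>)" for b'
    using that assms by (intro blinfun_eqI cinner_ext) metis
qed (use assms in blast)

lemma adj_exists:
  assumes "a \<in> bounded_ops"
  shows "adj a \<in> bounded_ops" "norm (adj a) \<le> norm a"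
    "cinner (blinfun_apply a \<xi>) \<eta> = cinner \<xi> (blinfun_apply (adj a) \<eta>)"
proof -
  obtain S where S: "S \<in> bounded_ops" "norm S \<le> norm a"
    "\<And>v w. cinner (blinfun_apply a v) w = cinner v (blinfun_apply S w)"
    by (rule graph_operator[of "range (\<lambda>v. (v, blinfun_apply a v))" "norm a"])
      (auto simp: image_iff blinfun.add_right bounded_ops_apply_scaleC[OF assms] norm_blinfun)
  have "adj a = S" by (rule adj_eqI) (rule S)
  with S show "adj a \<in> bounded_ops" "norm (adj a) \<le> norm a"
    "cinner (blinfun_apply a \<xi>) \<eta> = cinner \<xi> (blinfun_apply (adj a) \<eta>)" by auto
qed

section \<open>Bounded operators\<close>

lemma bounded_opsI: "(\<And>c v. blinfun_apply a (c *\<^sub>C v) = c *\<^sub>C blinfun_apply a v) \<Longrightarrow> a \<in> bounded_ops"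
  by (simp add: bounded_ops_def)

lemma bounded_ops_add: "a \<in> bounded_ops \<Longrightarrow> b \<in> bounded_ops \<Longrightarrow> a + b \<in> bounded_ops"
  by (auto intro!: bounded_opsI simp: bounded_ops_apply_scaleC blinfun.add_left scaleC_add_right)

lemma bounded_ops_scaleC: "a \<in> bounded_ops \<Longrightarrow> c *\<^sub>C a \<in> bounded_ops"
  by (auto intro!: bounded_opsI simp: bounded_ops_apply_scaleC blinfun_apply_scaleC scaleC_scaleC mult.commute)

lemma bounded_ops_scaleR: "a \<in> bounded_ops \<Longrightarrow> r *\<^sub>R a \<in> bounded_ops"
  by (simp add: scaleR_scaleC bounded_ops_scaleC)

lemma bounded_ops_compose: "a \<in> bounded_ops \<Longrightarrow> b \<in> bounded_ops \<Longrightarrow> a o\<^sub>L b \<in> bounded_ops"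
  by (auto intro!: bounded_opsI simp: bounded_ops_apply_scaleC)

lemma bounded_ops_id: "id_blinfun \<in> bounded_ops"
  by (auto intro!: bounded_opsI)

lemma bounded_ops_zero: "0 \<in> bounded_ops"
  by (auto intro!: bounded_opsI)

lemma bounded_ops_diff: "a \<in> bounded_ops \<Longrightarrow> b \<in> bounded_ops \<Longrightarrow> a - b \<in> bounded_ops"
  by (auto intro!: bounded_opsI simp: bounded_ops_apply_scaleC blinfun.diff_left scaleC_diff_right)

lemma bounded_ops_sum: "(\<And>i. i \<in> I \<Longrightarrow> a i \<in> bounded_ops) \<Longrightarrow> (\<Sum>i\<in>I. a i) \<in> bounded_ops"
  by (induction I rule: infinite_finite_induct) (auto intro: bounded_ops_add bounded_ops_zero)

lemma bounded_ops_LIMSEQ: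
  assumes "Z \<longlonglongrightarrow> Y" "\<And>n. Z n \<in> bounded_ops"
  shows "Y \<in> bounded_ops"
proof (rule bounded_opsI)
  fix c v
  have "(\<lambda>n. blinfun_apply (Z n) (c *\<^sub>C v)) \<longlonglongrightarrow> blinfun_apply Y (c *\<^sub>C v)"
    by (intro blinfun.tendsto assms tendsto_const)
  moreover have "(\<lambda>n. blinfun_apply (Z n) (c *\<^sub>C v)) \<longlonglongrightarrow> c *\<^sub>C blinfun_apply Y v"
    unfolding bounded_ops_apply_scaleC[OF assms(2)] by (intro tendsto_scaleC blinfun.tendsto assms tendsto_const)
  ultimately show "blinfun_apply Y (c *\<^sub>C v) = c *\<^sub>C blinfun_apply Y v"
    by (rule LIMSEQ_unique)
qed

lemmas bounded_ops_intros = bounded_ops_add bounded_ops_scaleC bounded_ops_scaleR bounded_ops_compose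
  bounded_ops_id bounded_ops_zero bounded_ops_diff bounded_ops_sum adj_exists(1)

lemma cinner_adj_right: "a \<in> bounded_ops \<Longrightarrow> cinner \<xi> (blinfun_apply (adj a) \<eta>) = cinner (blinfun_apply a \<xi>) \<eta>"
  by (simp add: adj_exists)

lemma cinner_adj_left: "a \<in> bounded_ops \<Longrightarrow> cinner (blinfun_apply (adj a) \<xi>) \<eta> = cinner \<xi> (blinfun_apply a \<eta>)"
  by (metis adj_exists(3) cinner_commute)

lemma adj_add: "a \<in> bounded_ops \<Longrightarrow> b \<in> bounded_ops \<Longrightarrow> adj (a + b) = adj a + adj b"
  by (rule adj_eqI) (simp add: blinfun.add_left cinner_add_left cinner_add_right cinner_adj_right)

lemma adj_diff: "a \<in> bounded_ops \<Longrightarrow> b \<in> bounded_ops \<Longrightarrow> adj (a - b) = adj a - adj b"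
  by (rule adj_eqI) (simp add: blinfun.diff_left cinner.diff_left cinner.diff_right cinner_adj_right)

lemma adj_scaleC: "a \<in> bounded_ops \<Longrightarrow> adj (c *\<^sub>C a) = cnj c *\<^sub>C adj a"
  by (rule adj_eqI) (simp add: blinfun_apply_scaleC cinner_scaleC_left cinner_scaleC_right cinner_adj_right)

lemma adj_compose: "a \<in> bounded_ops \<Longrightarrow> b \<in> bounded_ops \<Longrightarrow> adj (a o\<^sub>L b) = adj b o\<^sub>L adj a"
  by (rule adj_eqI) (simp add: cinner_adj_right)

lemma adj_adj: "a \<in> bounded_ops \<Longrightarrow> adj (adj a) = a"
  by (rule adj_eqI) (simp add: cinner_adj_left)

lemma adj_id: "adj id_blinfun = id_blinfun"
  by (rule adj_eqI) simp

lemma blinfun_compose_simps: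
  "(a + b) o\<^sub>L c = (a o\<^sub>L c) + (b o\<^sub>L c)" "c o\<^sub>L (a + b) = (c o\<^sub>L a) + (c o\<^sub>L b)"
  "(a - b) o\<^sub>L c = (a o\<^sub>L c) - (b o\<^sub>L c)" "c o\<^sub>L (a - b) = (c o\<^sub>L a) - (c o\<^sub>L b)"
  "(r *\<^sub>R a) o\<^sub>L c = r *\<^sub>R (a o\<^sub>L c)" "c o\<^sub>L (r *\<^sub>R a) = r *\<^sub>R (c o\<^sub>L a)"
  "a o\<^sub>L id_blinfun = a" "id_blinfun o\<^sub>L a = a"
  for a b c :: "'a::real_normed_vector \<Rightarrow>\<^sub>L 'a"
  by (auto intro!: blinfun_eqI simp: blinfun.bilinear_simps)

lemma blinfun_compose_assoc: "(a o\<^sub>L b) o\<^sub>L c = a o\<^sub>L (b o\<^sub>L c)"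
  by (auto intro!: blinfun_eqI)

lemma blinfun_compose_scaleC_left: "(c *\<^sub>C a) o\<^sub>L b = c *\<^sub>C (a o\<^sub>L b)"
  by (auto intro!: blinfun_eqI simp: blinfun_apply_scaleC)

lemma blinfun_compose_scaleC_right: "a \<in> bounded_ops \<Longrightarrow> a o\<^sub>L (c *\<^sub>C b) = c *\<^sub>C (a o\<^sub>L b)"
  by (auto intro!: blinfun_eqI simp: blinfun_apply_scaleC bounded_ops_apply_scaleC)

lemma positive_op_iff:
  "positive_op a \<longleftrightarrow> (\<forall>\<xi>. Im (cinner (blinfun_apply a \<xi>) \<xi>) = 0 \<and> 0 \<le> Re (cinner (blinfun_apply a \<xi>) \<xi>))"
  by (auto simp: positive_op_def complex_nonneg_Reals_iff)

lemma positive_op_adj_compose: "a \<in> bounded_ops \<Longrightarrow> positive_op (adj a o\<^sub>L a)"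
  by (simp add: positive_op_iff cinner_adj_left cinner_self)

lemma positive_op_add: "positive_op a \<Longrightarrow> positive_op b \<Longrightarrow> positive_op (a + b)"
  by (simp add: positive_op_iff blinfun.add_left cinner_add_left)

lemma positive_op_scaleR: "0 \<le> r \<Longrightarrow> positive_op a \<Longrightarrow> positive_op (r *\<^sub>R a)"
  by (simp add: positive_op_iff blinfun.scaleR_left cinner_scaleR_left)

lemma positive_op_zero [simp]: "positive_op 0"
  by (simp add: positive_op_iff cinner.zero_left)

lemma positive_op_id [simp]: "positive_op id_blinfun"
  by (simp add: positive_op_iff cinner_self)

text \<open>Polarization with \<open>x + y\<close> and \<open>x + \<i> *\<^sub>C y\<close>. Complex
  linearity matters: the antilinear map taking \<open>(u, v)\<close> to
  \<open>(- cnj v, cnj u)\<close> has a vanishing quadratic form.\<close>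

lemma bounded_ops_eq_zeroI:
  assumes b: "b \<in> bounded_ops" and z: "\<And>\<xi>. cinner (blinfun_apply b \<xi>) \<xi> = 0"
  shows "b = 0"
proof -
  have "cinner (blinfun_apply b x) y = 0" for x y
  proof -
    have 1: "cinner (blinfun_apply b x) y + cinner (blinfun_apply b y) x = 0"
      using z[of "x + y"] z[of x] z[of y]
      by (simp add: blinfun.add_right cinner_add_left cinner_add_right add.commute)
    have "- \<i> * cinner (blinfun_apply b x) y + \<i> * cinner (blinfun_apply b y) x = 0"
      using z[of "x + \<i> *\<^sub>C y"] z[of x] z[of y]
      by (simp add: blinfun.add_right bounded_ops_apply_scaleC[OF b] cinner_add_left cinner_add_right
          cinner_scaleC_left cinner_scaleC_right add.commute)
    then have "cinner (blinfun_apply b x) y = cinner (blinfun_apply b y) x" by simp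
    with 1 show ?thesis by simp
  qed
  then have "blinfun_apply b x = 0" for x
    using cinner_self[of "blinfun_apply b x"] by simp
  then show ?thesis by (auto intro: blinfun_eqI)
qed

lemma positive_op_adj:
  assumes "a \<in> bounded_ops" "positive_op a"
  shows "adj a = a"
proof -
  have "adj a - a = 0"
  proof (rule bounded_ops_eq_zeroI)
    fix \<xi>
    have "cinner (blinfun_apply (adj a) \<xi>) \<xi> = cnj (cinner (blinfun_apply a \<xi>) \<xi>)"
      using assms(1) by (simp add: cinner_adj_left cinner_commute[of \<xi>])
    also have "\<dots> = cinner (blinfun_apply a \<xi>) \<xi>"
      using assms(2) by (simp add: positive_op_iff complex_eq_iff)
    finally show "cinner (blinfun_apply (adj a - a) \<xi>) \<xi> = 0"
      by (simp add: blinfun.diff_left cinner.diff_left)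
  qed (intro bounded_ops_intros assms)
  then show ?thesis by simp
qed

lemma positive_op_symmetric:
  "a \<in> bounded_ops \<Longrightarrow> positive_op a \<Longrightarrow> cinner (blinfun_apply a \<xi>) \<eta> = cinner \<xi> (blinfun_apply a \<eta>)"
  by (metis cinner_adj_left positive_op_adj)

lemma positive_op_Cauchy_Schwarz:
  assumes a: "a \<in> bounded_ops" "positive_op a"
  shows "(cmod (cinner (blinfun_apply a v) w))\<^sup>2 \<le>
    Re (cinner (blinfun_apply a v) v) * Re (cinner (blinfun_apply a w) w)"
proof (rule cmod_square_le_if_quadratic_nonneg)
  fix c
  have "cinner (blinfun_apply a w) v = cnj (cinner (blinfun_apply a v) w)"
    by (simp add: positive_op_symmetric[OF a, of w] cinner_commute[of w])
  moreover have "0 \<le> Re (cinner (blinfun_apply a (v + cnj c *\<^sub>C w)) (v + cnj c *\<^sub>C w))"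
    using a(2) by (simp add: positive_op_iff)
  ultimately show "0 \<le> Re (cinner (blinfun_apply a v) v) + 2 * Re (c * cinner (blinfun_apply a v) w) +
      (cmod c)\<^sup>2 * Re (cinner (blinfun_apply a w) w)"
    by (simp add: blinfun.add_right bounded_ops_apply_scaleC[OF a(1)] cinner_add_left cinner_add_right
        cinner_scaleC_left cinner_scaleC_right cmod_power2 algebra_simps)
      (use a(2) in \<open>simp add: positive_op_iff power2_eq_square algebra_simps\<close>)
qed (use a(2) in \<open>simp add: positive_op_iff\<close>)

section \<open>The order on operators\<close>

definition op_le :: "('h::chilbert_space \<Rightarrow>\<^sub>L 'h) \<Rightarrow> ('h \<Rightarrow>\<^sub>L 'h) \<Rightarrow> bool" (infix "\<preceq>" 50)
  where "a \<preceq> b \<longleftrightarrow> positive_op (b - a)"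

lemma op_le_refl [simp]: "a \<preceq> a"
  by (simp add: op_le_def)

lemma op_le_trans: "a \<preceq> b \<Longrightarrow> b \<preceq> c \<Longrightarrow> a \<preceq> c"
  using positive_op_add[of "b - a" "c - b"] by (simp add: op_le_def)

lemma op_le_antisym: "a \<in> bounded_ops \<Longrightarrow> b \<in> bounded_ops \<Longrightarrow> a \<preceq> b \<Longrightarrow> b \<preceq> a \<Longrightarrow> a = b"
  using bounded_ops_eq_zeroI[of "b - a"]
  by (auto simp: op_le_def positive_op_iff blinfun.diff_left cinner.diff_left complex_eq_iff
      intro!: bounded_ops_intros intro: antisym)

text \<open>Cauchy-Schwarz for the form of \<open>a\<close> at \<open>v\<close> and
  \<open>a v\<close>, divided by the squared norm of \<open>a v\<close>. This is the form version of
  \<open>a o\<^sub>L a \<preceq> a\<close>, and the source of strong convergence of monotone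
  chains.\<close>

lemma norm_square_le_cinner:
  assumes a: "a \<in> bounded_ops" "0 \<preceq> a" "a \<preceq> id_blinfun"
  shows "(norm (blinfun_apply a v))\<^sup>2 \<le> Re (cinner (blinfun_apply a v) v)"
proof (cases "blinfun_apply a v = 0")
  case False
  let ?w = "blinfun_apply a v"
  have "(cmod (cinner ?w ?w))\<^sup>2 \<le> Re (cinner ?w v) * Re (cinner (blinfun_apply a ?w) ?w)"
    using a by (intro positive_op_Cauchy_Schwarz) (auto simp: op_le_def)
  also have "\<dots> \<le> Re (cinner ?w v) * (norm ?w)\<^sup>2"
    using a by (intro mult_left_mono)
      (auto simp: op_le_def positive_op_iff blinfun.diff_left cinner.diff_left cinner_self)
  finally have "(norm ?w)\<^sup>2 * (norm ?w)\<^sup>2 \<le> Re (cinner ?w v) * (norm ?w)\<^sup>2"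
    by (simp add: cinner_self power2_eq_square norm_mult)
  then show ?thesis using False by (subst (asm) mult_le_cancel_right) auto
qed (simp add: cinner.zero_left)

lemma norm_le_one_if_contraction:
  assumes "a \<in> bounded_ops" "0 \<preceq> a" "a \<preceq> id_blinfun"
  shows "norm (blinfun_apply a v) \<le> norm v"
proof -
  have "(norm (blinfun_apply a v))\<^sup>2 \<le> Re (cinner (blinfun_apply a v) v)"
    by (rule norm_square_le_cinner[OF assms])
  also have "\<dots> \<le> (norm v)\<^sup>2"
    using assms(3) by (simp add: op_le_def positive_op_iff blinfun.diff_left cinner.diff_left cinner_self)
  finally show ?thesis by (simp add: power2_le_iff_abs_le)
qed

lemma op_square_le:
  assumes a: "a \<in> bounded_ops" "0 \<preceq> a" "a \<preceq> id_blinfun"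
  shows "a o\<^sub>L a \<preceq> a"
proof -
  have p: "positive_op a" using a(2) by (simp add: op_le_def)
  have "Im (cinner (blinfun_apply (a - (a o\<^sub>L a)) v) v) = 0 \<and> 0 \<le> Re (cinner (blinfun_apply (a - (a o\<^sub>L a)) v) v)" for v
    using norm_square_le_cinner[OF a, of v] p
    by (simp add: positive_op_symmetric[OF a(1) p, of "blinfun_apply a v"] blinfun.diff_left
        cinner.diff_left cinner_self positive_op_iff)
  then show ?thesis by (simp add: op_le_def positive_op_iff)
qed

section \<open>Square roots of positive operators\<close>

primrec sqrt_iter :: "('h::chilbert_space \<Rightarrow>\<^sub>L 'h) \<Rightarrow> nat \<Rightarrow> ('h \<Rightarrow>\<^sub>L 'h)" where
  "sqrt_iter B 0 = 0"
| "sqrt_iter B (Suc n) = (1/2) *\<^sub>R (B + (sqrt_iter B n o\<^sub>L sqrt_iter B n))"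

text \<open>The same iteration for the scalar \<open>B = 1\<close>. It majorizes the norms of the
  operator iterates and of their increments, so that a bounded monotone real sequence yields
  convergence in norm.\<close>

primrec sqrt_iter_real :: "nat \<Rightarrow> real" where
  "sqrt_iter_real 0 = 0"
| "sqrt_iter_real (Suc n) = (1 + (sqrt_iter_real n)\<^sup>2) / 2"

lemma sqrt_iter_real_bounds:
  "0 \<le> sqrt_iter_real n \<and> sqrt_iter_real n \<le> 1 \<and> sqrt_iter_real n \<le> sqrt_iter_real (Suc n)"
proof (induction n)
  case (Suc n)
  then have "(sqrt_iter_real n)\<^sup>2 \<le> (sqrt_iter_real (Suc n))\<^sup>2" by (intro power_mono) auto
  moreover have "(sqrt_iter_real n)\<^sup>2 \<le> 1" using Suc by (simp add: power_le_one)
  ultimately show ?case by simp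
qed simp

lemma sqrt_iter_norm_diff:
  assumes "norm B \<le> 1"
  shows "norm (sqrt_iter B n) \<le> sqrt_iter_real n \<and>
    norm (sqrt_iter B (Suc n) - sqrt_iter B n) \<le> sqrt_iter_real (Suc n) - sqrt_iter_real n"
proof (induction n)
  case 0
  show ?case using assms by simp
next
  case (Suc n)
  let ?a = "sqrt_iter B (Suc n)" and ?b = "sqrt_iter B n"
  let ?x = "sqrt_iter_real (Suc n)" and ?y = "sqrt_iter_real n"
  have a: "norm ?a \<le> ?x"
  proof -
    have "norm (?b o\<^sub>L ?b) \<le> ?y\<^sup>2"
      using norm_blinfun_compose[of ?b ?b] mult_mono[of "norm ?b" ?y "norm ?b" ?y] Suc
        sqrt_iter_real_bounds[of n] by (simp add: power2_eq_square)
    then show ?thesis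
      using norm_triangle_ineq[of B "?b o\<^sub>L ?b"] assms by simp
  qed
  have "sqrt_iter B (Suc (Suc n)) - ?a = (1/2) *\<^sub>R ((?a o\<^sub>L ?a) - (?b o\<^sub>L ?b))"
    by (simp only: sqrt_iter.simps scaleR_diff_right[symmetric] add_diff_cancel_left)
  \<comment> \<open>This splitting of a difference of squares requires no commutation; its scalar
    counterpart is \<open>x * (x - y) + (x - y) * y\<close>.\<close>
  also have "(?a o\<^sub>L ?a) - (?b o\<^sub>L ?b) = (?a o\<^sub>L (?a - ?b)) + ((?a - ?b) o\<^sub>L ?b)"
    by (simp only: blinfun_compose_simps) simp
  finally have "norm (sqrt_iter B (Suc (Suc n)) - ?a) =
      (1/2) * norm ((?a o\<^sub>L (?a - ?b)) + ((?a - ?b) o\<^sub>L ?b))"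
    by (simp only: norm_scaleR)
  also have "norm ((?a o\<^sub>L (?a - ?b)) + ((?a - ?b) o\<^sub>L ?b)) \<le> norm ?a * norm (?a - ?b) + norm (?a - ?b) * norm ?b"
    by (intro norm_triangle_mono norm_blinfun_compose)
  also have "\<dots> \<le> ?x * (?x - ?y) + (?x - ?y) * ?y"
    using Suc a sqrt_iter_real_bounds[of n] sqrt_iter_real_bounds[of "Suc n"]
    by (intro add_mono mult_mono) (auto simp del: sqrt_iter.simps sqrt_iter_real.simps)
  finally have "norm (sqrt_iter B (Suc (Suc n)) - ?a) \<le> (1/2) * (?x * (?x - ?y) + (?x - ?y) * ?y)"
    by simp
  also have "\<dots> = sqrt_iter_real (Suc (Suc n)) - ?x"
  proof -
    have "?y * ?y = 2 * ?x - 1" by (simp add: power2_eq_square field_simps)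
    then show ?thesis
      unfolding sqrt_iter_real.simps(2)[of "Suc n"]
      by (simp add: power2_eq_square algebra_simps del: sqrt_iter_real.simps)
  qed
  finally show ?case using a by simp
qed

lemma sqrt_iter_Cauchy:
  assumes "norm B \<le> 1"
  shows "Cauchy (sqrt_iter B)"
proof -
  have tele: "norm (sqrt_iter B (n + k) - sqrt_iter B n) \<le> sqrt_iter_real (n + k) - sqrt_iter_real n" for n k
  proof (induction k)
    case (Suc k)
    then show ?case
      using sqrt_iter_norm_diff[OF assms, of "n + k"]
        norm_triangle_ineq[of "sqrt_iter B (Suc (n + k)) - sqrt_iter B (n + k)" "sqrt_iter B (n + k) - sqrt_iter B n"]
      by (simp del: sqrt_iter.simps sqrt_iter_real.simps)
  qed simp
  have "incseq sqrt_iter_real"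
    using sqrt_iter_real_bounds by (intro incseq_SucI) blast
  then obtain L where "sqrt_iter_real \<longlonglongrightarrow> L"
    by (rule incseq_convergent[of _ 1]) (use sqrt_iter_real_bounds in blast)
  then have "convergent sqrt_iter_real" by (rule convergentI)
  then have C: "Cauchy sqrt_iter_real" by (rule convergent_Cauchy)
  show ?thesis
  proof (rule metric_CauchyI)
    fix e :: real assume "0 < e"
    then obtain N where N: "\<And>m n. m \<ge> N \<Longrightarrow> n \<ge> N \<Longrightarrow> dist (sqrt_iter_real m) (sqrt_iter_real n) < e"
      using C by (meson Cauchy_def)
    have le: "dist (sqrt_iter B m) (sqrt_iter B n) < e" if "n \<le> m" "n \<ge> N" for m n
      using tele[of n "m - n"] N[of m n] that by (simp add: dist_norm)
    have "dist (sqrt_iter B m) (sqrt_iter B n) < e" if "m \<ge> N" "n \<ge> N" for m n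
      using le[of n m] le[of m n] that by (cases "n \<le> m") (auto simp: dist_commute)
    then show "\<exists>M. \<forall>m\<ge>M. \<forall>n\<ge>M. dist (sqrt_iter B m) (sqrt_iter B n) < e" by blast
  qed
qed

lemma blinfun_compose_tendsto:
  "(f \<longlongrightarrow> a) F \<Longrightarrow> (g \<longlongrightarrow> b) F \<Longrightarrow> ((\<lambda>x. f x o\<^sub>L g x) \<longlongrightarrow> a o\<^sub>L b) F"
  using bounded_bilinear.tendsto[OF bounded_bilinear_blinfun_compose] .

text \<open>The limit \<open>Z\<close> of the iteration satisfies \<open>2 Z = (1 - X) + Z\<^sup>2\<close>, that is \<open>(1 - Z)\<^sup>2 = X\<close>.\<close>

lemma op_sqrt_contraction:
  assumes X: "X \<in> bounded_ops" "0 \<preceq> X" "X \<preceq> id_blinfun"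
  obtains Y where "Y \<in> bounded_ops" "positive_op Y" "Y o\<^sub>L Y = X"
    "\<forall>T. T o\<^sub>L X = X o\<^sub>L T \<longrightarrow> T o\<^sub>L Y = Y o\<^sub>L T"
proof -
  define B where "B = id_blinfun - X"
  have B: "B \<in> bounded_ops" "positive_op B"
    using X by (auto simp: B_def op_le_def intro!: bounded_ops_intros)
  have "norm B \<le> 1"
  proof (rule norm_blinfun_bound)
    show "norm (blinfun_apply B v) \<le> 1 * norm v" for v
      using norm_le_one_if_contraction[OF B(1), of v] B(2) X(2) by (simp add: op_le_def B_def)
  qed simp
  obtain Z where Z: "sqrt_iter B \<longlonglongrightarrow> Z"
    using sqrt_iter_Cauchy[OF \<open>norm B \<le> 1\<close>] by (auto simp: Cauchy_convergent_iff convergent_def)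
  have "(\<lambda>n. (1/2) *\<^sub>R (B + (sqrt_iter B n o\<^sub>L sqrt_iter B n))) \<longlonglongrightarrow> (1/2) *\<^sub>R (B + (Z o\<^sub>L Z))"
    by (intro tendsto_intros blinfun_compose_tendsto Z)
  moreover have "(\<lambda>n. (1/2) *\<^sub>R (B + (sqrt_iter B n o\<^sub>L sqrt_iter B n))) \<longlonglongrightarrow> Z"
    using LIMSEQ_Suc[OF Z] by simp
  ultimately have eq: "Z = (1/2) *\<^sub>R (B + (Z o\<^sub>L Z))" by (rule LIMSEQ_unique[symmetric])
  \<comment> \<open>Every iterate is a polynomial in \<open>B\<close>, and commutation passes to the
    limit. This clause later places square roots inside von Neumann algebras.\<close>
  have comm: "T o\<^sub>L Z = Z o\<^sub>L T" if T: "T o\<^sub>L B = B o\<^sub>L T" for T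
  proof -
    have "T o\<^sub>L sqrt_iter B n = sqrt_iter B n o\<^sub>L T" for n
    proof (induction n)
      case (Suc n)
      let ?Z = "sqrt_iter B n"
      have "T o\<^sub>L (?Z o\<^sub>L ?Z) = (?Z o\<^sub>L ?Z) o\<^sub>L T"
        by (simp add: Suc flip: blinfun_compose_assoc) (simp add: Suc blinfun_compose_assoc)
      then show ?case
        by (simp add: blinfun_compose_simps T)
    qed simp
    then show ?thesis
      using blinfun_compose_tendsto[OF tendsto_const Z, of T] blinfun_compose_tendsto[OF Z tendsto_const, of T]
      by (simp add: LIMSEQ_unique)
  qed
  have ZA: "sqrt_iter B n \<in> bounded_ops \<and> adj (sqrt_iter B n) = sqrt_iter B n" for n
  proof (induction n)
    case 0
    show ?case by (auto intro!: bounded_ops_intros adj_eqI simp: cinner.zero_left cinner.zero_right)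
  next
    case (Suc n)
    then show ?case
      by (auto intro!: bounded_ops_intros B
          simp: scaleR_scaleC adj_scaleC adj_add adj_compose bounded_ops_intros B positive_op_adj[OF B])
  qed
  have Zb: "Z \<in> bounded_ops" using bounded_ops_LIMSEQ[OF Z] ZA by blast
  have Zsym: "cinner (blinfun_apply Z v) w = cinner v (blinfun_apply Z w)" for v w
  proof (rule LIMSEQ_unique)
    show "(\<lambda>n. cinner (blinfun_apply (sqrt_iter B n) v) w) \<longlonglongrightarrow> cinner (blinfun_apply Z v) w"
      by (intro tendsto_intros blinfun.tendsto Z)
    have "(\<lambda>n. cinner v (blinfun_apply (sqrt_iter B n) w)) \<longlonglongrightarrow> cinner v (blinfun_apply Z w)"
      by (intro tendsto_intros blinfun.tendsto Z)
    moreover have "cinner v (blinfun_apply (sqrt_iter B n) w) = cinner (blinfun_apply (sqrt_iter B n) v) w" for n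
      using cinner_adj_right[of "sqrt_iter B n" v w] ZA[of n] by simp
    ultimately show "(\<lambda>n. cinner (blinfun_apply (sqrt_iter B n) v) w) \<longlonglongrightarrow> cinner v (blinfun_apply Z w)"
      by simp
  qed
  have Znorm: "norm Z \<le> 1"
  proof (rule LIMSEQ_le_const2[OF tendsto_norm[OF Z]])
    show "\<exists>N. \<forall>n\<ge>N. norm (sqrt_iter B n) \<le> 1"
      using sqrt_iter_norm_diff[OF \<open>norm B \<le> 1\<close>] sqrt_iter_real_bounds by (meson order_trans)
  qed
  define Y where "Y = id_blinfun - Z"
  show ?thesis
  proof (rule that[of Y])
    show "Y \<in> bounded_ops" unfolding Y_def by (intro bounded_ops_intros Zb)
    have "2 *\<^sub>R Z = B + (Z o\<^sub>L Z)" by (subst eq) simp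
    then show "Y o\<^sub>L Y = X"
      by (simp add: Y_def B_def blinfun_compose_simps scaleR_2 algebra_simps)
    show "\<forall>T. T o\<^sub>L X = X o\<^sub>L T \<longrightarrow> T o\<^sub>L Y = Y o\<^sub>L T"
    proof (intro allI impI)
      fix T assume that: "T o\<^sub>L X = X o\<^sub>L T"
      have "T o\<^sub>L B = B o\<^sub>L T" by (simp add: B_def blinfun_compose_simps that)
      then show "T o\<^sub>L Y = Y o\<^sub>L T" using comm by (simp add: Y_def blinfun_compose_simps)
    qed
    have "Im (cinner (blinfun_apply Z v) v) = 0" for v
      using Zsym[of v v] cinner_commute[of v "blinfun_apply Z v"] by (simp add: complex_eq_iff)
    moreover have "Re (cinner (blinfun_apply Z v) v) \<le> (norm v)\<^sup>2" for v
    proof -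
      have "Re (cinner (blinfun_apply Z v) v) \<le> norm (blinfun_apply Z v) * norm v"
        by (rule order_trans[OF complex_Re_le_cmod cinner_Cauchy_Schwarz])
      also have "norm (blinfun_apply Z v) \<le> 1 * norm v"
        using norm_blinfun[of Z v] Znorm by (meson mult_right_mono norm_ge_zero order_trans)
      finally show ?thesis by (simp add: power2_eq_square mult_right_mono)
    qed
    ultimately show "positive_op Y"
      by (simp add: Y_def positive_op_iff blinfun.diff_left cinner.diff_left cinner_self)
  qed
qed

lemma op_sqrt:
  assumes X: "X \<in> bounded_ops" "positive_op X"
  obtains Y where "Y \<in> bounded_ops" "positive_op Y" "Y o\<^sub>L Y = X"
    "\<forall>T. T o\<^sub>L X = X o\<^sub>L T \<longrightarrow> T o\<^sub>L Y = Y o\<^sub>L T"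
proof -
  \<comment> \<open>The summand 1 keeps \<open>K\<close> positive even for
    \<open>X = 0\<close>.\<close>
  define K where "K = norm X + 1"
  have K: "0 < K" by (simp add: K_def add_nonneg_pos)
  have 1: "(1/K) *\<^sub>R X \<in> bounded_ops" by (intro bounded_ops_intros X)
  have 2: "0 \<preceq> (1/K) *\<^sub>R X" using X K by (simp add: op_le_def positive_op_scaleR)
  have "Re (cinner (blinfun_apply X v) v) \<le> K * (norm v)\<^sup>2" for v
  proof -
    have "Re (cinner (blinfun_apply X v) v) \<le> norm (blinfun_apply X v) * norm v"
      by (rule order_trans[OF complex_Re_le_cmod cinner_Cauchy_Schwarz])
    also have "norm (blinfun_apply X v) \<le> K * norm v"
      using norm_blinfun[of X v] by (simp add: K_def distrib_right add_increasing2)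
    finally show ?thesis by (simp add: power2_eq_square mult_right_mono)
  qed
  then have "Re (cinner (blinfun_apply X v) v) / K \<le> (norm v)\<^sup>2" for v
    using K by (simp only: pos_divide_le_eq mult.commute)
  then have 3: "(1/K) *\<^sub>R X \<preceq> id_blinfun"
    using X(2) by (simp add: op_le_def positive_op_iff blinfun.diff_left blinfun.scaleR_left
        cinner.diff_left cinner_scaleR_left cinner_self)
  obtain Y where Y: "Y \<in> bounded_ops" "positive_op Y" "Y o\<^sub>L Y = (1/K) *\<^sub>R X"
    "\<forall>T. T o\<^sub>L ((1/K) *\<^sub>R X) = ((1/K) *\<^sub>R X) o\<^sub>L T \<longrightarrow> T o\<^sub>L Y = Y o\<^sub>L T"
    by (rule op_sqrt_contraction[OF 1 2 3])
  show ?thesis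
  proof (rule that[of "sqrt K *\<^sub>R Y"])
    show "(sqrt K *\<^sub>R Y) o\<^sub>L (sqrt K *\<^sub>R Y) = X"
    proof -
      have "(sqrt K *\<^sub>R Y) o\<^sub>L (sqrt K *\<^sub>R Y) = (sqrt K * sqrt K) *\<^sub>R (1/K) *\<^sub>R X"
        by (simp only: blinfun_compose_simps(5,6) scaleR_scaleR Y(3) mult.assoc)
      then show ?thesis using K by simp
    qed
    show "\<forall>T. T o\<^sub>L X = X o\<^sub>L T \<longrightarrow> T o\<^sub>L (sqrt K *\<^sub>R Y) = (sqrt K *\<^sub>R Y) o\<^sub>L T"
    proof (intro allI impI)
      fix T assume that: "T o\<^sub>L X = X o\<^sub>L T"
      have "T o\<^sub>L ((1/K) *\<^sub>R X) = ((1/K) *\<^sub>R X) o\<^sub>L T"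
        by (simp only: blinfun_compose_simps(5,6) that)
      from Y(4)[THEN spec, THEN mp, OF this] have "T o\<^sub>L Y = Y o\<^sub>L T" .
      then show "T o\<^sub>L (sqrt K *\<^sub>R Y) = (sqrt K *\<^sub>R Y) o\<^sub>L T"
        by (simp only: blinfun_compose_simps(5,6))
    qed
    show "sqrt K *\<^sub>R Y \<in> bounded_ops" by (rule bounded_ops_scaleR[OF Y(1)])
    show "positive_op (sqrt K *\<^sub>R Y)" by (rule positive_op_scaleR[OF _ Y(2)]) (use K in simp)
  qed
qed

section \<open>Commutants, star algebras and von Neumann algebras\<close>

lemma commutantD: "a \<in> commutant S \<Longrightarrow> s \<in> S \<Longrightarrow> a o\<^sub>L s = s o\<^sub>L a"
  "a \<in> commutant S \<Longrightarrow> a \<in> bounded_ops"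
  unfolding commutant_def by blast+

lemma commutantI:
  "a \<in> bounded_ops \<Longrightarrow> (\<And>s. s \<in> S \<Longrightarrow> a o\<^sub>L s = s o\<^sub>L a) \<Longrightarrow> a \<in> commutant S"
  unfolding commutant_def by blast

lemma subset_bicommutant:
  assumes "S \<subseteq> bounded_ops"
  shows "S \<subseteq> commutant (commutant S)"
proof
  fix s assume s: "s \<in> S"
  show "s \<in> commutant (commutant S)"
    by (rule commutantI) (use s assms commutantD(1)[OF _ s] in \<open>auto simp only: subset_iff\<close>)
qed

locale star_algebra =
  fixes A :: "('h::chilbert_space \<Rightarrow>\<^sub>L 'h) set"
  assumes bounded: "a \<in> A \<Longrightarrow> a \<in> bounded_ops"
    and add: "a \<in> A \<Longrightarrow> b \<in> A \<Longrightarrow> a + b \<in> A"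
    and scaleC: "a \<in> A \<Longrightarrow> c *\<^sub>C a \<in> A"
    and compose: "a \<in> A \<Longrightarrow> b \<in> A \<Longrightarrow> a o\<^sub>L b \<in> A"
    and star: "a \<in> A \<Longrightarrow> adj a \<in> A"
    and ident: "id_blinfun \<in> A"
begin

lemma zero: "0 \<in> A"
  using scaleC[OF ident, of 0] by simp

lemma scaleR: "a \<in> A \<Longrightarrow> r *\<^sub>R a \<in> A"
  by (simp add: scaleR_scaleC scaleC)

lemma diff: "a \<in> A \<Longrightarrow> b \<in> A \<Longrightarrow> a - b \<in> A"
  using add[OF _ scaleC, of a b "-1"] by (simp add: scaleC_minus1)

lemma sum: "(\<And>i. i \<in> I \<Longrightarrow> f i \<in> A) \<Longrightarrow> (\<Sum>i\<in>I. f i) \<in> A"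
  by (induction I rule: infinite_finite_induct) (auto intro: zero add)

lemmas closed = add scaleC compose star ident zero scaleR diff sum

end

locale von_neumann = star_algebra +
  assumes bicommutant: "commutant (commutant A) \<subseteq> A"
begin

text \<open>Whatever commutes with \<open>a\<close> commutes with its root, so the root lies in the
  bicommutant.\<close>

lemma sqrt:
  assumes "a \<in> A" "positive_op a"
  obtains r where "r \<in> A" "positive_op r" "adj r = r" "r o\<^sub>L r = a"
proof -
  obtain r where r: "r \<in> bounded_ops" "positive_op r" "r o\<^sub>L r = a"
    "\<forall>T. T o\<^sub>L a = a o\<^sub>L T \<longrightarrow> T o\<^sub>L r = r o\<^sub>L T"
    using op_sqrt[OF bounded[OF assms(1)] assms(2)] by metis
  have "r \<in> commutant (commutant A)"
    by (rule commutantI[OF r(1)]) (use r(4) commutantD(1)[OF _ assms(1)] in metis)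
  then show ?thesis using that r positive_op_adj bicommutant by blast
qed

end

text \<open>Self-adjointness of \<open>S\<close> provides the adjoints. The bicommutant clause holds
  because \<open>S\<close> lies in its own bicommutant, so whatever commutes with the latter
  commutes with \<open>S\<close>.\<close>

lemma von_neumann_commutant:
  assumes S: "S \<subseteq> bounded_ops" "\<And>a. a \<in> S \<Longrightarrow> adj a \<in> S"
  shows "von_neumann (commutant S)"
proof
  show "a \<in> bounded_ops" if "a \<in> commutant S" for a using that by (rule commutantD)
  show "a + b \<in> commutant S" if ab: "a \<in> commutant S" "b \<in> commutant S" for a b
    by (rule commutantI) (simp_all only: bounded_ops_add commutantD(2)[OF ab(1)] commutantD(2)[OF ab(2)]
        blinfun_compose_simps(1,2) commutantD(1)[OF ab(1)] commutantD(1)[OF ab(2)])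
  show "c *\<^sub>C a \<in> commutant S" if a: "a \<in> commutant S" for a c
  proof (rule commutantI)
    fix s assume s: "s \<in> S"
    then have "s \<in> bounded_ops" using S(1) by blast
    then show "(c *\<^sub>C a) o\<^sub>L s = s o\<^sub>L (c *\<^sub>C a)"
      by (simp only: blinfun_compose_scaleC_left blinfun_compose_scaleC_right commutantD(1)[OF a s])
  qed (intro bounded_ops_intros commutantD(2)[OF a])
  show "a o\<^sub>L b \<in> commutant S" if ab: "a \<in> commutant S" "b \<in> commutant S" for a b
  proof (rule commutantI)
    fix s assume s: "s \<in> S"
    have "(a o\<^sub>L b) o\<^sub>L s = a o\<^sub>L (s o\<^sub>L b)"
      by (simp only: blinfun_compose_assoc commutantD(1)[OF ab(2) s])
    also have "\<dots> = s o\<^sub>L (a o\<^sub>L b)"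
      by (simp only: blinfun_compose_assoc[symmetric] commutantD(1)[OF ab(1) s])
    finally show "(a o\<^sub>L b) o\<^sub>L s = s o\<^sub>L (a o\<^sub>L b)" .
  qed (intro bounded_ops_intros commutantD(2)[OF ab(1)] commutantD(2)[OF ab(2)])
  show "id_blinfun \<in> commutant S"
    by (rule commutantI) (simp_all only: bounded_ops_id blinfun_compose_simps)
  show "adj a \<in> commutant S" if a: "a \<in> commutant S" for a
  proof (rule commutantI)
    fix s assume s: "s \<in> S"
    have "adj (a o\<^sub>L adj s) = adj (adj s o\<^sub>L a)" by (simp only: commutantD(1)[OF a S(2)[OF s]])
    moreover have "a \<in> bounded_ops" "s \<in> bounded_ops" "adj s \<in> bounded_ops"
      using commutantD(2)[OF a] S s by blast+
    ultimately show "adj a o\<^sub>L s = s o\<^sub>L adj a"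
      by (simp only: adj_compose adj_adj)
  qed (intro bounded_ops_intros commutantD(2)[OF a])
  show "commutant (commutant (commutant S)) \<subseteq> commutant S"
  proof
    fix a assume a: "a \<in> commutant (commutant (commutant S))"
    show "a \<in> commutant S"
    proof (rule commutantI)
      fix s assume "s \<in> S"
      with subset_bicommutant[OF S(1)] have "s \<in> commutant (commutant S)" by blast
      with a show "a o\<^sub>L s = s o\<^sub>L a" by (rule commutantD(1))
    qed (use a in \<open>rule commutantD(2)\<close>)
  qed
qed

lemma von_neumann_bicommutant:
  assumes S: "S \<subseteq> bounded_ops" "\<And>a. a \<in> S \<Longrightarrow> adj a \<in> S"
  shows "von_neumann (commutant (commutant S))"
proof -
  interpret von_neumann "commutant S" by (rule von_neumann_commutant[OF assms])
  show ?thesis by (rule von_neumann_commutant) (use bounded star in blast)+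
qed

lemma von_neumann_if_von_neumann_algebra: "von_neumann_algebra A \<Longrightarrow> von_neumann A"
  unfolding von_neumann_algebra_def by (metis von_neumann_bicommutant)

section \<open>The Hilbert space of square-summable sequences\<close>

lemma square_summable_iff_bounded:
  "square_summable \<xi> \<longleftrightarrow> (\<exists>B. \<forall>n. (\<Sum>k<n. (norm (\<xi> k))\<^sup>2) \<le> B)"
proof
  assume "square_summable \<xi>"
  then show "\<exists>B. \<forall>n. (\<Sum>k<n. (norm (\<xi> k))\<^sup>2) \<le> B"
    unfolding square_summable_def by (meson sum_le_suminf finite_lessThan zero_le_power2)
next
  assume "\<exists>B. \<forall>n. (\<Sum>k<n. (norm (\<xi> k))\<^sup>2) \<le> B"
  then show "square_summable \<xi>"
    unfolding square_summable_def by (meson summableI_nonneg_bounded zero_le_power2)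
qed

lemma square_summable_add:
  assumes "square_summable \<xi>" "square_summable \<eta>"
  shows "square_summable (\<lambda>k. \<xi> k + \<eta> k)"
  unfolding square_summable_def
proof (rule summable_comparison_test')
  show "summable (\<lambda>k. 2 * (norm (\<xi> k))\<^sup>2 + 2 * (norm (\<eta> k))\<^sup>2)"
    using assms unfolding square_summable_def by (intro summable_add summable_mult)
  show "norm ((norm (\<xi> k + \<eta> k))\<^sup>2) \<le> 2 * (norm (\<xi> k))\<^sup>2 + 2 * (norm (\<eta> k))\<^sup>2" for k
  proof -
    have "(norm (\<xi> k + \<eta> k))\<^sup>2 \<le> (norm (\<xi> k) + norm (\<eta> k))\<^sup>2"
      by (intro power_mono norm_triangle_ineq norm_ge_zero)
    then show ?thesis
      using sum_squares_bound[of "norm (\<xi> k)" "norm (\<eta> k)"] by (simp add: power2_sum)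
  qed
qed

lemma square_summable_bounded:
  assumes "square_summable \<xi>" "\<And>k. norm (\<eta> k) \<le> C * norm (\<xi> k)"
  shows "square_summable \<eta>"
  unfolding square_summable_def
proof (rule summable_comparison_test')
  show "summable (\<lambda>k. C\<^sup>2 * (norm (\<xi> k))\<^sup>2)"
    using assms(1) unfolding square_summable_def by (rule summable_mult)
  show "norm ((norm (\<eta> k))\<^sup>2) \<le> C\<^sup>2 * (norm (\<xi> k))\<^sup>2" for k
    using power_mono[OF assms(2)[of k], of 2] by (simp add: power_mult_distrib)
qed

lemma square_summable_zero: "square_summable (\<lambda>_. 0)"
  by (simp add: square_summable_def)

text \<open>The direct sum of countably many copies of \<open>'h\<close>. A functional given by two
  square-summable sequences becomes a vector functional here, and a finite matrix of operators acts
  on the first \<open>n\<close> coordinates.\<close>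

typedef (overloaded) ('h::chilbert_space) l2 = "{\<xi> :: nat \<Rightarrow> 'h. square_summable \<xi>}"
  morphisms l2_nth Abs_l2
  using square_summable_zero by blast

lemma l2_nth_square_summable: "square_summable (l2_nth x)"
  using l2_nth by blast

lemma l2_nth_Abs: "square_summable \<xi> \<Longrightarrow> l2_nth (Abs_l2 \<xi>) = \<xi>"
  by (simp add: Abs_l2_inverse)

lemma l2_eqI: "(\<And>k. l2_nth x k = l2_nth y k) \<Longrightarrow> x = y"
  by (metis l2_nth_inject ext)

instantiation l2 :: (chilbert_space) real_normed_vector
begin

definition zero_l2 :: "'a l2" where "0 = Abs_l2 (\<lambda>_. 0)"
definition plus_l2 :: "'a l2 \<Rightarrow> 'a l2 \<Rightarrow> 'a l2" where "x + y = Abs_l2 (\<lambda>k. l2_nth x k + l2_nth y k)"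
definition minus_l2 :: "'a l2 \<Rightarrow> 'a l2 \<Rightarrow> 'a l2" where "x - y = Abs_l2 (\<lambda>k. l2_nth x k - l2_nth y k)"
definition uminus_l2 :: "'a l2 \<Rightarrow> 'a l2" where "- x = Abs_l2 (\<lambda>k. - l2_nth x k)"
definition scaleR_l2 :: "real \<Rightarrow> 'a l2 \<Rightarrow> 'a l2" where "r *\<^sub>R x = Abs_l2 (\<lambda>k. r *\<^sub>R l2_nth x k)"
definition norm_l2 :: "'a l2 \<Rightarrow> real" where "norm x = sqrt (\<Sum>k. (norm (l2_nth x k))\<^sup>2)"
definition dist_l2 :: "'a l2 \<Rightarrow> 'a l2 \<Rightarrow> real" where "dist_l2 x y = norm (x - y)"
definition sgn_l2 :: "'a l2 \<Rightarrow> 'a l2" where "sgn_l2 x = inverse (norm x) *\<^sub>R x"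
definition uniformity_l2 :: "('a l2 \<times> 'a l2) filter"
  where "uniformity_l2 = (INF e\<in>{0 <..}. principal {(x, y). dist x y < e})"
definition open_l2 :: "'a l2 set \<Rightarrow> bool"
  where "open_l2 S = (\<forall>x\<in>S. \<forall>\<^sub>F (x', y) in uniformity. x' = x \<longrightarrow> y \<in> S)"

lemma l2_nth_uminus: "l2_nth (- x) k = - l2_nth x k" for x :: "'a l2"
  unfolding uminus_l2_def
  by (subst l2_nth_Abs) (rule square_summable_bounded[OF l2_nth_square_summable, of _ 1 x], auto)

lemma l2_nth_plus: "l2_nth (x + y) k = l2_nth x k + l2_nth y k" for x :: "'a l2"
  unfolding plus_l2_def by (subst l2_nth_Abs) (intro square_summable_add l2_nth_square_summable, rule refl)

lemma l2_nth_minus: "l2_nth (x - y) k = l2_nth x k - l2_nth y k" for x :: "'a l2"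
proof -
  have "square_summable (\<lambda>k. l2_nth x k + l2_nth (- y) k)"
    by (intro square_summable_add l2_nth_square_summable)
  then show ?thesis unfolding minus_l2_def l2_nth_uminus by (simp add: l2_nth_Abs)
qed

lemma l2_nth_zero: "l2_nth 0 k = (0 :: 'a)"
  by (simp add: zero_l2_def l2_nth_Abs square_summable_zero)

lemma l2_nth_scaleR: "l2_nth (r *\<^sub>R x) k = r *\<^sub>R l2_nth x k" for x :: "'a l2"
  unfolding scaleR_l2_def
  by (subst l2_nth_Abs) (rule square_summable_bounded[OF l2_nth_square_summable, of _ "\<bar>r\<bar>" x], auto)

lemma norm_l2_square_sums: "(\<lambda>k. (norm (l2_nth x k))\<^sup>2) sums (norm x)\<^sup>2" for x :: "'a l2"
proof -
  have "summable (\<lambda>k. (norm (l2_nth x k))\<^sup>2)"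
    using l2_nth_square_summable[of x] by (simp add: square_summable_def)
  then show ?thesis
    using suminf_nonneg[of "\<lambda>k. (norm (l2_nth x k))\<^sup>2"] by (simp add: norm_l2_def summable_sums)
qed

lemma norm_l2_partial: "(\<Sum>k<n. (norm (l2_nth x k))\<^sup>2) \<le> (norm x)\<^sup>2" for x :: "'a l2"
  using norm_l2_square_sums[of x] sum_le_suminf[of "\<lambda>k. (norm (l2_nth x k))\<^sup>2" "{..<n}"]
  by (auto simp: sums_iff)

lemma norm_l2_leI:
  assumes "\<And>n. (\<Sum>k<n. (norm (l2_nth x k))\<^sup>2) \<le> B\<^sup>2" "0 \<le> B"
  shows "norm (x :: 'a l2) \<le> B"
proof -
  have "(norm x)\<^sup>2 \<le> B\<^sup>2"
    using assms(1) by (intro LIMSEQ_le_const2[OF norm_l2_square_sums[unfolded sums_def]]) blast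
  then show ?thesis using assms(2) by (simp add: power2_le_iff_abs_le)
qed

lemma norm_l2_nonneg: "0 \<le> norm (x :: 'a l2)"
  by (simp add: norm_l2_def suminf_nonneg l2_nth_square_summable[unfolded square_summable_def])

lemma norm_l2_nth_le: "norm (l2_nth x k) \<le> norm x" for x :: "'a l2"
proof -
  have "(norm (l2_nth x k))\<^sup>2 \<le> (\<Sum>j<Suc k. (norm (l2_nth x j))\<^sup>2)"
    by (simp add: sum_nonneg)
  also have "\<dots> \<le> (norm x)\<^sup>2" by (rule norm_l2_partial)
  finally show ?thesis by (rule power2_le_imp_le) (rule norm_l2_nonneg)
qed

instance
proof
  fix x y z :: "'a l2" and r s :: real
  show "x + y + z = x + (y + z)" "x + y = y + x" "0 + x = x" "- x + x = 0" "x - y = x + - y"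
    "r *\<^sub>R (x + y) = r *\<^sub>R x + r *\<^sub>R y" "(r + s) *\<^sub>R x = r *\<^sub>R x + s *\<^sub>R x"
    "r *\<^sub>R s *\<^sub>R x = (r * s) *\<^sub>R x" "1 *\<^sub>R x = x"
    by (auto intro!: l2_eqI simp: l2_nth_plus l2_nth_minus l2_nth_uminus l2_nth_zero l2_nth_scaleR
        scaleR_add_right scaleR_add_left)
  show "dist x y = norm (x - y)" by (rule dist_l2_def)
  show "sgn x = inverse (norm x) *\<^sub>R x" by (rule sgn_l2_def)
  show "uniformity = (INF e\<in>{0 <..}. principal {(x, y). dist (x :: 'a l2) y < e})" by (rule uniformity_l2_def)
  show "open U = (\<forall>x\<in>U. \<forall>\<^sub>F (x', y) in uniformity. x' = x \<longrightarrow> y \<in> U)" for U :: "'a l2 set" by (rule open_l2_def)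
  show "norm x = 0 \<longleftrightarrow> x = 0"
  proof
    assume "norm x = 0"
    then show "x = 0"
      using norm_l2_nth_le[of x] by (intro l2_eqI) (simp add: l2_nth_zero)
  next
    assume "x = 0"
    then show "norm x = 0" by (simp add: norm_l2_def l2_nth_zero)
  qed
  show "norm (r *\<^sub>R x) = \<bar>r\<bar> * norm x"
  proof -
    have "(\<lambda>k. r\<^sup>2 * (norm (l2_nth x k))\<^sup>2) sums (r\<^sup>2 * (norm x)\<^sup>2)"
      by (intro sums_mult norm_l2_square_sums)
    then have "(norm (r *\<^sub>R x))\<^sup>2 = (\<bar>r\<bar> * norm x)\<^sup>2"
      using norm_l2_square_sums[of "r *\<^sub>R x"]
      by (auto simp: l2_nth_scaleR power_mult_distrib dest: sums_unique2)
    then show ?thesis by (rule power2_eq_imp_eq) (simp_all add: norm_l2_nonneg)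
  qed
  \<comment> \<open>Minkowski's inequality for the partial sums, then the limit.\<close>
  show "norm (x + y) \<le> norm x + norm y"
  proof (rule norm_l2_leI)
    fix n
    have le: "L2_set (\<lambda>k. norm (l2_nth z k)) {..<n} \<le> norm z" for z :: "'a l2"
      unfolding L2_set_def using norm_l2_partial[of z n] by (intro real_le_lsqrt) (auto simp: norm_l2_nonneg sum_nonneg)
    have "L2_set (\<lambda>k. norm (l2_nth (x + y) k)) {..<n} \<le>
        L2_set (\<lambda>k. norm (l2_nth x k) + norm (l2_nth y k)) {..<n}"
      by (rule L2_set_mono) (simp_all add: l2_nth_plus norm_triangle_ineq)
    also have "\<dots> \<le> L2_set (\<lambda>k. norm (l2_nth x k)) {..<n} + L2_set (\<lambda>k. norm (l2_nth y k)) {..<n}"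
      by (rule L2_set_triangle_ineq)
    also have "\<dots> \<le> norm x + norm y" by (intro add_mono le)
    finally have "(L2_set (\<lambda>k. norm (l2_nth (x + y) k)) {..<n})\<^sup>2 \<le> (norm x + norm y)\<^sup>2"
      by (intro power_mono) (auto simp: L2_set_nonneg)
    then show "(\<Sum>k<n. (norm (l2_nth (x + y) k))\<^sup>2) \<le> (norm x + norm y)\<^sup>2"
      by (simp add: L2_set_def sum_nonneg)
  qed (simp add: norm_l2_nonneg)
qed

end

instance l2 :: (chilbert_space) banach
proof
  fix X :: "nat \<Rightarrow> 'a l2" assume X: "Cauchy X"
  have "Cauchy (\<lambda>n. l2_nth (X n) k)" for k
  proof (rule metric_CauchyI)
    fix e :: real assume "0 < e"
    then obtain N where N: "\<And>m n. m \<ge> N \<Longrightarrow> n \<ge> N \<Longrightarrow> dist (X m) (X n) < e"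
      using X by (meson Cauchy_def)
    then show "\<exists>M. \<forall>m\<ge>M. \<forall>n\<ge>M. dist (l2_nth (X m) k) (l2_nth (X n) k) < e"
      using norm_l2_nth_le[of "X _ - X _" k] unfolding dist_norm l2_nth_minus
      by (meson le_less_trans)
  qed
  then have "\<exists>l. (\<lambda>n. l2_nth (X n) k) \<longlonglongrightarrow> l" for k
    by (simp add: Cauchy_convergent_iff convergent_def)
  then obtain l where l: "\<And>k. (\<lambda>n. l2_nth (X n) k) \<longlonglongrightarrow> l k" by metis
  \<comment> \<open>Stated for partial sums because \<open>l\<close> is not yet known to be
    square-summable.\<close>
  have bound: "\<exists>N. \<forall>m\<ge>N. \<forall>K. (\<Sum>k<K. (norm (l2_nth (X m) k - l k))\<^sup>2) \<le> e\<^sup>2" if "0 < e" for e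
  proof -
    obtain N where N: "\<And>m n. m \<ge> N \<Longrightarrow> n \<ge> N \<Longrightarrow> dist (X m) (X n) < e"
      using X \<open>0 < e\<close> by (meson Cauchy_def)
    have "(\<Sum>k<K. (norm (l2_nth (X m) k - l k))\<^sup>2) \<le> e\<^sup>2" if "m \<ge> N" for m K
    proof (rule LIMSEQ_le_const2)
      show "(\<lambda>n. \<Sum>k<K. (norm (l2_nth (X m) k - l2_nth (X n) k))\<^sup>2) \<longlonglongrightarrow> (\<Sum>k<K. (norm (l2_nth (X m) k - l k))\<^sup>2)"
        by (intro tendsto_intros l)
      have "(\<Sum>k<K. (norm (l2_nth (X m) k - l2_nth (X n) k))\<^sup>2) \<le> e\<^sup>2" if "n \<ge> N" for n
      proof -
        have "(\<Sum>k<K. (norm (l2_nth (X m - X n) k))\<^sup>2) \<le> (norm (X m - X n))\<^sup>2" by (rule norm_l2_partial)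
        also have "\<dots> \<le> e\<^sup>2"
          using N[OF \<open>m \<ge> N\<close> that] by (intro power_mono) (auto simp: dist_norm)
        finally show ?thesis by (simp add: l2_nth_minus)
      qed
      then show "\<exists>N. \<forall>n\<ge>N. (\<Sum>k<K. (norm (l2_nth (X m) k - l2_nth (X n) k))\<^sup>2) \<le> e\<^sup>2" by blast
    qed
    then show ?thesis by blast
  qed
  have "square_summable l"
  proof -
    obtain N where "\<And>K. (\<Sum>k<K. (norm (l2_nth (X N) k - l k))\<^sup>2) \<le> 1\<^sup>2"
      using bound[of 1] by auto
    then have "square_summable (\<lambda>k. l2_nth (X N) k - l k)"
      unfolding square_summable_iff_bounded by blast
    then have "square_summable (\<lambda>k. - (l2_nth (X N) k - l k))"
      by (rule square_summable_bounded[where C = 1]) (simp add: norm_minus_commute)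
    from square_summable_add[OF l2_nth_square_summable[of "X N"] this] show ?thesis by simp
  qed
  then have nth: "l2_nth (Abs_l2 l) = l" by (rule l2_nth_Abs)
  have "X \<longlonglongrightarrow> Abs_l2 l"
  proof (rule metric_LIMSEQ_I)
    fix e :: real assume "0 < e"
    then obtain N where N: "\<And>m K. m \<ge> N \<Longrightarrow> (\<Sum>k<K. (norm (l2_nth (X m) k - l k))\<^sup>2) \<le> (e / 2)\<^sup>2"
      using bound[of "e / 2"] by auto
    have "dist (X m) (Abs_l2 l) < e" if "m \<ge> N" for m
    proof -
      have "norm (X m - Abs_l2 l) \<le> e / 2"
        by (rule norm_l2_leI) (use N[OF that] \<open>0 < e\<close> in \<open>simp_all add: l2_nth_minus nth\<close>)
      then show ?thesis using \<open>0 < e\<close> by (simp add: dist_norm)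
    qed
    then show "\<exists>N. \<forall>m\<ge>N. dist (X m) (Abs_l2 l) < e" by blast
  qed
  then show "convergent X" by (rule convergentI)
qed

instantiation l2 :: (chilbert_space) chilbert_space
begin

definition scaleC_l2 :: "complex \<Rightarrow> 'a l2 \<Rightarrow> 'a l2" where "c *\<^sub>C x = Abs_l2 (\<lambda>k. c *\<^sub>C l2_nth x k)"
definition cinner_l2 :: "'a l2 \<Rightarrow> 'a l2 \<Rightarrow> complex" where "cinner x y = (\<Sum>k. cinner (l2_nth x k) (l2_nth y k))"

lemma l2_nth_scaleC: "l2_nth (c *\<^sub>C x) k = c *\<^sub>C l2_nth x k" for x :: "'a l2"
  unfolding scaleC_l2_def
  by (subst l2_nth_Abs)
    (rule square_summable_bounded[OF l2_nth_square_summable, of _ "cmod c" x], auto simp: norm_scaleC)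

lemma cinner_square_summable:
  assumes "square_summable \<xi>" "square_summable \<eta>"
  shows "summable (\<lambda>k. cinner (\<xi> k) (\<eta> k :: 'a))"
proof (rule summable_comparison_test')
  show "summable (\<lambda>k. (norm (\<xi> k))\<^sup>2 + (norm (\<eta> k))\<^sup>2)"
    using assms unfolding square_summable_def by (rule summable_add)
  show "norm (cinner (\<xi> k) (\<eta> k)) \<le> (norm (\<xi> k))\<^sup>2 + (norm (\<eta> k))\<^sup>2" for k
  proof -
    have "0 \<le> norm (\<xi> k) * norm (\<eta> k)" by simp
    then show ?thesis
      using cinner_Cauchy_Schwarz[of "\<xi> k" "\<eta> k"] sum_squares_bound[of "norm (\<xi> k)" "norm (\<eta> k)"]
      by linarith
  qed
qed

lemma cinner_l2_sums: "(\<lambda>k. cinner (l2_nth x k) (l2_nth y k)) sums cinner x y" for x :: "'a l2"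
  unfolding cinner_l2_def by (intro summable_sums cinner_square_summable l2_nth_square_summable)

instance
proof
  fix x y z :: "'a l2" and c d :: complex and r :: real
  show "c *\<^sub>C (x + y) = c *\<^sub>C x + c *\<^sub>C y" "(c + d) *\<^sub>C x = c *\<^sub>C x + d *\<^sub>C x"
    "c *\<^sub>C d *\<^sub>C x = (c * d) *\<^sub>C x" "1 *\<^sub>C x = x" "r *\<^sub>R x = complex_of_real r *\<^sub>C x"
    by (auto intro!: l2_eqI simp: l2_nth_plus l2_nth_scaleC l2_nth_scaleR scaleC_add_right scaleC_add_left
        scaleC_scaleC scaleC_one scaleC_of_real)
  show "cinner x y = cnj (cinner y x)"
  proof (rule sums_unique2[OF cinner_l2_sums])
    show "(\<lambda>k. cinner (l2_nth x k) (l2_nth y k)) sums cnj (cinner y x)"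
      using cinner_l2_sums[of y x] by (subst cinner_commute) (simp add: sums_cnj)
  qed
  show "cinner (x + y) z = cinner x z + cinner y z"
    by (rule sums_unique2[OF cinner_l2_sums])
      (unfold l2_nth_plus cinner_add_left, intro sums_add cinner_l2_sums)
  show "cinner (c *\<^sub>C x) y = c * cinner x y"
    by (rule sums_unique2[OF cinner_l2_sums])
      (unfold l2_nth_scaleC cinner_scaleC_left, intro sums_mult cinner_l2_sums)
  show "cinner x x = complex_of_real ((norm x)\<^sup>2)"
    by (rule sums_unique2[OF cinner_l2_sums])
      (unfold cinner_self, intro sums_of_real norm_l2_square_sums)
qed

end

lemmas l2_nth_simps = l2_nth_plus l2_nth_minus l2_nth_uminus l2_nth_zero l2_nth_scaleR l2_nth_scaleC

lemma l2_nth_sum: "l2_nth (\<Sum>i\<in>I. f i) k = (\<Sum>i\<in>I. l2_nth (f i) k)"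
  by (induction I rule: infinite_finite_induct) (auto simp: l2_nth_simps)

lemma bounded_linear_l2_nth: "bounded_linear (\<lambda>x. l2_nth x k)"
  by (rule bounded_linear_intro[where K = 1]) (auto simp: l2_nth_simps norm_l2_nth_le)

definition l2_single :: "nat \<Rightarrow> 'h::chilbert_space \<Rightarrow> 'h l2"
  where "l2_single k v = Abs_l2 (\<lambda>j. if j = k then v else 0)"

lemma l2_nth_single: "l2_nth (l2_single k v) j = (if j = k then v else 0)"
proof -
  have "square_summable (\<lambda>j. if j = k then v else 0)"
    unfolding square_summable_def
    by (rule summable_finite[of "{k}"]) auto
  then show ?thesis by (simp add: l2_single_def l2_nth_Abs)
qed

lemma cinner_single_right: "cinner x (l2_single k v) = cinner (l2_nth x k) v"
proof -
  have "(\<lambda>j. cinner (l2_nth x j) (l2_nth (l2_single k v) j)) = (\<lambda>j. if j = k then cinner (l2_nth x j) v else 0)"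
    by (auto simp: l2_nth_single cinner.zero_right)
  with cinner_l2_sums[of x "l2_single k v"]
  have "(\<lambda>j. if j = k then cinner (l2_nth x j) v else 0) sums cinner x (l2_single k v)"
    by simp
  from sums_unique2[OF this sums_single] show ?thesis .
qed

lemma cinner_single_left: "cinner (l2_single k v) x = cinner v (l2_nth x k)"
  by (metis cinner_commute cinner_single_right)

lemma norm_single: "norm (l2_single k v) = norm v"
proof -
  have "complex_of_real ((norm (l2_single k v))\<^sup>2) = complex_of_real ((norm v)\<^sup>2)"
    by (simp only: cinner_self[symmetric] cinner_single_right l2_nth_single if_True simp_thms)
  then show ?thesis by (simp only: of_real_eq_iff) (simp add: power2_eq_iff_nonneg)
qed

lemma bounded_linear_single: "bounded_linear (l2_single k)"
  by (rule bounded_linear_intro[where K = 1])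
    (auto intro!: l2_eqI simp: l2_nth_simps l2_nth_single norm_single)

lemma l2_single_scaleC: "l2_single k (c *\<^sub>C v) = c *\<^sub>C l2_single k v"
  by (auto intro!: l2_eqI simp: l2_nth_simps l2_nth_single)

lemma l2_sums_single: "(\<lambda>k. l2_single k (l2_nth x k)) sums x"
proof -
  define P where "P n = (\<Sum>k<n. l2_single k (l2_nth x k))" for n
  have nth: "l2_nth (P n) j = (if j < n then l2_nth x j else 0)" for n j
    by (simp add: P_def l2_nth_sum l2_nth_single)
  have eq: "(norm (P n - x))\<^sup>2 = (norm x)\<^sup>2 - (\<Sum>k<n. (norm (l2_nth x k))\<^sup>2)" for n
  proof (rule sums_unique2[OF norm_l2_square_sums])
    have "(\<lambda>k. if k \<in> {..<n} then (norm (l2_nth x k))\<^sup>2 else 0) sums (\<Sum>k<n. (norm (l2_nth x k))\<^sup>2)"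
      by (rule sums_If_finite_set) simp
    from sums_diff[OF norm_l2_square_sums this]
    show "(\<lambda>k. (norm (l2_nth (P n - x) k))\<^sup>2) sums ((norm x)\<^sup>2 - (\<Sum>k<n. (norm (l2_nth x k))\<^sup>2))"
      by (rule sums_cong[THEN iffD1, rotated]) (auto simp: l2_nth_simps nth)
  qed
  have "(\<lambda>n. (norm (P n - x))\<^sup>2) \<longlonglongrightarrow> (norm x)\<^sup>2 - (norm x)\<^sup>2"
    unfolding eq using norm_l2_square_sums[of x] by (intro tendsto_intros) (simp add: sums_def)
  then have "(\<lambda>n. sqrt ((norm (P n - x))\<^sup>2)) \<longlonglongrightarrow> sqrt 0"
    by (intro tendsto_real_sqrt) simp
  then have "(\<lambda>n. norm (P n - x)) \<longlonglongrightarrow> 0" by simp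
  then show ?thesis
    unfolding sums_def P_def[symmetric] by (simp add: LIM_zero_iff tendsto_norm_zero_iff)
qed

text \<open>\<open>a\<close> tensored with the identity of the sequence space. The functionals that
  generate the ultraweak topology are exactly the vector functionals of
  \<open>amp a\<close>.\<close>

definition amp :: "('h::chilbert_space \<Rightarrow>\<^sub>L 'h) \<Rightarrow> ('h l2 \<Rightarrow>\<^sub>L 'h l2)"
  where "amp a = Blinfun (\<lambda>x. Abs_l2 (\<lambda>k. blinfun_apply a (l2_nth x k)))"

lemma l2_nth_amp: "l2_nth (blinfun_apply (amp a) x) k = blinfun_apply a (l2_nth x k)"
  and norm_amp: "norm (amp a) \<le> norm a"
proof -
  define f where "f x = Abs_l2 (\<lambda>k. blinfun_apply a (l2_nth x k))" for x
  have nth: "l2_nth (f x) k = blinfun_apply a (l2_nth x k)" for x k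
    unfolding f_def
    by (subst l2_nth_Abs) (rule square_summable_bounded[OF l2_nth_square_summable norm_blinfun], rule refl)
  have norm_f: "norm (f x) \<le> norm x * norm a" for x
  proof (rule norm_l2_leI)
    fix n
    have "(\<Sum>k<n. (norm (l2_nth (f x) k))\<^sup>2) \<le> (\<Sum>k<n. (norm a)\<^sup>2 * (norm (l2_nth x k))\<^sup>2)"
      unfolding nth power_mult_distrib[symmetric] by (intro sum_mono power_mono norm_blinfun) auto
    also have "\<dots> \<le> (norm a)\<^sup>2 * (norm x)\<^sup>2"
      unfolding sum_distrib_left[symmetric] by (intro mult_left_mono norm_l2_partial) auto
    finally show "(\<Sum>k<n. (norm (l2_nth (f x) k))\<^sup>2) \<le> (norm x * norm a)\<^sup>2"
      by (simp add: power_mult_distrib mult.commute)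
  qed simp
  then have "bounded_linear f"
    by (intro bounded_linear_intro[where K = "norm a"] l2_eqI)
      (auto simp: nth l2_nth_simps blinfun.bilinear_simps)
  then have amp: "blinfun_apply (amp a) = f"
    unfolding amp_def f_def by (rule bounded_linear_Blinfun_apply)
  then show "l2_nth (blinfun_apply (amp a) x) k = blinfun_apply a (l2_nth x k)" by (simp add: nth)
  show "norm (amp a) \<le> norm a"
    by (rule norm_blinfun_bound) (use norm_f in \<open>simp_all add: amp mult.commute\<close>)
qed

lemma amp_simps:
  "amp (a + b) = amp a + amp b" "amp (a - b) = amp a - amp b" "amp (r *\<^sub>R a) = r *\<^sub>R amp a"
  "amp (c *\<^sub>C a) = c *\<^sub>C amp a" "amp (a o\<^sub>L b) = amp a o\<^sub>L amp b" "amp id_blinfun = id_blinfun" "amp 0 = 0"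
  by (auto intro!: blinfun_eqI l2_eqI simp: l2_nth_amp l2_nth_simps blinfun.bilinear_simps blinfun_apply_scaleC)

lemma amp_bounded_ops: "a \<in> bounded_ops \<Longrightarrow> amp a \<in> bounded_ops"
  by (auto intro!: bounded_opsI l2_eqI simp: l2_nth_amp l2_nth_simps bounded_ops_apply_scaleC)

lemma amp_adj: "a \<in> bounded_ops \<Longrightarrow> adj (amp a) = amp (adj a)"
  by (rule adj_eqI) (simp add: cinner_l2_def l2_nth_amp cinner_adj_right)

lemma amp_single: "blinfun_apply (amp a) (l2_single k v) = l2_single k (blinfun_apply a v)"
  by (auto intro!: l2_eqI simp: l2_nth_amp l2_nth_single)

text \<open>\<open>z\<close> lists the entries of all the vectors \<open>2\<^sup>n \<zeta>\<^sub>n\<close>, along \<open>nat \<times> nat \<cong> nat\<close>.\<close>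

lemma l2_pack:
  fixes \<zeta> :: "nat \<Rightarrow> 'h::chilbert_space l2"
  assumes K: "\<And>n. norm (\<zeta> n) \<le> K * (1/4) ^ n"
  obtains z where "\<And>n a. norm (blinfun_apply (amp a) (\<zeta> n)) \<le> (1/2) ^ n * norm (blinfun_apply (amp a) z)"
proof -
  \<comment> \<open>The factor \<open>2 ^ n\<close> becomes the gain \<open>(1/2) ^ n\<close> of the
    conclusion. It is affordable: with norms at most \<open>K * (1/4) ^ n\<close>, the rescaled
    vectors have squared norms at most \<open>K\<^sup>2 * (1/4) ^ n\<close>.\<close>
  define f where "f = (\<lambda>(n, j). (2::real) ^ n *\<^sub>R l2_nth (\<zeta> n) j)"
  have four: "((2::real) ^ n)\<^sup>2 = 4 ^ n" for n
    by (simp add: power2_eq_square flip: power_mult_distrib)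
  have "square_summable (\<lambda>k. f (prod_decode k))"
    unfolding square_summable_iff_bounded
  proof (intro exI allI)
    fix m
    \<comment> \<open>Finitely many indices decode into a finite square, over which the double sum
      is estimated row by row.\<close>
    obtain N where N: "prod_decode ` {..<m} \<subseteq> {..<N} \<times> {..<N}"
    proof -
      let ?D = "prod_decode ` {..<m}"
      have "finite (fst ` ?D \<union> snd ` ?D)" by simp
      then obtain N where N: "fst ` ?D \<union> snd ` ?D \<subseteq> {..<N}"
        unfolding finite_nat_iff_bounded by blast
      have "p \<in> {..<N} \<times> {..<N}" if "p \<in> ?D" for p
      proof -
        have "fst p \<in> fst ` ?D" "snd p \<in> snd ` ?D" using that by (rule imageI)+
        with N have "fst p \<in> {..<N}" "snd p \<in> {..<N}" by blast+
        then show ?thesis by (simp add: mem_Times_iff)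
      qed
      then show ?thesis by (intro that[of N] subsetI)
    qed
    have "(\<Sum>k<m. (norm (f (prod_decode k)))\<^sup>2) = (\<Sum>p\<in>prod_decode ` {..<m}. (norm (f p))\<^sup>2)"
      by (subst sum.reindex) (auto simp: inj_prod_decode)
    also have "\<dots> \<le> (\<Sum>p\<in>{..<N} \<times> {..<N}. (norm (f p))\<^sup>2)"
      by (rule sum_mono2) (use N in auto)
    also have "\<dots> = (\<Sum>n<N. \<Sum>j<N. (norm (f (n, j)))\<^sup>2)"
      by (simp add: sum.cartesian_product)
    also have "\<dots> = (\<Sum>n<N. 4 ^ n * (\<Sum>j<N. (norm (l2_nth (\<zeta> n) j))\<^sup>2))"
      by (simp add: f_def power_mult_distrib four sum_distrib_left)
    also have "\<dots> \<le> (\<Sum>n<N. K\<^sup>2 * (1/4) ^ n)"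
    proof (rule sum_mono)
      fix n
      have "(\<Sum>j<N. (norm (l2_nth (\<zeta> n) j))\<^sup>2) \<le> (norm (\<zeta> n))\<^sup>2" by (rule norm_l2_partial)
      also have "\<dots> \<le> (K * (1/4) ^ n)\<^sup>2" by (intro power_mono K) simp
      finally have "4 ^ n * (\<Sum>j<N. (norm (l2_nth (\<zeta> n) j))\<^sup>2) \<le> 4 ^ n * (K * (1/4) ^ n)\<^sup>2" by simp
      also have "\<dots> = K\<^sup>2 * (4 ^ n * (1/4) ^ n) * (1/4) ^ n"
        by (simp only: power2_eq_square mult.assoc mult.commute mult.left_commute)
      also have "\<dots> = K\<^sup>2 * (1/4) ^ n" by (simp flip: power_mult_distrib)
      finally show "4 ^ n * (\<Sum>j<N. (norm (l2_nth (\<zeta> n) j))\<^sup>2) \<le> K\<^sup>2 * (1/4) ^ n" .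
    qed
    also have "\<dots> \<le> (\<Sum>n. K\<^sup>2 * (1/4) ^ n)"
      by (rule sum_le_suminf) (auto intro!: summable_mult summable_geometric)
    finally show "(\<Sum>k<m. (norm (f (prod_decode k)))\<^sup>2) \<le> (\<Sum>n. K\<^sup>2 * (1/4) ^ n)" .
  qed
  then have nth: "l2_nth (Abs_l2 (\<lambda>k. f (prod_decode k))) = (\<lambda>k. f (prod_decode k))" by (rule l2_nth_Abs)
  define z where "z = Abs_l2 (\<lambda>k. f (prod_decode k))"
  show ?thesis
  proof (rule that[of z])
    fix n and a :: "'h \<Rightarrow>\<^sub>L 'h"
    let ?g = "\<lambda>k. (norm (l2_nth (blinfun_apply (amp a) z) k))\<^sup>2"
    have zn: "l2_nth z (prod_encode (n, j)) = 2 ^ n *\<^sub>R l2_nth (\<zeta> n) j" for j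
      unfolding z_def nth by (simp add: f_def)
    have g: "?g sums (norm (blinfun_apply (amp a) z))\<^sup>2" by (rule norm_l2_square_sums)
    \<comment> \<open>Row \<open>n\<close> is a subseries of a convergent series of nonnegative
      terms.\<close>
    have "(\<Sum>j. ?g (prod_encode (n, j))) \<le> suminf ?g"
      using suminf_reindex_mono[of ?g "\<lambda>j. prod_encode (n, j)"] g
      by (auto simp: sums_iff o_def inj_def)
    also have "\<dots> = (norm (blinfun_apply (amp a) z))\<^sup>2" using g by (simp add: sums_iff)
    also have "(\<lambda>j. ?g (prod_encode (n, j))) = (\<lambda>j. (2 ^ n)\<^sup>2 * (norm (l2_nth (blinfun_apply (amp a) (\<zeta> n)) j))\<^sup>2)"
      by (simp only: l2_nth_amp zn blinfun.scaleR_right norm_scaleR power_mult_distrib) simp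
    also have "suminf \<dots> = (2 ^ n)\<^sup>2 * (norm (blinfun_apply (amp a) (\<zeta> n)))\<^sup>2"
      by (rule sums_unique[symmetric]) (intro sums_mult norm_l2_square_sums)
    finally have "(2 ^ n * norm (blinfun_apply (amp a) (\<zeta> n)))\<^sup>2 \<le> (norm (blinfun_apply (amp a) z))\<^sup>2"
      by (simp add: power_mult_distrib)
    then have "2 ^ n * norm (blinfun_apply (amp a) (\<zeta> n)) \<le> norm (blinfun_apply (amp a) z)"
      by (rule power2_le_imp_le) simp
    then have "(1/2) ^ n * (2 ^ n * norm (blinfun_apply (amp a) (\<zeta> n))) \<le> (1/2) ^ n * norm (blinfun_apply (amp a) z)"
      by (rule mult_left_mono) simp
    then show "norm (blinfun_apply (amp a) (\<zeta> n)) \<le> (1/2) ^ n * norm (blinfun_apply (amp a) z)"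
      by (simp only: mult.assoc[symmetric] power_mult_distrib[symmetric]) simp
  qed
qed

section \<open>Normal functionals\<close>

text \<open>The seminorms taking \<open>a\<close> to the norm of \<open>amp a\<close> at a vector
  are directed: any two have a common majorant of the same kind.\<close>

lemma l2_pack_two:
  fixes \<zeta> \<zeta>' :: "'h::chilbert_space l2"
  obtains z where "\<And>a. norm (blinfun_apply (amp a) \<zeta>) \<le> norm (blinfun_apply (amp a) z)"
    "\<And>a. norm (blinfun_apply (amp a) \<zeta>') \<le> norm (blinfun_apply (amp a) z)"
proof -
  define \<xi> where "\<xi> n = (if n = 0 then \<zeta> else if n = 1 then \<zeta>' else 0)" for n :: nat
  \<comment> \<open>The factor 4 compensates \<open>(1/4) ^ n\<close> at
    \<open>n = 1\<close>.\<close>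
  have "norm (\<xi> n) \<le> (norm \<zeta> + 4 * norm \<zeta>') * (1/4) ^ n" for n
    by (simp add: \<xi>_def)
  then obtain z where z: "\<And>n a. norm (blinfun_apply (amp a) (\<xi> n)) \<le> (1/2) ^ n * norm (blinfun_apply (amp a) z)"
    by (rule l2_pack) blast
  show ?thesis
  proof (rule that[of z])
    show "norm (blinfun_apply (amp a) \<zeta>) \<le> norm (blinfun_apply (amp a) z)" for a
      using z[of a 0] by (simp add: \<xi>_def)
    show "norm (blinfun_apply (amp a) \<zeta>') \<le> norm (blinfun_apply (amp a) z)" for a
    proof -
      have "norm (blinfun_apply (amp a) \<zeta>') \<le> (1/2) * norm (blinfun_apply (amp a) z)"
        using z[of a 1] by (simp add: \<xi>_def)
      then show ?thesis using norm_ge_zero[of "blinfun_apply (amp a) z"] by linarith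
    qed
  qed
qed

text \<open>The generating functionals are controlled by Cauchy-Schwarz, and a finite intersection
  of balls contains a ball because \<open>l2_pack_two\<close> merges two seminorms. The seminorms
  define a finer topology, the ultrastrong one, but \<open>predual_iff_dominated\<close> shows that
  it has the same continuous linear functionals.\<close>

lemma ultraweak_open_contains_ball:
  assumes "openin ultraweak_topology W" "a \<in> W"
  shows "\<exists>\<zeta>. \<forall>b. norm (blinfun_apply (amp (b - a)) \<zeta>) < 1 \<longrightarrow> b \<in> W"
proof -
  have "generate_topology_on {{a. (\<Sum>k. cinner (blinfun_apply a (\<xi> k)) (\<eta> k)) \<in> U} | \<xi> \<eta> U.
        square_summable \<xi> \<and> square_summable \<eta> \<and> open U} W"
    using assms(1) unfolding ultraweak_topology_def by (rule openin_topology_generated_by)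
  then show ?thesis using assms(2)
  proof (induction arbitrary: a)
    case (Int V W)
    obtain \<zeta> where \<zeta>: "\<And>b. norm (blinfun_apply (amp (b - a)) \<zeta>) < 1 \<Longrightarrow> b \<in> V"
      using Int.IH(1)[of a] Int.prems by blast
    obtain \<zeta>' where \<zeta>': "\<And>b. norm (blinfun_apply (amp (b - a)) \<zeta>') < 1 \<Longrightarrow> b \<in> W"
      using Int.IH(2)[of a] Int.prems by blast
    obtain z where z: "\<And>a. norm (blinfun_apply (amp a) \<zeta>) \<le> norm (blinfun_apply (amp a) z)"
      "\<And>a. norm (blinfun_apply (amp a) \<zeta>') \<le> norm (blinfun_apply (amp a) z)"
      by (rule l2_pack_two[of \<zeta> \<zeta>']) blast
    have "b \<in> V \<inter> W" if "norm (blinfun_apply (amp (b - a)) z) < 1" for b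
      using \<zeta>[OF le_less_trans[OF z(1) that]] \<zeta>'[OF le_less_trans[OF z(2) that]] by (rule IntI)
    then show ?case by blast
  next
    case (UN K)
    then show ?case by blast
  next
    case (Basis s)
    then obtain \<xi> \<eta> U where s: "s = {a. (\<Sum>k. cinner (blinfun_apply a (\<xi> k)) (\<eta> k)) \<in> U}"
      and ss: "square_summable \<xi>" "square_summable \<eta>" and U: "open U" by blast
    define x y where "x = Abs_l2 \<xi>" and "y = Abs_l2 \<eta>"
    have eq: "(\<Sum>k. cinner (blinfun_apply a (\<xi> k)) (\<eta> k)) = cinner (blinfun_apply (amp a) x) y" for a
      by (simp add: cinner_l2_def l2_nth_amp x_def y_def l2_nth_Abs ss)
    obtain e where e: "e > 0" "ball (cinner (blinfun_apply (amp a) x) y) e \<subseteq> U"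
      using U Basis.prems unfolding s eq open_contains_ball by blast
    \<comment> \<open>\<open>norm y + 1\<close> keeps \<open>r\<close> positive; by Cauchy-Schwarz
      the unit ball of the seminorm at \<open>r *\<^sub>R x\<close> stays within distance
      \<open>e\<close>.\<close>
    define r where "r = (norm y + 1) / e"
    have r: "0 < r" using e(1) by (simp add: r_def add_nonneg_pos)
    have "b \<in> s" if "norm (blinfun_apply (amp (b - a)) (r *\<^sub>R x)) < 1" for b
    proof -
      have lt: "r * norm (blinfun_apply (amp (b - a)) x) < 1"
        using that r by (simp add: blinfun.scaleR_right)
      have "norm (cinner (blinfun_apply (amp (b - a)) x) y) \<le> norm (blinfun_apply (amp (b - a)) x) * (norm y + 1)"
        by (rule order_trans[OF cinner_Cauchy_Schwarz]) (simp add: mult_left_mono)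
      also have "\<dots> = e * (r * norm (blinfun_apply (amp (b - a)) x))"
        using e(1) by (simp add: r_def)
      also have "\<dots> < e * 1" using lt e(1) by (rule mult_strict_left_mono)
      finally have "dist (cinner (blinfun_apply (amp a) x) y) (cinner (blinfun_apply (amp b) x) y) < e"
        by (simp add: dist_norm norm_minus_commute amp_simps blinfun.diff_left cinner.diff_left)
      then show ?thesis using e(2) unfolding s eq by (simp add: subset_iff)
    qed
    then show ?case by blast
  qed simp
qed

definition linear_on :: "('h::chilbert_space \<Rightarrow>\<^sub>L 'h) set \<Rightarrow> (('h \<Rightarrow>\<^sub>L 'h) \<Rightarrow> complex) \<Rightarrow> bool" where
  "linear_on A \<psi> \<longleftrightarrow> (\<forall>a\<in>A. \<forall>b\<in>A. \<psi> (a + b) = \<psi> a + \<psi> b) \<and> (\<forall>c. \<forall>a\<in>A. \<psi> (c *\<^sub>C a) = c * \<psi> a)"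

lemma linear_onD:
  "linear_on A \<psi> \<Longrightarrow> a \<in> A \<Longrightarrow> b \<in> A \<Longrightarrow> \<psi> (a + b) = \<psi> a + \<psi> b"
  "linear_on A \<psi> \<Longrightarrow> a \<in> A \<Longrightarrow> \<psi> (c *\<^sub>C a) = c * \<psi> a"
  by (auto simp: linear_on_def)

text \<open>The working form of normality. It passes to sums, multiples and compositions by plain
  estimates.\<close>

definition dominated :: "('h::chilbert_space \<Rightarrow>\<^sub>L 'h) set \<Rightarrow> (('h \<Rightarrow>\<^sub>L 'h) \<Rightarrow> complex) \<Rightarrow> 'h l2 \<Rightarrow> bool" where
  "dominated A \<psi> \<zeta> \<longleftrightarrow> (\<forall>a\<in>A. cmod (\<psi> a) \<le> norm (blinfun_apply (amp a) \<zeta>))"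

context star_algebra
begin

lemma linear_on_zero: "linear_on A \<psi> \<Longrightarrow> \<psi> 0 = 0"
  using linear_onD(2)[OF _ zero, of \<psi> 0] by simp

lemma linear_on_diff: "linear_on A \<psi> \<Longrightarrow> a \<in> A \<Longrightarrow> b \<in> A \<Longrightarrow> \<psi> (a - b) = \<psi> a - \<psi> b"
  using linear_onD(1)[of A \<psi> a "(-1) *\<^sub>C b"] linear_onD(2)[of A \<psi> b "-1"] scaleC[of b "-1"]
  by (simp add: scaleC_minus1)

lemma linear_on_sum:
  "linear_on A \<psi> \<Longrightarrow> (\<And>i. i \<in> I \<Longrightarrow> f i \<in> A) \<Longrightarrow> \<psi> (\<Sum>i\<in>I. f i) = (\<Sum>i\<in>I. \<psi> (f i))"
proof (induction I rule: infinite_finite_induct)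
  case (insert x F)
  then have "\<psi> (f x + sum f F) = \<psi> (f x) + \<psi> (sum f F)"
    by (intro linear_onD(1)) (auto intro: sum)
  with insert show ?case by simp
qed (auto simp: linear_on_zero)

text \<open>Domination makes \<open>\<psi>\<close> well defined on the vectors
  \<open>blinfun_apply (amp a) \<zeta>\<close>, so that Riesz representation applies to the graph of
  these pairs.\<close>

lemma dominated_representation:
  assumes lin: "linear_on A \<psi>" and dom: "dominated A \<psi> \<zeta>"
  obtains \<eta> where "\<And>a. a \<in> A \<Longrightarrow> \<psi> a = cinner (blinfun_apply (amp a) \<zeta>) \<eta>"
proof (rule Riesz_graph[of "(\<lambda>a. (blinfun_apply (amp a) \<zeta>, \<psi> a)) ` A" 1], goal_cases)
  case 1
  show ?case
    by (rule image_eqI[of _ _ 0]) (auto simp: amp_simps linear_on_zero[OF lin] zero)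
next
  case (2 v x w y)
  then obtain a b where "a \<in> A" "b \<in> A" "v = blinfun_apply (amp a) \<zeta>" "w = blinfun_apply (amp b) \<zeta>" "x = \<psi> a" "y = \<psi> b"
    by auto
  then show ?case
    by (intro image_eqI[of _ _ "a + b"]) (auto simp: amp_simps blinfun.add_left linear_onD(1)[OF lin] add)
next
  case (3 c v x)
  then obtain a where "a \<in> A" "v = blinfun_apply (amp a) \<zeta>" "x = \<psi> a"
    by auto
  then show ?case
    by (intro image_eqI[of _ _ "c *\<^sub>C a"]) (auto simp: amp_simps blinfun_apply_scaleC linear_onD(2)[OF lin] scaleC)
next
  case (4 v a)
  then show ?case using dom by (auto simp: dominated_def)
next
  case (5 \<eta>)
  then show ?case using that[of \<eta>] by blast
qed

text \<open>Forwards, the preimage of the unit disc contains a ball of one seminorm around 0, and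
  homogeneity does the rest. Backwards, the two representing vectors exhibit \<open>\<psi>\<close>
  as one of the functionals that generate the topology.\<close>

lemma predual_iff_dominated: "\<psi> \<in> predual A \<longleftrightarrow> linear_on A \<psi> \<and> (\<exists>\<zeta>. dominated A \<psi> \<zeta>)"
proof
  assume \<psi>: "\<psi> \<in> predual A"
  then have lin: "linear_on A \<psi>" by (auto simp: predual_def linear_on_def)
  have cont: "continuous_map (subtopology ultraweak_topology A) euclidean \<psi>"
    using \<psi> by (simp add: predual_def)
  have "openin (subtopology ultraweak_topology A)
      {a \<in> topspace (subtopology ultraweak_topology A). \<psi> a \<in> ball 0 1}"
    by (rule openin_continuous_map_preimage[OF cont]) simp
  then obtain W where W: "openin ultraweak_topology W"
    "{a \<in> topspace (subtopology ultraweak_topology A). \<psi> a \<in> ball 0 1} = W \<inter> A"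
    by (auto simp: openin_subtopology)
  have "(UNIV :: ('h \<Rightarrow>\<^sub>L 'h) set) \<in> {{a. (\<Sum>k. cinner (blinfun_apply a (\<xi> k)) (\<eta> k)) \<in> U} | \<xi> \<eta> U.
        square_summable \<xi> \<and> square_summable \<eta> \<and> open U}"
    by (intro CollectI exI[of _ "\<lambda>_. 0"] exI[of _ UNIV] conjI) (simp_all add: square_summable_zero)
  then have top: "topspace ultraweak_topology = (UNIV :: ('h \<Rightarrow>\<^sub>L 'h) set)"
    unfolding ultraweak_topology_def topology_generated_by_topspace
    by (intro top.extremum_uniqueI Union_upper)
  have WA: "a \<in> A \<Longrightarrow> a \<in> W \<longleftrightarrow> cmod (\<psi> a) < 1" for a
    using W(2)[unfolded set_eq_iff, THEN spec, of a] by (simp add: top)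
  have "0 \<in> W" using WA[OF zero] linear_on_zero[OF lin] by simp
  then obtain \<zeta> where \<zeta>: "\<And>b. norm (blinfun_apply (amp b) \<zeta>) < 1 \<Longrightarrow> b \<in> W"
    using ultraweak_open_contains_ball[OF W(1), of 0] by auto
  have "cmod (\<psi> a) \<le> norm (blinfun_apply (amp a) \<zeta>)" if a: "a \<in> A" for a
  \<comment> \<open>The seminorm may vanish at \<open>a\<close>, so \<open>a\<close> is rescaled by
    an arbitrary \<open>s\<close> strictly above its value.\<close>
  proof (rule dense_ge)
    fix s assume s: "norm (blinfun_apply (amp a) \<zeta>) < s"
    have s0: "0 < s" by (rule le_less_trans[OF norm_ge_zero s])
    have "norm (blinfun_apply (amp (complex_of_real (1/s) *\<^sub>C a)) \<zeta>) < 1"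
      using s s0 by (simp add: amp_simps blinfun_apply_scaleC norm_scaleC norm_divide)
    from \<zeta>[OF this] have "cmod (\<psi> (complex_of_real (1/s) *\<^sub>C a)) < 1"
      using WA[OF scaleC[OF a]] by blast
    then show "cmod (\<psi> a) \<le> s"
      using s0 by (simp add: linear_onD(2)[OF lin a] norm_mult norm_divide)
  qed
  then show "linear_on A \<psi> \<and> (\<exists>\<zeta>. dominated A \<psi> \<zeta>)"
    using lin by (auto simp: dominated_def)
next
  assume "linear_on A \<psi> \<and> (\<exists>\<zeta>. dominated A \<psi> \<zeta>)"
  then obtain \<zeta> where lin: "linear_on A \<psi>" and dom: "dominated A \<psi> \<zeta>" by blast
  obtain \<eta> where \<eta>: "\<And>a. a \<in> A \<Longrightarrow> \<psi> a = cinner (blinfun_apply (amp a) \<zeta>) \<eta>"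
    by (rule dominated_representation[OF lin dom]) blast
  have "openin (subtopology ultraweak_topology A) {a \<in> topspace (subtopology ultraweak_topology A). \<psi> a \<in> U}"
    if U: "open U" for U
  proof -
    define V where "V = {a. (\<Sum>k. cinner (blinfun_apply a (l2_nth \<zeta> k)) (l2_nth \<eta> k)) \<in> U}"
    have "openin ultraweak_topology V"
      unfolding ultraweak_topology_def V_def
      by (intro topology_generated_by_Basis CollectI exI conjI) (rule refl l2_nth_square_summable U)+
    moreover have "{a \<in> topspace (subtopology ultraweak_topology A). \<psi> a \<in> U} = V \<inter> A"
      using openin_subset[OF \<open>openin ultraweak_topology V\<close>]
      by (auto simp: V_def \<eta> cinner_l2_def l2_nth_amp)
    ultimately show ?thesis by (auto simp: openin_subtopology)
  qed
  then show "\<psi> \<in> predual A"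
    using lin by (simp add: predual_def linear_on_def continuous_map_def)
qed

end

text \<open>The adjoint of the inclusion of \<open>D\<close>: \<open>graph_operator\<close> is
  applied to the identity relation on \<open>D\<close>.\<close>

lemma projection:
  fixes D :: "'h::chilbert_space set"
  assumes D: "0 \<in> D" "\<And>v w. v \<in> D \<Longrightarrow> w \<in> D \<Longrightarrow> v + w \<in> D" "\<And>c v. v \<in> D \<Longrightarrow> c *\<^sub>C v \<in> D"
  obtains P where "P \<in> bounded_ops" "\<And>v. blinfun_apply P v \<in> closure D"
    "\<And>v d. d \<in> closure D \<Longrightarrow> cinner d (v - blinfun_apply P v) = 0"
proof -
  obtain P where P: "P \<in> bounded_ops" "\<And>w. blinfun_apply P w \<in> closure (fst ` (\<lambda>d. (d, d)) ` D)"
    "\<And>v a w. (v, a) \<in> (\<lambda>d. (d, d)) ` D \<Longrightarrow> cinner a w = cinner v (blinfun_apply P w)"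
    by (rule graph_operator[of "(\<lambda>d. (d, d)) ` D" 1]) (use D in auto)
  show ?thesis
  proof (rule that[OF P(1)])
    show "blinfun_apply P v \<in> closure D" for v
      using P(2)[of v] by (simp add: image_image)
    show "cinner d (v - blinfun_apply P v) = 0" if "d \<in> closure D" for d v
      by (rule cinner_closure_zero[OF _ that]) (use P(3) in \<open>auto simp: cinner.diff_right\<close>)
  qed
qed

section \<open>Positive functionals and the Radon-Nikodym theorem\<close>

locale positive_linear = star_algebra A for A :: "('h::chilbert_space \<Rightarrow>\<^sub>L 'h) set" +
  fixes f :: "('h \<Rightarrow>\<^sub>L 'h) \<Rightarrow> complex"
  assumes linear: "linear_on A f"
    and nonneg: "x \<in> A \<Longrightarrow> f (adj x o\<^sub>L x) \<in> \<real>\<^sub>\<ge>\<^sub>0"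
begin

lemmas f_add = linear_onD(1)[OF linear]
  and f_scaleC = linear_onD(2)[OF linear]
  and f_diff = linear_on_diff[OF linear]

lemma f_square_expand:
  assumes "a \<in> A" "b \<in> A"
  shows "f (adj (a + cnj c *\<^sub>C b) o\<^sub>L (a + cnj c *\<^sub>C b)) =
    f (adj a o\<^sub>L a) + cnj c * f (adj a o\<^sub>L b) + c * f (adj b o\<^sub>L a) + complex_of_real ((cmod c)\<^sup>2) * f (adj b o\<^sub>L b)"
proof -
  have "adj (a + cnj c *\<^sub>C b) o\<^sub>L (a + cnj c *\<^sub>C b) =
      ((adj a o\<^sub>L a) + cnj c *\<^sub>C (adj a o\<^sub>L b)) + (c *\<^sub>C (adj b o\<^sub>L a) + (c * cnj c) *\<^sub>C (adj b o\<^sub>L b))"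
    using assms bounded
    by (simp add: adj_add adj_scaleC blinfun_compose_simps(1,2) blinfun_compose_scaleC_left
        blinfun_compose_scaleC_right bounded_ops_intros scaleC_scaleC scaleC_add_right)
  then show ?thesis
    using assms by (simp add: f_add f_scaleC closed complex_norm_square[symmetric])
qed

text \<open>The mixed terms of the expansion add up to a real number for every \<open>c\<close>;
  \<open>c = 1\<close> and \<open>c = \<i>\<close> give both components.\<close>

lemma f_hermitian:
  assumes "a \<in> A" "b \<in> A"
  shows "f (adj a o\<^sub>L b) = cnj (f (adj b o\<^sub>L a))"
proof -
  have real: "Im (f (adj x o\<^sub>L x)) = 0" if "x \<in> A" for x
    using nonneg[OF that] by (simp add: complex_nonneg_Reals_iff)
  have "Im (cnj c * f (adj a o\<^sub>L b) + c * f (adj b o\<^sub>L a)) = 0" for c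
    using real[of "a + cnj c *\<^sub>C b"] real[of a] real[of b] assms f_square_expand[OF assms, of c]
    by (simp add: closed)
  from this[of 1] this[of \<i>] show ?thesis by (simp add: complex_eq_iff)
qed

lemma f_Cauchy_Schwarz:
  assumes "a \<in> A" "b \<in> A"
  shows "(cmod (f (adj b o\<^sub>L a)))\<^sup>2 \<le> Re (f (adj a o\<^sub>L a)) * Re (f (adj b o\<^sub>L b))"
proof (rule cmod_square_le_if_quadratic_nonneg)
  fix c
  have "0 \<le> Re (f (adj (a + cnj c *\<^sub>C b) o\<^sub>L (a + cnj c *\<^sub>C b)))"
    using nonneg[of "a + cnj c *\<^sub>C b"] assms by (simp add: closed complex_nonneg_Reals_iff)
  also have "\<dots> = Re (f (adj a o\<^sub>L a)) + 2 * Re (c * f (adj b o\<^sub>L a)) + (cmod c)\<^sup>2 * Re (f (adj b o\<^sub>L b))"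
    unfolding f_square_expand[OF assms] f_hermitian[OF assms] by simp
  finally show "0 \<le> Re (f (adj a o\<^sub>L a)) + 2 * Re (c * f (adj b o\<^sub>L a)) + (cmod c)\<^sup>2 * Re (f (adj b o\<^sub>L b))" .
qed (use nonneg[OF assms(2)] in \<open>simp add: complex_nonneg_Reals_iff\<close>)

text \<open>From two vectors to one: \<open>f (adj x o\<^sub>L x)\<close> is the inner product
  \<open>cinner u v\<close> of the values of \<open>amp x\<close> at \<open>\<zeta>\<close> and
  \<open>\<eta>\<close>, and \<open>4 * Re (cinner u v)\<close> is at most the squared norm of
  \<open>u + v\<close>. Half of \<open>\<zeta> + \<eta>\<close> therefore works.\<close>

lemma f_dominated_square:
  assumes "dominated A f \<zeta>"
  obtains z where "\<And>x. x \<in> A \<Longrightarrow> Re (f (adj x o\<^sub>L x)) \<le> (norm (blinfun_apply (amp x) z))\<^sup>2"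
proof -
  obtain \<eta> where \<eta>: "\<And>a. a \<in> A \<Longrightarrow> f a = cinner (blinfun_apply (amp a) \<zeta>) \<eta>"
    by (rule dominated_representation[OF linear assms]) blast
  have "Re (f (adj x o\<^sub>L x)) \<le> (norm (blinfun_apply (amp x) ((1/2) *\<^sub>R (\<zeta> + \<eta>))))\<^sup>2" if x: "x \<in> A" for x
  proof -
    let ?u = "blinfun_apply (amp x) \<zeta>" and ?v = "blinfun_apply (amp x) \<eta>"
    have "f (adj x o\<^sub>L x) = cinner ?u ?v"
      using x bounded[OF x] by (simp add: \<eta> closed amp_simps amp_adj[symmetric] cinner_adj_left amp_bounded_ops)
    then have "Re (f (adj x o\<^sub>L x)) = Re (cinner ?u ?v)" by simp
    moreover have "4 * Re (cinner ?u ?v) = (norm (?u + ?v))\<^sup>2 - (norm (?u - ?v))\<^sup>2"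
      using norm_add_square[of ?u ?v] norm_add_square[of ?u "- ?v"] by (simp add: cinner.minus_right)
    moreover have "(norm (blinfun_apply (amp x) ((1/2) *\<^sub>R (\<zeta> + \<eta>))))\<^sup>2 = (norm (?u + ?v))\<^sup>2 / 4"
      by (simp add: blinfun.scaleR_right blinfun.add_right power_divide)
    ultimately show ?thesis using zero_le_power2[of "norm (?u - ?v)"] by linarith
  qed
  then show ?thesis by (rule that)
qed

text \<open>Radon--Nikodym: \<open>f\<close> is dominated by a vector functional \<open>z\<close>, so \<open>f (b\<^sup>* a) = \<langle>S a z, b z\<rangle>\<close> for some
  positive \<open>S\<close> in the commutant of the amplified algebra; the square root of \<open>S\<close> moves \<open>z\<close> to \<open>\<zeta>\<close>.\<close>

theorem vector_representation:
  assumes "dominated A f \<zeta>'"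
  obtains \<zeta> where "\<And>x. x \<in> A \<Longrightarrow> f (adj x o\<^sub>L x) = complex_of_real ((norm (blinfun_apply (amp x) \<zeta>))\<^sup>2)"
proof -
  obtain z where z: "\<And>x. x \<in> A \<Longrightarrow> Re (f (adj x o\<^sub>L x)) \<le> (norm (blinfun_apply (amp x) z))\<^sup>2"
    using f_dominated_square[OF assms] by blast
  define g where "g a = blinfun_apply (amp a) z" for a
  define D where "D = g ` A"
  have g_simps: "g (a + b) = g a + g b" "g (c *\<^sub>C a) = c *\<^sub>C g a" "g (a o\<^sub>L b) = blinfun_apply (amp a) (g b)" for a b c
    by (auto simp: g_def amp_simps blinfun.add_left blinfun_apply_scaleC)
  have D: "v + w \<in> D" "c *\<^sub>C v \<in> D" if "v \<in> D" "w \<in> D" for v w c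
    using that add scaleC by (auto simp: D_def g_simps[symmetric])
  have D0: "0 \<in> D" using D(2)[of _ _ 0] D_def zero by fastforce
  note closureD = closure_add_scaleC[of D, OF D(1) D(2)]
  have uniq: "x = y" if "x \<in> closure D" "y \<in> closure D" "\<And>b. b \<in> A \<Longrightarrow> cinner (g b) x = cinner (g b) y" for x y
    by (rule closure_subspace_eqI[of D]) (use D that in \<open>auto simp: D_def\<close>)
  have ampD: "blinfun_apply (amp c) v \<in> closure D" if c: "c \<in> A" and v: "v \<in> closure D" for c v
  proof -
    obtain h where h: "\<And>n. h n \<in> D" "h \<longlonglongrightarrow> v" using v by (auto simp: closure_sequential)
    have "blinfun_apply (amp c) (h n) \<in> D" for n
      using h(1)[of n] c compose by (auto simp: D_def g_simps[symmetric])
    moreover have "(\<lambda>n. blinfun_apply (amp c) (h n)) \<longlonglongrightarrow> blinfun_apply (amp c) v"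
      by (intro blinfun.tendsto tendsto_const h)
    ultimately show ?thesis unfolding closure_sequential by (intro exI conjI allI)
  qed
  have CS: "cmod (f (adj b o\<^sub>L a)) \<le> norm (g a) * norm (g b)" if "a \<in> A" "b \<in> A" for a b
  proof -
    have "(cmod (f (adj b o\<^sub>L a)))\<^sup>2 \<le> Re (f (adj a o\<^sub>L a)) * Re (f (adj b o\<^sub>L b))"
      by (rule f_Cauchy_Schwarz[OF that])
    also have "\<dots> \<le> (norm (g a))\<^sup>2 * (norm (g b))\<^sup>2"
      unfolding g_def using that z nonneg[OF that(2)]
      by (intro mult_mono) (auto simp: complex_nonneg_Reals_iff)
    finally show ?thesis by (simp add: power_mult_distrib[symmetric] power2_le_iff_abs_le)
  qed
  \<comment> \<open>\<open>w a\<close> represents the functional taking \<open>g b\<close> to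
    \<open>f (adj a o\<^sub>L b)\<close>. By the norm bound, the passage from \<open>g a\<close> to
    \<open>w a\<close> is a well-defined contraction, and \<open>S\<close> will be its
    adjoint.\<close>
  have "\<exists>w. w \<in> closure D \<and> norm w \<le> norm (g a) \<and> (\<forall>b\<in>A. f (adj a o\<^sub>L b) = cinner (g b) w)" if a: "a \<in> A" for a
  proof (rule Riesz_graph[of "(\<lambda>b. (g b, f (adj a o\<^sub>L b))) ` A" "norm (g a)"], goal_cases)
    case 1
    have "g 0 = 0" "f (adj a o\<^sub>L 0) = 0" by (simp_all add: g_def amp_simps linear_on_zero[OF linear])
    then show ?case using zero by (force simp: image_iff)
  next
    case (2 v x w y)
    then obtain b c where bc: "b \<in> A" "c \<in> A" "v = g b" "w = g c" "x = f (adj a o\<^sub>L b)" "y = f (adj a o\<^sub>L c)" by auto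
    then show ?case
      by (intro image_eqI[of _ _ "b + c"]) (auto simp: g_simps blinfun_compose_simps(1,2) f_add closed a)
  next
    case (3 c v x)
    then obtain b where b: "b \<in> A" "v = g b" "x = f (adj a o\<^sub>L b)" by auto
    then show ?case
      by (intro image_eqI[of _ _ "c *\<^sub>C b"])
        (auto simp: g_simps blinfun_compose_scaleC_right bounded f_scaleC closed a)
  next
    case (4 v x)
    then show ?case using CS[OF _ a] a CS[of _ a] f_hermitian[OF a] by (auto simp: mult.commute)
  next
    case (5 \<eta>)
    have "fst ` (\<lambda>b. (g b, f (adj a o\<^sub>L b))) ` A = D" by (force simp: D_def)
    with 5 show ?case by (intro exI[of _ \<eta>]) auto
  qed
  then obtain w where w: "\<And>a. a \<in> A \<Longrightarrow> w a \<in> closure D" "\<And>a. a \<in> A \<Longrightarrow> norm (w a) \<le> norm (g a)"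
    "\<And>a b. a \<in> A \<Longrightarrow> b \<in> A \<Longrightarrow> f (adj a o\<^sub>L b) = cinner (g b) (w a)"
    by metis
  have w': "cinner (w a) (g b) = f (adj b o\<^sub>L a)" if "a \<in> A" "b \<in> A" for a b
    using w(3)[OF that] f_hermitian[OF that] by (metis cinner_commute complex_cnj_cnj)
  have w_add: "w (a + b) = w a + w b" if "a \<in> A" "b \<in> A" for a b
  proof (rule uniq)
    fix c assume "c \<in> A"
    then show "cinner (g c) (w (a + b)) = cinner (g c) (w a + w b)"
      using that by (simp add: cinner_add_right w(3)[symmetric] closed adj_add bounded blinfun_compose_simps(1) f_add)
  qed (use that w closed closureD in auto)
  have w_scale: "w (c *\<^sub>C a) = c *\<^sub>C w a" if "a \<in> A" for a c
  proof (rule uniq)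
    fix b assume "b \<in> A"
    then show "cinner (g b) (w (c *\<^sub>C a)) = cinner (g b) (c *\<^sub>C w a)"
      using that by (simp add: cinner_scaleC_right w(3)[symmetric] closed adj_scaleC bounded blinfun_compose_scaleC_left f_scaleC)
  qed (use that w closed closureD in auto)
  obtain S where S: "S \<in> bounded_ops" "\<And>v. blinfun_apply S v \<in> closure (fst ` (\<lambda>a. (g a, w a)) ` A)"
    "\<And>v u x. (v, u) \<in> (\<lambda>a. (g a, w a)) ` A \<Longrightarrow> cinner u x = cinner v (blinfun_apply S x)"
  proof (rule graph_operator[of "(\<lambda>a. (g a, w a)) ` A" 1], goal_cases)
    case 1
    have "g 0 = 0" by (simp add: g_def amp_simps)
    moreover have "w 0 = 0" using w(2)[OF zero] \<open>g 0 = 0\<close> by simp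
    ultimately show ?case using zero by (force simp: image_iff)
  next
    case (2 v a u b)
    then show ?case using add by (force simp: image_iff g_simps w_add)
  next
    case (3 c v a)
    then show ?case using scaleC by (force simp: image_iff g_simps w_scale)
  next
    case (5 v a)
    then show ?case using w(2) by auto
  qed auto
  have SD: "blinfun_apply S v \<in> closure D" for v
    using S(2)[of v] by (simp add: D_def image_image)
  have Sg: "cinner (g a) (blinfun_apply S v) = cinner (w a) v" if "a \<in> A" for a v
    using S(3)[of "g a" "w a" v] that by auto
  \<comment> \<open>\<open>S\<close> vanishes on the orthogonal complement of \<open>D\<close>.
    Positivity can thus be checked after projecting to the closure of \<open>D\<close>, and by
    continuity on \<open>D\<close>, where it is the positivity of \<open>f\<close>.\<close>
  have S_orth: "blinfun_apply S v = 0" if "\<And>d. d \<in> closure D \<Longrightarrow> cinner d v = 0" for v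
    by (rule uniq) (use SD closure_subset D0 in \<open>auto simp: Sg that w(1) cinner.zero_right\<close>)
  obtain P where P: "\<And>v. blinfun_apply P v \<in> closure D"
    "\<And>v d. d \<in> closure D \<Longrightarrow> cinner d (v - blinfun_apply P v) = 0"
    using projection[of D] D D0 by metis
  have "positive_op S"
    unfolding positive_op_def
  proof
    fix v
    let ?p = "blinfun_apply P v"
    have "blinfun_apply S (v - ?p) = 0" by (rule S_orth) (rule P(2))
    then have Sv: "blinfun_apply S v = blinfun_apply S ?p" by (simp add: blinfun.diff_right)
    have eq: "cinner (blinfun_apply S v) v = cinner (blinfun_apply S ?p) ?p"
      using P(2)[OF SD[of v], of v] unfolding Sv by (simp add: cinner.diff_right)
    obtain h where h: "\<And>n. h n \<in> D" "h \<longlonglongrightarrow> ?p" using P(1)[of v] by (auto simp: closure_sequential)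
    have "cinner (blinfun_apply S (h n)) (h n) \<in> \<real>\<^sub>\<ge>\<^sub>0" for n
    proof -
      obtain a where a: "a \<in> A" "h n = g a" using h(1)[of n] by (auto simp: D_def)
      have "cinner (blinfun_apply S (h n)) (h n) = cnj (f (adj a o\<^sub>L a))"
        unfolding a(2) using Sg[OF a(1)] w'[OF a(1) a(1)] by (metis cinner_commute)
      then show ?thesis using nonneg[OF a(1)] by (simp add: complex_nonneg_Reals_iff)
    qed
    moreover have "(\<lambda>n. cinner (blinfun_apply S (h n)) (h n)) \<longlonglongrightarrow> cinner (blinfun_apply S ?p) ?p"
      by (intro tendsto_intros blinfun.tendsto h)
    ultimately show "cinner (blinfun_apply S v) v \<in> \<real>\<^sub>\<ge>\<^sub>0"
      unfolding eq by (intro Lim_in_closed_set[OF closed_nonneg_Reals_complex]) auto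
  qed
  have S_comm: "amp c o\<^sub>L S = S o\<^sub>L amp c" if c: "c \<in> A" for c
  proof (rule blinfun_eqI)
    fix v
    note cb = amp_bounded_ops[OF bounded[OF c]]
    \<comment> \<open>Both sides have the inner product
      \<open>f (adj a o\<^sub>L (c o\<^sub>L b))\<close> with every \<open>g b\<close>.\<close>
    have wc: "w (adj c o\<^sub>L a) = blinfun_apply (amp (adj c)) (w a)" if a: "a \<in> A" for a
    proof (rule uniq)
      fix b assume b: "b \<in> A"
      have "cinner (g b) (w (adj c o\<^sub>L a)) = f (adj a o\<^sub>L (c o\<^sub>L b))"
        using a b c by (simp add: w(3)[symmetric] closed adj_compose adj_adj bounded blinfun_compose_assoc)
      also have "\<dots> = cinner (g b) (blinfun_apply (amp (adj c)) (w a))"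
        using a b c by (simp add: w(3) closed g_simps amp_adj[symmetric] bounded cinner_adj_right cb)
      finally show "cinner (g b) (w (adj c o\<^sub>L a)) = cinner (g b) (blinfun_apply (amp (adj c)) (w a))" .
    qed (use a c closed w(1) ampD in auto)
    have "blinfun_apply (amp c) (blinfun_apply S v) = blinfun_apply S (blinfun_apply (amp c) v)"
    proof (rule uniq)
      fix a assume a: "a \<in> A"
      have "cinner (g a) (blinfun_apply (amp c) (blinfun_apply S v)) = cinner (g (adj c o\<^sub>L a)) (blinfun_apply S v)"
        using c by (simp add: g_simps amp_adj[symmetric] bounded cinner_adj_left cb)
      also have "\<dots> = cinner (w (adj c o\<^sub>L a)) v" using a c by (simp add: Sg closed)
      also have "\<dots> = cinner (w a) (blinfun_apply (amp c) v)"
        using c by (simp add: wc[OF a] amp_adj[symmetric] bounded cinner_adj_left cb)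
      finally show "cinner (g a) (blinfun_apply (amp c) (blinfun_apply S v)) =
          cinner (g a) (blinfun_apply S (blinfun_apply (amp c) v))"
        using a by (simp add: Sg)
    qed (use SD ampD c in auto)
    then show "blinfun_apply (amp c o\<^sub>L S) v = blinfun_apply (S o\<^sub>L amp c) v" by simp
  qed
  obtain R where R: "R \<in> bounded_ops" "positive_op R" "R o\<^sub>L R = S"
    "\<forall>T. T o\<^sub>L S = S o\<^sub>L T \<longrightarrow> T o\<^sub>L R = R o\<^sub>L T"
    using op_sqrt[OF S(1) \<open>positive_op S\<close>] by metis
  show ?thesis
  proof (rule that[of "blinfun_apply R z"])
    fix x assume x: "x \<in> A"
    have "amp x o\<^sub>L R = R o\<^sub>L amp x"
      using R(4)[THEN spec, THEN mp, OF S_comm[OF x]] .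
    then have "blinfun_apply (amp x) (blinfun_apply R z) = blinfun_apply R (g x)"
      unfolding g_def by (metis blinfun_apply_blinfun_compose)
    then have "complex_of_real ((norm (blinfun_apply (amp x) (blinfun_apply R z)))\<^sup>2) =
        cinner (blinfun_apply R (g x)) (blinfun_apply R (g x))"
      by (simp only: cinner_self)
    also have "\<dots> = cinner (g x) (blinfun_apply (R o\<^sub>L R) (g x))"
      by (simp add: positive_op_symmetric[OF R(1,2)])
    also have "\<dots> = f (adj x o\<^sub>L x)"
      unfolding R(3) using Sg[OF x] w'[OF x x] by simp
    finally show "f (adj x o\<^sub>L x) = complex_of_real ((norm (blinfun_apply (amp x) (blinfun_apply R z)))\<^sup>2)" ..
  qed
qed

end

section \<open>Bounded chains of positive operators\<close>

lemma op_le_quadratic: "a \<preceq> b \<Longrightarrow> Re (cinner (blinfun_apply a v) v) \<le> Re (cinner (blinfun_apply b v) v)"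
  by (simp add: op_le_def positive_op_iff blinfun.diff_left cinner.diff_left)

lemma op_le_add_right: "0 \<preceq> b \<Longrightarrow> a \<preceq> a + b"
  by (simp add: op_le_def)

lemma op_le_cancel: "a \<preceq> b \<Longrightarrow> c + a \<preceq> c + b" "a \<preceq> b \<Longrightarrow> 0 \<preceq> b - a" "a \<preceq> b \<Longrightarrow> c - b \<preceq> c - a"
  "0 \<preceq> a \<Longrightarrow> b - a \<preceq> b" "0 \<preceq> a \<Longrightarrow> 0 \<preceq> b \<Longrightarrow> 0 \<preceq> a + b"
  by (simp_all add: op_le_def positive_op_add)

text \<open>\<open>bounded_ops\<close> enters through antisymmetry, which fails for general
  real-linear operators.\<close>

lemma op_Zorn:
  assumes S: "S \<subseteq> bounded_ops" "S \<noteq> {}"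
    and chain: "\<And>C. C \<subseteq> S \<Longrightarrow> C \<noteq> {} \<Longrightarrow> (\<And>a b. a \<in> C \<Longrightarrow> b \<in> C \<Longrightarrow> a \<preceq> b \<or> b \<preceq> a) \<Longrightarrow> \<exists>u\<in>S. \<forall>c\<in>C. c \<preceq> u"
  obtains m where "m \<in> S" "\<And>a. a \<in> S \<Longrightarrow> m \<preceq> a \<Longrightarrow> a = m"
proof -
  have "\<exists>m\<in>S. \<forall>a\<in>S. m \<preceq> a \<longrightarrow> a = m"
  proof (rule predicate_Zorn)
    show "partial_order_on S (relation_of (\<preceq>) S)"
    proof (rule partial_order_on_relation_ofI)
      show "a \<preceq> c" if "a \<preceq> b" "b \<preceq> c" for a b c using that by (rule op_le_trans)
      show "a = b" if "a \<in> S" "b \<in> S" "a \<preceq> b" "b \<preceq> a" for a b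
        using that(3,4) by (intro op_le_antisym subsetD[OF S(1)] that(1,2))
    qed simp
    show "\<exists>u\<in>S. \<forall>a\<in>C. a \<preceq> u" if C: "C \<in> Chains (relation_of (\<preceq>) S)" for C
    proof (cases "C = {}")
      case True
      then show ?thesis using S(2) by blast
    next
      case False
      have "C \<subseteq> S" "\<And>a b. a \<in> C \<Longrightarrow> b \<in> C \<Longrightarrow> a \<preceq> b \<or> b \<preceq> a"
        using C by (auto simp: Chains_def relation_of_def)
      then show ?thesis using chain False by blast
    qed
  qed
  then show ?thesis using that by blast
qed

definition op_chain :: "('h::chilbert_space \<Rightarrow>\<^sub>L 'h) set \<Rightarrow> bool" where
  "op_chain C \<longleftrightarrow> C \<noteq> {} \<and> (\<forall>a\<in>C. \<forall>b\<in>C. a \<preceq> b \<or> b \<preceq> a)"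

text \<open>The filter of tails of \<open>C\<close>, so that limits along a chain are indexed by the
  chain itself.\<close>

definition chain_filter :: "('h::chilbert_space \<Rightarrow>\<^sub>L 'h) set \<Rightarrow> ('h \<Rightarrow>\<^sub>L 'h) filter" where
  "chain_filter C = (INF c\<in>C. principal {d\<in>C. c \<preceq> d})"

lemma eventually_chain_filter:
  assumes "op_chain C"
  shows "eventually P (chain_filter C) \<longleftrightarrow> (\<exists>c\<in>C. \<forall>d\<in>C. c \<preceq> d \<longrightarrow> P d)"
  unfolding chain_filter_def
proof (subst eventually_INF_base)
  show "C \<noteq> {}" using assms by (simp add: op_chain_def)
  show "\<exists>x\<in>C. principal {d\<in>C. x \<preceq> d} \<le> inf (principal {d\<in>C. a \<preceq> d}) (principal {d\<in>C. b \<preceq> d})"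
    if "a \<in> C" "b \<in> C" for a b
  proof (cases "a \<preceq> b")
    case True
    then show ?thesis using that by (intro bexI[of _ b]) (auto intro: op_le_trans)
  next
    case False
    then have "b \<preceq> a" using assms that by (auto simp: op_chain_def)
    then show ?thesis using that by (intro bexI[of _ a]) (auto intro: op_le_trans)
  qed
qed (auto simp: eventually_principal)

lemma chain_filter_not_bot: "op_chain C \<Longrightarrow> chain_filter C \<noteq> bot"
  unfolding trivial_limit_def by (subst eventually_chain_filter) (auto intro: op_le_refl)

lemma eventually_chain_filter_ge: "op_chain C \<Longrightarrow> c \<in> C \<Longrightarrow> \<forall>\<^sub>F d in chain_filter C. d \<in> C \<and> c \<preceq> d"
  by (subst eventually_chain_filter) auto

lemma eventually_chain_filter_mem: "op_chain C \<Longrightarrow> \<forall>\<^sub>F d in chain_filter C. d \<in> C"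
  by (subst eventually_chain_filter) (auto simp: op_chain_def)

text \<open>For \<open>c \<preceq> d\<close> in the chain, \<open>d - c\<close> is again a positive
  contraction, so the squared norm of \<open>(d - c) v\<close> is at most the increment of the
  quadratic form at \<open>v\<close>. These forms increase to a finite supremum, which makes the
  values at \<open>v\<close> Cauchy.\<close>

lemma chain_strong_limit:
  assumes C: "op_chain C" "C \<subseteq> {a \<in> bounded_ops. 0 \<preceq> a \<and> a \<preceq> id_blinfun}"
  obtains s where "s \<in> bounded_ops" "\<And>v. ((\<lambda>c. blinfun_apply c v) \<longlongrightarrow> blinfun_apply s v) (chain_filter C)"
proof -
  note F = chain_filter_not_bot[OF C(1)]
  have CD: "c \<in> bounded_ops" "0 \<preceq> c" "c \<preceq> id_blinfun" if "c \<in> C" for c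
    using C(2) that by auto
  have "\<exists>l. ((\<lambda>c. blinfun_apply c v) \<longlongrightarrow> l) (chain_filter C)" for v
  proof -
    define q where "q c = Re (cinner (blinfun_apply c v) v)" for c
    have q_bound: "q c \<le> (norm v)\<^sup>2" if "c \<in> C" for c
      using op_le_quadratic[OF CD(3)[OF that], of v] by (simp add: q_def cinner_self)
    have diff: "(norm (blinfun_apply d v - blinfun_apply c v))\<^sup>2 \<le> q d - q c" if "c \<in> C" "d \<in> C" "c \<preceq> d" for c d
    proof -
      have "d - c \<preceq> id_blinfun"
        by (rule op_le_trans[OF op_le_cancel(4)[OF CD(2)[OF that(1)]] CD(3)[OF that(2)]])
      then have "(norm (blinfun_apply (d - c) v))\<^sup>2 \<le> Re (cinner (blinfun_apply (d - c) v) v)"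
        by (rule norm_square_le_cinner[OF bounded_ops_diff[OF CD(1)[OF that(2)] CD(1)[OF that(1)]] op_le_cancel(2)[OF that(3)]])
      then show ?thesis by (simp add: blinfun.diff_left cinner.diff_left q_def)
    qed
    have bdd: "bdd_above (q ` C)" using q_bound by (rule bdd_aboveI2)
    have "cauchy_filter (filtermap (\<lambda>c. blinfun_apply c v) (chain_filter C))"
      unfolding cauchy_filter_metric_filtermap
    proof (intro allI impI)
      fix e :: real assume e: "0 < e"
      have "q ` C \<noteq> {}" using C(1) by (simp add: op_chain_def)
      then obtain c where c: "c \<in> C" "(SUP c\<in>C. q c) - (e / 2)\<^sup>2 < q c"
        using less_cSUP_iff[OF _ bdd, of "(SUP c\<in>C. q c) - (e / 2)\<^sup>2"] e by auto
      have near: "norm (blinfun_apply d v - blinfun_apply c v) < e / 2" if d: "d \<in> C" "c \<preceq> d" for d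
      proof -
        have "(norm (blinfun_apply d v - blinfun_apply c v))\<^sup>2 \<le> q d - q c" by (rule diff[OF c(1) d])
        also have "\<dots> < (e / 2)\<^sup>2" using cSUP_upper[OF d(1) bdd] c(2) by simp
        finally show ?thesis by (rule power2_less_imp_less) (use e in simp)
      qed
      show "\<exists>P. eventually P (chain_filter C) \<and> (\<forall>x y. P x \<and> P y \<longrightarrow> dist (blinfun_apply x v) (blinfun_apply y v) < e)"
      proof (intro exI conjI allI impI)
        show "\<forall>\<^sub>F d in chain_filter C. d \<in> C \<and> c \<preceq> d"
          by (rule eventually_chain_filter_ge[OF C(1) c(1)])
        fix x y assume "(x \<in> C \<and> c \<preceq> x) \<and> (y \<in> C \<and> c \<preceq> y)"
        then have "dist (blinfun_apply x v) (blinfun_apply c v) < e / 2" "dist (blinfun_apply y v) (blinfun_apply c v) < e / 2"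
          using near by (auto simp: dist_norm)
        then show "dist (blinfun_apply x v) (blinfun_apply y v) < e" by (rule dist_triangle_half_l)
      qed
    qed
    from cauchy_filter_complete_converges[OF this complete_UNIV] F show ?thesis
      by (auto simp: filterlim_def filtermap_bot_iff)
  qed
  then obtain u where u: "\<And>v. ((\<lambda>c. blinfun_apply c v) \<longlongrightarrow> u v) (chain_filter C)" by metis
  have mem: "\<forall>\<^sub>F c in chain_filter C. c \<in> C" by (rule eventually_chain_filter_mem[OF C(1)])
  have add: "u (v + w) = u v + u w" for v w
    by (rule tendsto_unique[OF F u]) (simp only: blinfun.add_right, intro tendsto_intros u)
  have scale: "u (c *\<^sub>C v) = c *\<^sub>C u v" for c v
  proof (rule tendsto_unique[OF F u])
    have "\<forall>\<^sub>F a in chain_filter C. c *\<^sub>C blinfun_apply a v = blinfun_apply a (c *\<^sub>C v)"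
      using mem by eventually_elim (simp add: bounded_ops_apply_scaleC CD(1))
    moreover have "((\<lambda>a. c *\<^sub>C blinfun_apply a v) \<longlongrightarrow> c *\<^sub>C u v) (chain_filter C)"
      by (intro tendsto_intros u)
    ultimately show "((\<lambda>a. blinfun_apply a (c *\<^sub>C v)) \<longlongrightarrow> c *\<^sub>C u v) (chain_filter C)"
      by (rule Lim_transform_eventually[rotated])
  qed
  have "norm (u v) \<le> norm v" for v
  proof (rule tendsto_upperbound[OF tendsto_norm[OF u] _ F])
    show "\<forall>\<^sub>F c in chain_filter C. norm (blinfun_apply c v) \<le> norm v"
      using mem by eventually_elim (intro norm_le_one_if_contraction CD)
  qed
  then have "bounded_linear u"
    by (intro bounded_linear_intro[where K = 1]) (simp_all add: add scale scaleR_scaleC)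
  then have U: "blinfun_apply (Blinfun u) = u" by (rule bounded_linear_Blinfun_apply)
  show ?thesis
    by (rule that[of "Blinfun u"]) (simp_all add: bounded_ops_def U scale u)
qed

context von_neumann
begin

definition unit_interval :: "('a \<Rightarrow>\<^sub>L 'a) set" where
  "unit_interval = {a \<in> A. 0 \<preceq> a \<and> a \<preceq> id_blinfun}"

lemma unit_intervalD:
  "a \<in> unit_interval \<Longrightarrow> a \<in> A" "a \<in> unit_interval \<Longrightarrow> 0 \<preceq> a" "a \<in> unit_interval \<Longrightarrow> a \<preceq> id_blinfun"
  "a \<in> unit_interval \<Longrightarrow> a \<in> bounded_ops"
  by (auto simp: unit_interval_def bounded)

text \<open>The strong limit commutes with everything that commutes with the chain, hence stays in
  \<open>A\<close>; testing quadratic forms shows that it is the supremum. Both descriptions are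
  kept: an anti-automorphism transports the first three clauses, vector functionals exploit the
  fourth.\<close>

lemma chain_lub:
  assumes C: "op_chain C" "C \<subseteq> unit_interval"
  obtains s where "s \<in> unit_interval" "\<And>c. c \<in> C \<Longrightarrow> c \<preceq> s"
    "\<And>u. (\<And>c. c \<in> C \<Longrightarrow> c \<preceq> u) \<Longrightarrow> s \<preceq> u"
    "\<And>v. ((\<lambda>c. blinfun_apply c v) \<longlongrightarrow> blinfun_apply s v) (chain_filter C)"
proof -
  have "C \<subseteq> {a \<in> bounded_ops. 0 \<preceq> a \<and> a \<preceq> id_blinfun}"
    using C(2) by (auto dest: unit_intervalD)
  then obtain s where s: "s \<in> bounded_ops"
    and lim: "\<And>v. ((\<lambda>c. blinfun_apply c v) \<longlongrightarrow> blinfun_apply s v) (chain_filter C)"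
    by (rule chain_strong_limit[OF C(1)]) blast
  note F = chain_filter_not_bot[OF C(1)]
  note mem = eventually_chain_filter_mem[OF C(1)]
  have lower: "b \<preceq> s" if "\<forall>\<^sub>F c in chain_filter C. b \<preceq> c" for b
    unfolding op_le_def positive_op_def
  proof
    fix v
    show "cinner (blinfun_apply (s - b) v) v \<in> \<real>\<^sub>\<ge>\<^sub>0"
    proof (rule Lim_in_closed_set[OF closed_nonneg_Reals_complex _ F])
      show "\<forall>\<^sub>F c in chain_filter C. cinner (blinfun_apply (c - b) v) v \<in> \<real>\<^sub>\<ge>\<^sub>0"
        using that by eventually_elim (simp add: op_le_def positive_op_def)
      show "((\<lambda>c. cinner (blinfun_apply (c - b) v) v) \<longlongrightarrow> cinner (blinfun_apply (s - b) v) v) (chain_filter C)"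
        unfolding blinfun.diff_left by (intro tendsto_intros lim)
    qed
  qed
  have upper: "s \<preceq> b" if "\<And>c. c \<in> C \<Longrightarrow> c \<preceq> b" for b
    unfolding op_le_def positive_op_def
  proof
    fix v
    show "cinner (blinfun_apply (b - s) v) v \<in> \<real>\<^sub>\<ge>\<^sub>0"
    proof (rule Lim_in_closed_set[OF closed_nonneg_Reals_complex _ F])
      show "\<forall>\<^sub>F c in chain_filter C. cinner (blinfun_apply (b - c) v) v \<in> \<real>\<^sub>\<ge>\<^sub>0"
        using mem by eventually_elim (use that in \<open>simp add: op_le_def positive_op_def\<close>)
      show "((\<lambda>c. cinner (blinfun_apply (b - c) v) v) \<longlongrightarrow> cinner (blinfun_apply (b - s) v) v) (chain_filter C)"
        unfolding blinfun.diff_left by (intro tendsto_intros lim)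
    qed
  qed
  have "s \<in> commutant (commutant A)"
  proof (rule commutantI[OF s])
    fix T assume T: "T \<in> commutant A"
    show "s o\<^sub>L T = T o\<^sub>L s"
    proof (rule blinfun_eqI)
      fix v
      have "((\<lambda>c. blinfun_apply T (blinfun_apply c v)) \<longlongrightarrow> blinfun_apply T (blinfun_apply s v)) (chain_filter C)"
        by (intro blinfun.tendsto tendsto_const lim)
      moreover have "\<forall>\<^sub>F c in chain_filter C. blinfun_apply T (blinfun_apply c v) = blinfun_apply c (blinfun_apply T v)"
        using mem
      proof eventually_elim
        case (elim c)
        then have "T o\<^sub>L c = c o\<^sub>L T" using commutantD(1)[OF T] C(2) unit_intervalD(1) by blast
        then show ?case by (metis blinfun_apply_blinfun_compose)
      qed
      ultimately have "((\<lambda>c. blinfun_apply c (blinfun_apply T v)) \<longlongrightarrow> blinfun_apply T (blinfun_apply s v)) (chain_filter C)"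
        by (rule Lim_transform_eventually)
      from tendsto_unique[OF F lim this] show "blinfun_apply (s o\<^sub>L T) v = blinfun_apply (T o\<^sub>L s) v"
        by simp
    qed
  qed
  then have sA: "s \<in> A" using bicommutant by blast
  have ge: "c \<preceq> s" if "c \<in> C" for c
    by (rule lower) (use eventually_chain_filter_ge[OF C(1) that] in \<open>auto elim: eventually_mono\<close>)
  have "0 \<preceq> s" by (rule lower, use mem in eventually_elim) (use C(2) unit_intervalD(2) in blast)
  moreover have "s \<preceq> id_blinfun" by (rule upper) (use C(2) unit_intervalD(3) in blast)
  ultimately have "s \<in> unit_interval" using sA by (simp add: unit_interval_def)
  from that[OF this ge upper lim] show ?thesis .
qed

text \<open>Upper bounds range over \<open>A\<close> only, which makes the notion invariant under
  order isomorphisms of \<open>A\<close>.\<close>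

definition is_lub :: "('a \<Rightarrow>\<^sub>L 'a) set \<Rightarrow> ('a \<Rightarrow>\<^sub>L 'a) \<Rightarrow> bool" where
  "is_lub C s \<longleftrightarrow> s \<in> A \<and> (\<forall>c\<in>C. c \<preceq> s) \<and> (\<forall>u\<in>A. (\<forall>c\<in>C. c \<preceq> u) \<longrightarrow> s \<preceq> u)"

lemma is_lub_unique: "is_lub C s \<Longrightarrow> is_lub C s' \<Longrightarrow> s = s'"
  unfolding is_lub_def by (meson bounded op_le_antisym)

end

section \<open>Order-continuous positive functionals are normal\<close>

locale normal_positive = von_neumann A + positive_linear A f
  for A :: "('h::chilbert_space \<Rightarrow>\<^sub>L 'h) set" and f +
  assumes normal: "op_chain C \<Longrightarrow> C \<subseteq> unit_interval \<Longrightarrow> is_lub C s \<Longrightarrow> s \<in> unit_interval \<Longrightarrow> 0 < e \<Longrightarrow>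
    \<exists>c\<in>C. Re (f s) - e < Re (f c)"
begin

lemma f_positive: "a \<in> A \<Longrightarrow> 0 \<preceq> a \<Longrightarrow> 0 \<le> Re (f a)"
  by (metis sqrt nonneg op_le_def diff_zero complex_nonneg_Reals_iff)

lemma f_mono: "a \<in> A \<Longrightarrow> b \<in> A \<Longrightarrow> a \<preceq> b \<Longrightarrow> Re (f a) \<le> Re (f b)"
  using f_positive[of "b - a"] by (simp add: f_diff diff op_le_def)

lemma cmod_f_square_le:
  assumes "x \<in> A"
  shows "(cmod (f x))\<^sup>2 \<le> Re (f id_blinfun) * Re (f (adj x o\<^sub>L x))"
  using f_Cauchy_Schwarz[OF assms ident] by (simp add: adj_id blinfun_compose_simps mult.commute)

text \<open>The form of the left side at \<open>v\<close> is at most \<open>K\<close> times the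
  squared norm of \<open>e v\<close>, and \<open>e o\<^sub>L e \<preceq> e\<close> for a positive
  contraction. Leaving \<open>K\<close> free allows a strictly positive one where it serves as a
  divisor.\<close>

lemma sandwich_le:
  assumes e: "e \<in> unit_interval" and x: "x \<in> A" and K: "(norm x)\<^sup>2 \<le> K"
  shows "adj (x o\<^sub>L e) o\<^sub>L (x o\<^sub>L e) \<preceq> K *\<^sub>R e"
proof -
  have "positive_op (K *\<^sub>R e - (adj (x o\<^sub>L e) o\<^sub>L (x o\<^sub>L e)))"
    unfolding positive_op_iff
  proof (intro allI conjI)
    fix v
    note eb = unit_intervalD(4)[OF e] and pe = unit_intervalD(2)[OF e, unfolded op_le_def diff_zero]
    have eq: "cinner (blinfun_apply (K *\<^sub>R e - (adj (x o\<^sub>L e) o\<^sub>L (x o\<^sub>L e))) v) v =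
        K *\<^sub>R cinner (blinfun_apply e v) v - complex_of_real ((norm (blinfun_apply (x o\<^sub>L e) v))\<^sup>2)"
      by (simp add: blinfun.diff_left blinfun.scaleR_left cinner.diff_left cinner_scaleR_left
          cinner_adj_left bounded_ops_compose bounded[OF x] eb cinner_self[symmetric] del: of_real_power)
    show "Im (cinner (blinfun_apply (K *\<^sub>R e - (adj (x o\<^sub>L e) o\<^sub>L (x o\<^sub>L e))) v) v) = 0"
      unfolding eq using pe by (simp add: positive_op_iff)
    have "(norm (blinfun_apply (x o\<^sub>L e) v))\<^sup>2 \<le> (norm x * norm (blinfun_apply e v))\<^sup>2"
      by (intro power_mono) (simp_all add: norm_blinfun)
    also have "\<dots> = (norm x)\<^sup>2 * (norm (blinfun_apply e v))\<^sup>2" by (rule power_mult_distrib)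
    also have "\<dots> \<le> K * Re (cinner (blinfun_apply e v) v)"
      by (intro mult_mono K norm_square_le_cinner unit_intervalD[OF e])
        (use K order_trans[OF zero_le_power2] in auto)
    finally show "0 \<le> Re (cinner (blinfun_apply (K *\<^sub>R e - (adj (x o\<^sub>L e) o\<^sub>L (x o\<^sub>L e))) v) v)"
      unfolding eq by simp
  qed
  then show ?thesis by (simp add: op_le_def)
qed

text \<open>A small \<open>f e\<close> makes \<open>f (x o\<^sub>L e)\<close> small for every
  \<open>x\<close>; this controls the remainder when a supremum is approached from below.\<close>

lemma f_sandwich:
  assumes e: "e \<in> unit_interval" and x: "x \<in> A"
  shows "(cmod (f (x o\<^sub>L e)))\<^sup>2 \<le> Re (f id_blinfun) * ((norm x)\<^sup>2 * Re (f e))"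
proof -
  note eA = unit_intervalD(1)[OF e]
  have "(cmod (f (x o\<^sub>L e)))\<^sup>2 \<le> Re (f id_blinfun) * Re (f (adj (x o\<^sub>L e) o\<^sub>L (x o\<^sub>L e)))"
    by (rule cmod_f_square_le) (intro closed x eA)
  also have "\<dots> \<le> Re (f id_blinfun) * Re (f ((norm x)\<^sup>2 *\<^sub>R e))"
    by (intro mult_left_mono f_mono sandwich_le closed x e eA order_refl f_positive) (simp add: op_le_def)
  finally show ?thesis by (simp add: scaleR_scaleC f_scaleC eA)
qed

text \<open>A Hahn decomposition. Take \<open>a\<close> below \<open>b\<close> maximal such that the
  vector functional is at most \<open>f\<close> at \<open>a\<close>. A \<open>d\<close> below
  \<open>b - a\<close> at which \<open>f\<close> is strictly larger could be added to
  \<open>a\<close>, so \<open>c = b - a\<close> works; the strict inequality at \<open>b\<close>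
  excludes \<open>c = 0\<close>.\<close>

lemma vector_majorant_below:
  assumes b: "b \<in> unit_interval" and less: "Re (f b) < Re (cinner (blinfun_apply b \<xi>) \<xi>)"
  obtains c where "c \<in> unit_interval" "c \<preceq> b" "c \<noteq> 0"
    "\<And>d. d \<in> A \<Longrightarrow> 0 \<preceq> d \<Longrightarrow> d \<preceq> c \<Longrightarrow> Re (f d) \<le> Re (cinner (blinfun_apply d \<xi>) \<xi>)"
proof -
  define S where "S = {a \<in> unit_interval. a \<preceq> b \<and> Re (cinner (blinfun_apply a \<xi>) \<xi>) \<le> Re (f a)}"
  have "0 \<preceq> id_blinfun" by (simp add: op_le_def)
  then have "0 \<in> S"
    using unit_intervalD(2)[OF b] by (simp add: S_def unit_interval_def zero linear_on_zero[OF linear] cinner.zero_left)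
  have "\<exists>u\<in>S. \<forall>c\<in>C. c \<preceq> u" if C: "C \<subseteq> S" "C \<noteq> {}" "\<And>a b. a \<in> C \<Longrightarrow> b \<in> C \<Longrightarrow> a \<preceq> b \<or> b \<preceq> a" for C
  proof -
    have ch: "op_chain C" using C(2,3) by (simp add: op_chain_def)
    obtain s where s: "s \<in> unit_interval" "\<And>c. c \<in> C \<Longrightarrow> c \<preceq> s" "\<And>u. (\<And>c. c \<in> C \<Longrightarrow> c \<preceq> u) \<Longrightarrow> s \<preceq> u"
      "\<And>v. ((\<lambda>c. blinfun_apply c v) \<longlongrightarrow> blinfun_apply s v) (chain_filter C)"
      by (rule chain_lub[OF ch]) (use C(1) S_def in auto)
    \<comment> \<open>The vector functional is strongly continuous along the chain and
      \<open>f\<close> is monotone, so the inequality survives the supremum.\<close>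
    have "Re (cinner (blinfun_apply s \<xi>) \<xi>) \<le> Re (f s)"
    proof (rule tendsto_upperbound[OF _ _ chain_filter_not_bot[OF ch]])
      show "((\<lambda>c. Re (cinner (blinfun_apply c \<xi>) \<xi>)) \<longlongrightarrow> Re (cinner (blinfun_apply s \<xi>) \<xi>)) (chain_filter C)"
        by (intro tendsto_intros s(4))
      show "\<forall>\<^sub>F c in chain_filter C. Re (cinner (blinfun_apply c \<xi>) \<xi>) \<le> Re (f s)"
        using eventually_chain_filter_mem[OF ch]
      proof eventually_elim
        case (elim c)
        then have "Re (cinner (blinfun_apply c \<xi>) \<xi>) \<le> Re (f c)" "c \<in> A"
          using C(1) by (auto simp: S_def unit_interval_def)
        then show ?case using f_mono[of c s] s(1,2) elim unit_intervalD(1) by force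
      qed
    qed
    moreover have "s \<preceq> b" by (rule s(3)) (use C(1) in \<open>auto simp: S_def\<close>)
    ultimately show ?thesis using s(1,2) by (auto simp: S_def)
  qed
  then obtain a where a: "a \<in> S" and max: "\<And>a'. a' \<in> S \<Longrightarrow> a \<preceq> a' \<Longrightarrow> a' = a"
    by (rule op_Zorn[of S, rotated 2]) (use \<open>0 \<in> S\<close> in \<open>auto simp: S_def unit_intervalD(4)\<close>)
  have aI: "a \<in> unit_interval" "a \<preceq> b" "Re (cinner (blinfun_apply a \<xi>) \<xi>) \<le> Re (f a)" using a by (auto simp: S_def)
  note aA = unit_intervalD(1)[OF aI(1)] and bA = unit_intervalD(1)[OF b]
  show ?thesis
  proof (rule that[of "b - a"])
    show le: "b - a \<preceq> b" by (rule op_le_cancel(4)[OF unit_intervalD(2)[OF aI(1)]])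
    show "b - a \<in> unit_interval"
      using op_le_trans[OF le unit_intervalD(3)[OF b]] op_le_cancel(2)[OF aI(2)]
      by (simp add: unit_interval_def diff aA bA)
    show "b - a \<noteq> 0" using less aI(3) by auto
    fix d assume d: "d \<in> A" "0 \<preceq> d" "d \<preceq> b - a"
    show "Re (f d) \<le> Re (cinner (blinfun_apply d \<xi>) \<xi>)"
    proof (rule ccontr)
      assume not: "\<not> ?thesis"
      have "a + d \<preceq> b" using op_le_cancel(1)[OF d(3), of a] by simp
      then have "a + d \<in> S"
        using aI(3) not d op_le_trans[OF _ unit_intervalD(3)[OF b]] op_le_cancel(5)[OF unit_intervalD(2)[OF aI(1)] d(2)]
        by (simp add: S_def unit_interval_def add aA f_add blinfun.add_left cinner_add_left)
      then have "a + d = a" by (rule max) (rule op_le_add_right[OF d(2)])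
      then have "d = 0" by simp
      with not show False by (simp add: linear_on_zero[OF linear] cinner.zero_left)
    qed
  qed
qed

text \<open>By \<open>predual_iff_dominated\<close>, this says that \<open>f (\<cdot> a)\<close> is normal.\<close>

definition compressible :: "('h \<Rightarrow>\<^sub>L 'h) \<Rightarrow> bool" where
  "compressible a \<longleftrightarrow> (\<exists>\<zeta>. dominated A (\<lambda>x. f (x o\<^sub>L a)) \<zeta>)"

lemma compressible_add:
  assumes "a \<in> A" "b \<in> A" "compressible a" "compressible b"
  shows "compressible (a + b)"
proof -
  obtain \<zeta> \<zeta>' where z: "dominated A (\<lambda>x. f (x o\<^sub>L a)) \<zeta>" "dominated A (\<lambda>x. f (x o\<^sub>L b)) \<zeta>'"
    using assms(3,4) by (auto simp: compressible_def)
  obtain z where p: "\<And>a. norm (blinfun_apply (amp a) \<zeta>) \<le> norm (blinfun_apply (amp a) z)"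
    "\<And>a. norm (blinfun_apply (amp a) \<zeta>') \<le> norm (blinfun_apply (amp a) z)"
    by (rule l2_pack_two[of \<zeta> \<zeta>']) blast
  have "dominated A (\<lambda>x. f (x o\<^sub>L (a + b))) (2 *\<^sub>R z)"
    unfolding dominated_def
  proof
    fix x assume x: "x \<in> A"
    have "cmod (f (x o\<^sub>L (a + b))) \<le> cmod (f (x o\<^sub>L a)) + cmod (f (x o\<^sub>L b))"
      using assms(1,2) x by (simp add: blinfun_compose_simps(2) f_add compose norm_triangle_ineq)
    also have "\<dots> \<le> norm (blinfun_apply (amp x) z) + norm (blinfun_apply (amp x) z)"
      by (intro add_mono order_trans[OF _ p(1)] order_trans[OF _ p(2)]) (use z x in \<open>auto simp: dominated_def\<close>)
    finally show "cmod (f (x o\<^sub>L (a + b))) \<le> norm (blinfun_apply (amp x) (2 *\<^sub>R z))"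
      by (simp add: blinfun.scaleR_right)
  qed
  then show ?thesis by (auto simp: compressible_def)
qed

lemma compressible_scaleC:
  assumes "a \<in> A" "compressible a"
  shows "compressible (c *\<^sub>C a)"
proof -
  obtain \<zeta> where z: "dominated A (\<lambda>x. f (x o\<^sub>L a)) \<zeta>"
    using assms(2) by (auto simp: compressible_def)
  have "dominated A (\<lambda>x. f (x o\<^sub>L (c *\<^sub>C a))) (cmod c *\<^sub>R \<zeta>)"
    unfolding dominated_def
  proof
    fix x assume x: "x \<in> A"
    then have "cmod c * cmod (f (x o\<^sub>L a)) \<le> cmod c * norm (blinfun_apply (amp x) \<zeta>)"
      using z by (intro mult_left_mono) (auto simp: dominated_def)
    then show "cmod (f (x o\<^sub>L (c *\<^sub>C a))) \<le> norm (blinfun_apply (amp x) (cmod c *\<^sub>R \<zeta>))"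
      using x assms(1) by (simp add: blinfun_compose_scaleC_right bounded f_scaleC compose norm_mult blinfun.scaleR_right)
  qed
  then show ?thesis by (auto simp: compressible_def)
qed

lemma compressible_diff:
  assumes "a \<in> A" "b \<in> A" "compressible a" "compressible b"
  shows "compressible (a - b)"
proof -
  have "compressible (a + (-1) *\<^sub>C b)"
    by (intro compressible_add compressible_scaleC scaleC assms)
  then show ?thesis by (simp add: scaleC_minus1)
qed

text \<open>Here the first maximality argument is turned into a Cauchy--Schwarz estimate:
  \<open>|f (x c)|\<^sup>2 \<le> f 1 f (c x\<^sup>* x c) \<le> f 1 |x c \<xi>|\<^sup>2\<close>, because \<open>c x\<^sup>* x c\<close> is below a multiple of \<open>c\<close>.\<close>

lemma compressible_below:
  assumes b: "b \<in> unit_interval" "b \<noteq> 0"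
  obtains c where "c \<in> unit_interval" "c \<preceq> b" "c \<noteq> 0" "compressible c"
proof -
  obtain v where "cinner (blinfun_apply b v) v \<noteq> 0"
    using bounded_ops_eq_zeroI[OF unit_intervalD(4)[OF b(1)]] b(2) by blast
  moreover have "positive_op b" using unit_intervalD(2)[OF b(1)] by (simp add: op_le_def)
  ultimately have v: "0 < Re (cinner (blinfun_apply b v) v)"
    by (auto simp: positive_op_iff complex_eq_iff less_le)
  have "0 \<le> Re (f b)" by (intro f_positive unit_intervalD b)
  \<comment> \<open>Scaling \<open>v\<close> by \<open>sqrt r\<close> brings the quadratic form of
    \<open>b\<close> to \<open>Re (f b) + 1\<close>.\<close>
  define r where "r = (Re (f b) + 1) / Re (cinner (blinfun_apply b v) v)"
  have "Re (f b) < Re (cinner (blinfun_apply b (sqrt r *\<^sub>R v)) (sqrt r *\<^sub>R v))"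
    using v \<open>0 \<le> Re (f b)\<close>
    by (simp add: blinfun.scaleR_right cinner_scaleR_left cinner_scaleR_right r_def flip: mult.assoc)
  then obtain c \<xi> where c: "c \<in> unit_interval" "c \<preceq> b" "c \<noteq> 0"
    and le: "\<And>d. d \<in> A \<Longrightarrow> 0 \<preceq> d \<Longrightarrow> d \<preceq> c \<Longrightarrow> Re (f d) \<le> Re (cinner (blinfun_apply d \<xi>) \<xi>)"
    using vector_majorant_below[OF b(1)] by metis
  note cA = unit_intervalD(1)[OF c(1)]
  define k where "k = Re (f id_blinfun)"
  have k: "0 \<le> k" unfolding k_def by (rule f_positive[OF ident]) (simp add: op_le_def)
  \<comment> \<open>One coordinate of \<open>l2\<close> is enough: the bound is a multiple of the
    norm of \<open>x\<close> applied to \<open>c \<xi>\<close>, and \<open>sqrt k\<close> is the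
    constant of Cauchy-Schwarz against the identity.\<close>
  have "dominated A (\<lambda>x. f (x o\<^sub>L c)) (l2_single 0 (sqrt k *\<^sub>R blinfun_apply c \<xi>))"
    unfolding dominated_def
  proof
    fix x assume x: "x \<in> A"
    define y where "y = adj (x o\<^sub>L c) o\<^sub>L (x o\<^sub>L c)"
    have y: "y \<in> A" "0 \<preceq> y" unfolding y_def
      by (intro closed x cA) (simp add: op_le_def positive_op_adj_compose bounded_ops_compose bounded x cA)
    \<comment> \<open>Positive even for \<open>x = 0\<close>; division by \<open>K\<close> brings
      \<open>y\<close> below \<open>c\<close>, where \<open>le\<close> applies.\<close>
    define K where "K = (norm x)\<^sup>2 + 1"
    have K: "0 < K" by (simp add: K_def add_nonneg_pos)
    have "positive_op ((1/K) *\<^sub>R (K *\<^sub>R c - y))"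
      using sandwich_le[OF c(1) x, of K] K unfolding y_def[symmetric]
      by (intro positive_op_scaleR) (auto simp: op_le_def K_def)
    then have "(1/K) *\<^sub>R y \<preceq> c" using K by (simp add: op_le_def scaleR_diff_right)
    moreover have "0 \<preceq> (1/K) *\<^sub>R y" using y(2) K by (simp add: op_le_def positive_op_scaleR)
    ultimately have "Re (f ((1/K) *\<^sub>R y)) \<le> Re (cinner (blinfun_apply ((1/K) *\<^sub>R y) \<xi>) \<xi>)"
      by (intro le closed y)
    then have "Re (f y) / K \<le> Re (cinner (blinfun_apply y \<xi>) \<xi>) / K"
      by (simp add: scaleR_scaleC f_scaleC y blinfun_apply_scaleC cinner_scaleC_left)
    then have "Re (f y) \<le> Re (cinner (blinfun_apply y \<xi>) \<xi>)"
      using K by (simp add: divide_le_cancel)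
    also have "\<dots> = (norm (blinfun_apply (x o\<^sub>L c) \<xi>))\<^sup>2"
      by (simp add: y_def cinner_adj_left bounded_ops_compose bounded x cA cinner_self)
    finally have "k * Re (f y) \<le> k * (norm (blinfun_apply (x o\<^sub>L c) \<xi>))\<^sup>2" using k by (rule mult_left_mono)
    moreover have "(cmod (f (x o\<^sub>L c)))\<^sup>2 \<le> k * Re (f y)"
      unfolding k_def y_def by (rule cmod_f_square_le) (intro closed x cA)
    ultimately have "(cmod (f (x o\<^sub>L c)))\<^sup>2 \<le> (sqrt k * norm (blinfun_apply (x o\<^sub>L c) \<xi>))\<^sup>2"
      using k by (simp add: power_mult_distrib)
    then have "cmod (f (x o\<^sub>L c)) \<le> sqrt k * norm (blinfun_apply (x o\<^sub>L c) \<xi>)"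
      by (rule power2_le_imp_le) (use k in simp)
    then show "cmod (f (x o\<^sub>L c)) \<le> norm (blinfun_apply (amp x) (l2_single 0 (sqrt k *\<^sub>R blinfun_apply c \<xi>)))"
      using k by (simp add: amp_single norm_single blinfun.scaleR_right)
  qed
  then show ?thesis using that c by (auto simp: compressible_def)
qed

end

context normal_positive
begin

text \<open>A sequence \<open>c\<^sub>n\<close> of the chain with \<open>f (s - c\<^sub>n) < 16\<^sup>-\<^sup>n\<close> suffices: the increments \<open>d\<^sub>n\<close> are compressible,
  so \<open>f (d\<^sub>n \<cdot> d\<^sub>n)\<close> is a vector functional by Radon--Nikodym, with a vector of norm at most \<open>4\<^sup>-\<^sup>n\<close>.\<close>

lemma compressible_lub:
  assumes C: "op_chain C" "C \<subseteq> unit_interval" "\<And>c. c \<in> C \<Longrightarrow> compressible c"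
    and s: "is_lub C s" "s \<in> unit_interval"
  shows "compressible s"
proof -
  \<comment> \<open>\<open>1/16\<close> is the square of the rate \<open>1/4\<close> demanded by
    \<open>l2_pack\<close>, because the squared norms of the vectors below are values of
    \<open>f\<close>.\<close>
  have "\<exists>c\<in>C. Re (f s) - (1/16) ^ n < Re (f c)" for n
    by (rule normal[OF C(1,2) s]) simp
  then obtain c where c: "\<And>n. c n \<in> C" "\<And>n. Re (f s) - (1/16) ^ n < Re (f (c n))" by metis
  have cU: "c n \<in> unit_interval" for n using c(1) C(2) by blast
  note cA = unit_intervalD(1)[OF cU] and sA = unit_intervalD(1)[OF s(2)]
  have cs: "c n \<preceq> s" for n using s(1) c(1) by (simp add: is_lub_def)
  define e where "e n = s - c n" for n
  have eU: "e n \<in> unit_interval" for n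
    using op_le_cancel(2)[OF cs] op_le_trans[OF op_le_cancel(4)[OF unit_intervalD(2)[OF cU]] unit_intervalD(3)[OF s(2)]]
    by (simp add: e_def unit_interval_def diff sA cA)
  have e0: "0 \<le> Re (f (e n))" for n by (intro f_positive unit_intervalD eU)
  have e1: "Re (f (e n)) < (1/16) ^ n" for n
    using c(2)[of n] by (simp add: e_def f_diff sA cA)
  define d where "d n = c (Suc n) - c n" for n
  have dA: "d n \<in> A" for n by (simp add: d_def diff cA)
  have d_adj: "adj (d n) = d n" for n
    using unit_intervalD(2)[OF cU] by (simp add: d_def adj_diff bounded cA positive_op_adj op_le_def)
  have square: "Re (f (p o\<^sub>L p)) \<le> Re (f p)" if "p \<in> unit_interval" for p
    by (intro f_mono op_square_le compose unit_intervalD that)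
  have fd: "Re (f (d n)) = Re (f (e n)) - Re (f (e (Suc n)))" for n
    by (simp add: d_def e_def f_diff cA sA)
  have diff_unit: "c m - c n \<in> unit_interval" if "c n \<preceq> c m" for m n
    using op_le_cancel(2)[OF that] op_le_trans[OF op_le_cancel(4)[OF unit_intervalD(2)[OF cU]] unit_intervalD(3)[OF cU]]
    by (simp add: unit_interval_def diff cA)
  \<comment> \<open>The chosen elements need not increase with \<open>n\<close>. In either case
    \<open>d n\<close> or its negative is a positive contraction, and the two have the same
    square.\<close>
  have d2: "Re (f (d n o\<^sub>L d n)) \<le> (1/16) ^ n" for n
  proof (cases "c n \<preceq> c (Suc n)")
    case True
    then have "Re (f (d n o\<^sub>L d n)) \<le> Re (f (d n))"
      using square[OF diff_unit] by (simp add: d_def)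
    then show ?thesis using fd[of n] e0[of "Suc n"] e1[of n] by linarith
  next
    case False
    then have "c (Suc n) \<preceq> c n" using C(1) c(1) by (auto simp: op_chain_def)
    from square[OF diff_unit[OF this]]
    have "Re (f ((c n - c (Suc n)) o\<^sub>L (c n - c (Suc n)))) \<le> Re (f (e (Suc n))) - Re (f (e n))"
      by (simp add: e_def f_diff cA sA)
    moreover have eq: "(c n - c (Suc n)) o\<^sub>L (c n - c (Suc n)) = d n o\<^sub>L d n"
      unfolding d_def blinfun_compose_simps(3,4) by (simp add: algebra_simps)
    ultimately have "Re (f (d n o\<^sub>L d n)) \<le> Re (f (e (Suc n))) - Re (f (e n))" by (simp only: eq)
    moreover have "(1/16 :: real) ^ Suc n \<le> (1/16) ^ n" by simp
    ultimately show ?thesis using e0[of n] e1[of "Suc n"] by linarith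
  qed
  have dC: "compressible (d n)" for n
    unfolding d_def by (intro compressible_diff cA C(3) c(1))
  define k where "k = Re (f id_blinfun)"
  have k: "0 \<le> k" unfolding k_def by (rule f_positive[OF ident]) (simp add: op_le_def)
  have "\<exists>\<zeta>. norm \<zeta> \<le> 1 * (1/4) ^ n \<and>
      (\<forall>x\<in>A. cmod (f (x o\<^sub>L d n)) \<le> sqrt k * norm (blinfun_apply (amp x) \<zeta>))" for n
  proof -
    \<comment> \<open>Cauchy-Schwarz against the identity bounds the squared modulus of
      \<open>f (x o\<^sub>L d n)\<close> by \<open>k\<close> times
      \<open>g (adj x o\<^sub>L x)\<close>, so a vector for \<open>g\<close> serves for
      \<open>d n\<close>. Its squared norm is the value of \<open>g\<close> at the identity, the
      small number \<open>f (d n o\<^sub>L d n)\<close>.\<close>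
    define g where "g x = f (d n o\<^sub>L (x o\<^sub>L d n))" for x
    have gsq: "g (adj x o\<^sub>L x) = f (adj (x o\<^sub>L d n) o\<^sub>L (x o\<^sub>L d n))" if "x \<in> A" for x
      using that by (simp add: g_def adj_compose bounded dA d_adj blinfun_compose_assoc)
    interpret g: positive_linear A g
    proof
      show "linear_on A g"
        unfolding linear_on_def g_def
        by (simp add: blinfun_compose_simps(1,2) f_add closed dA blinfun_compose_scaleC_left
            blinfun_compose_scaleC_right bounded f_scaleC)
      show "g (adj x o\<^sub>L x) \<in> \<real>\<^sub>\<ge>\<^sub>0" if "x \<in> A" for x
        unfolding gsq[OF that] by (intro nonneg closed that dA)
    qed
    obtain \<zeta>' where \<zeta>': "dominated A (\<lambda>x. f (x o\<^sub>L d n)) \<zeta>'"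
      using dC by (auto simp: compressible_def)
    have "dominated A g (norm (amp (d n)) *\<^sub>R \<zeta>')"
      unfolding dominated_def
    proof
      fix x assume x: "x \<in> A"
      have "cmod (g x) \<le> norm (blinfun_apply (amp (d n o\<^sub>L x)) \<zeta>')"
        using \<zeta>' compose[OF dA x] by (auto simp: dominated_def g_def simp flip: blinfun_compose_assoc)
      also have "\<dots> \<le> norm (amp (d n)) * norm (blinfun_apply (amp x) \<zeta>')"
        by (simp add: amp_simps norm_blinfun)
      finally show "cmod (g x) \<le> norm (blinfun_apply (amp x) (norm (amp (d n)) *\<^sub>R \<zeta>'))"
        by (simp add: blinfun.scaleR_right)
    qed
    then obtain \<zeta> where \<zeta>: "\<And>x. x \<in> A \<Longrightarrow> g (adj x o\<^sub>L x) = complex_of_real ((norm (blinfun_apply (amp x) \<zeta>))\<^sup>2)"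
      by (rule g.vector_representation) blast
    have "(norm \<zeta>)\<^sup>2 \<le> ((1/4) ^ n)\<^sup>2"
    proof -
      have "complex_of_real ((norm \<zeta>)\<^sup>2) = f (d n o\<^sub>L d n)"
        using \<zeta>[OF ident] by (simp add: g_def adj_id amp_simps blinfun_compose_simps)
      then have "(norm \<zeta>)\<^sup>2 = Re (f (d n o\<^sub>L d n))" by (metis Re_complex_of_real)
      also have "\<dots> \<le> ((1/4) ^ n)\<^sup>2"
        using d2[of n] by (simp add: power2_eq_square flip: power_mult_distrib)
      finally show ?thesis .
    qed
    from power2_le_imp_le[OF this] have "norm \<zeta> \<le> 1 * (1/4) ^ n" by simp
    moreover have "cmod (f (x o\<^sub>L d n)) \<le> sqrt k * norm (blinfun_apply (amp x) \<zeta>)" if x: "x \<in> A" for x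
    proof (rule power2_le_imp_le)
      have "(cmod (f (x o\<^sub>L d n)))\<^sup>2 \<le> k * Re (g (adj x o\<^sub>L x))"
        unfolding gsq[OF x] k_def by (intro cmod_f_square_le closed x dA)
      also have "\<dots> = (sqrt k * norm (blinfun_apply (amp x) \<zeta>))\<^sup>2"
        using k by (simp only: \<zeta>[OF x] Re_complex_of_real power_mult_distrib real_sqrt_pow2)
      finally show "(cmod (f (x o\<^sub>L d n)))\<^sup>2 \<le> (sqrt k * norm (blinfun_apply (amp x) \<zeta>))\<^sup>2" .
    qed (use k in simp)
    ultimately show ?thesis by blast
  qed
  then obtain \<zeta> where \<zeta>: "\<And>n. norm (\<zeta> n) \<le> 1 * (1/4) ^ n"
    "\<And>n x. x \<in> A \<Longrightarrow> cmod (f (x o\<^sub>L d n)) \<le> sqrt k * norm (blinfun_apply (amp x) (\<zeta> n))"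
    by metis
  obtain z where z: "\<And>n a. norm (blinfun_apply (amp a) (\<zeta> n)) \<le> (1/2) ^ n * norm (blinfun_apply (amp a) z)"
    by (rule l2_pack[OF \<zeta>(1)]) blast
  obtain z0 where z0: "dominated A (\<lambda>x. f (x o\<^sub>L c 0)) z0"
    using C(3)[OF c(1)] by (auto simp: compressible_def)
  \<comment> \<open>\<open>2 - 2 * (1/2) ^ n\<close> is the sum of the weights
    \<open>(1/2) ^ i\<close> for \<open>i < n\<close>, so the bound stays uniform in
    \<open>n\<close>.\<close>
  have step: "cmod (f (x o\<^sub>L c n)) \<le> norm (blinfun_apply (amp x) z0) +
      sqrt k * norm (blinfun_apply (amp x) z) * (2 - 2 * (1/2) ^ n)" if x: "x \<in> A" for x n
  proof (induction n)
    case 0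
    show ?case using z0 x by (auto simp: dominated_def)
  next
    case (Suc n)
    have "x o\<^sub>L c (Suc n) = (x o\<^sub>L c n) + (x o\<^sub>L d n)"
      by (simp add: d_def blinfun_compose_simps)
    then have "f (x o\<^sub>L c (Suc n)) = f (x o\<^sub>L c n) + f (x o\<^sub>L d n)"
      by (simp add: f_add closed x cA dA)
    then have "cmod (f (x o\<^sub>L c (Suc n))) \<le> cmod (f (x o\<^sub>L c n)) + cmod (f (x o\<^sub>L d n))"
      by (simp add: norm_triangle_ineq)
    moreover have "cmod (f (x o\<^sub>L d n)) \<le> sqrt k * norm (blinfun_apply (amp x) z) * (1/2) ^ n"
    proof -
      have "cmod (f (x o\<^sub>L d n)) \<le> sqrt k * norm (blinfun_apply (amp x) (\<zeta> n))" by (rule \<zeta>(2)[OF x])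
      also have "\<dots> \<le> sqrt k * ((1/2) ^ n * norm (blinfun_apply (amp x) z))"
        by (rule mult_left_mono[OF z]) (use k in simp)
      finally show ?thesis by (simp only: mult.assoc mult.commute mult.left_commute)
    qed
    moreover have "r * (2 - 2 * (1/2) ^ n) + r * (1/2) ^ n = r * (2 - 2 * (1/2) ^ Suc n)" for r :: real
      by (simp add: algebra_simps)
    ultimately show ?case using Suc.IH by (smt (verit, best))
  qed
  obtain w where w: "\<And>a. norm (blinfun_apply (amp a) z0) \<le> norm (blinfun_apply (amp a) w)"
    "\<And>a. norm (blinfun_apply (amp a) z) \<le> norm (blinfun_apply (amp a) w)"
    by (rule l2_pack_two[of z0 z]) blast
  have "dominated A (\<lambda>x. f (x o\<^sub>L s)) ((1 + sqrt k * 2) *\<^sub>R w)"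
    unfolding dominated_def
  proof
    fix x assume x: "x \<in> A"
    let ?N = "norm (blinfun_apply (amp x) w)"
    have le: "cmod (f (x o\<^sub>L c n)) \<le> (1 + sqrt k * 2) * ?N" for n
    proof -
      have "cmod (f (x o\<^sub>L c n)) \<le> norm (blinfun_apply (amp x) z0) +
          sqrt k * norm (blinfun_apply (amp x) z) * (2 - 2 * (1/2) ^ n)" by (rule step[OF x])
      also have "\<dots> \<le> ?N + sqrt k * ?N * 2"
        using k by (intro add_mono mult_mono w mult_nonneg_nonneg) (auto simp: power_le_one)
      finally show ?thesis by (simp add: algebra_simps)
    qed
    \<comment> \<open>This bound involves the operator norm of \<open>x\<close> and cannot serve for
      domination, but for fixed \<open>x\<close> it vanishes as \<open>n\<close> grows.\<close>
    have err: "cmod (f (x o\<^sub>L e n)) \<le> sqrt k * norm x * (1/4) ^ n" for n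
    proof (rule power2_le_imp_le)
      have "(cmod (f (x o\<^sub>L e n)))\<^sup>2 \<le> k * ((norm x)\<^sup>2 * Re (f (e n)))"
        unfolding k_def by (rule f_sandwich[OF eU x])
      also have "\<dots> \<le> k * ((norm x)\<^sup>2 * (1/16) ^ n)"
        using k e1[of n] by (intro mult_left_mono) auto
      also have "(1/16 :: real) ^ n = ((1/4) ^ n)\<^sup>2"
        by (simp add: power2_eq_square flip: power_mult_distrib)
      also have "k * ((norm x)\<^sup>2 * ((1/4) ^ n)\<^sup>2) = (sqrt k * norm x * (1/4) ^ n)\<^sup>2"
        using k by (simp only: power_mult_distrib real_sqrt_pow2 mult.assoc)
      finally show "(cmod (f (x o\<^sub>L e n)))\<^sup>2 \<le> (sqrt k * norm x * (1/4) ^ n)\<^sup>2" .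
    qed (use k in simp)
    have "cmod (f (x o\<^sub>L s)) \<le> (1 + sqrt k * 2) * ?N + sqrt k * norm x * (1/4) ^ n" for n
    proof -
      have "x o\<^sub>L s = (x o\<^sub>L c n) + (x o\<^sub>L e n)" by (simp add: e_def blinfun_compose_simps)
      then have "f (x o\<^sub>L s) = f (x o\<^sub>L c n) + f (x o\<^sub>L e n)"
        by (simp add: f_add closed x cA unit_intervalD(1)[OF eU])
      then show ?thesis using norm_triangle_mono[OF le[of n] err[of n]] by simp
    qed
    moreover have "(\<lambda>n. (1 + sqrt k * 2) * ?N + sqrt k * norm x * (1/4) ^ n) \<longlonglongrightarrow> (1 + sqrt k * 2) * ?N + sqrt k * norm x * 0"
      by (intro tendsto_intros LIMSEQ_power_zero) simp
    ultimately have "cmod (f (x o\<^sub>L s)) \<le> (1 + sqrt k * 2) * ?N + sqrt k * norm x * 0"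
      by (intro LIMSEQ_le_const) auto
    then show "cmod (f (x o\<^sub>L s)) \<le> norm (blinfun_apply (amp x) ((1 + sqrt k * 2) *\<^sub>R w))"
      using k by (simp add: blinfun.scaleR_right)
  qed
  then show ?thesis by (auto simp: compressible_def)
qed

theorem in_predual: "f \<in> predual A"
proof -
  define S where "S = {a \<in> unit_interval. compressible a}"
  have pos1: "0 \<preceq> id_blinfun" by (simp add: op_le_def)
  have "0 \<in> S"
  proof -
    have "dominated A (\<lambda>x. f (x o\<^sub>L 0)) 0"
      by (simp add: dominated_def linear_on_zero[OF linear])
    then show ?thesis using pos1 by (auto simp: S_def unit_interval_def zero compressible_def)
  qed
  have "\<exists>u\<in>S. \<forall>c\<in>C. c \<preceq> u" if C: "C \<subseteq> S" "C \<noteq> {}" "\<And>a b. a \<in> C \<Longrightarrow> b \<in> C \<Longrightarrow> a \<preceq> b \<or> b \<preceq> a" for C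
  proof -
    have ch: "op_chain C" using C(2,3) by (simp add: op_chain_def)
    have CU: "C \<subseteq> unit_interval" using C(1) by (auto simp: S_def)
    obtain s where s: "s \<in> unit_interval" "\<And>c. c \<in> C \<Longrightarrow> c \<preceq> s" "\<And>u. (\<And>c. c \<in> C \<Longrightarrow> c \<preceq> u) \<Longrightarrow> s \<preceq> u"
      by (rule chain_lub[OF ch CU]) blast
    have lub: "is_lub C s" using s unit_intervalD(1)[OF s(1)] by (simp add: is_lub_def)
    have "compressible s" by (rule compressible_lub[OF ch CU _ lub s(1)]) (use C(1) in \<open>auto simp: S_def\<close>)
    then show ?thesis using s(1,2) by (auto simp: S_def)
  qed
  then obtain a where a: "a \<in> S" and max: "\<And>a'. a' \<in> S \<Longrightarrow> a \<preceq> a' \<Longrightarrow> a' = a"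
    by (rule op_Zorn[of S, rotated 2]) (use \<open>0 \<in> S\<close> in \<open>auto simp: S_def unit_intervalD(4)\<close>)
  have aU: "a \<in> unit_interval" and aC: "compressible a" using a by (auto simp: S_def)
  have "a = id_blinfun"
  proof (rule ccontr)
    assume ne: "a \<noteq> id_blinfun"
    have bU: "id_blinfun - a \<in> unit_interval"
      using op_le_cancel(2)[OF unit_intervalD(3)[OF aU]] op_le_cancel(4)[OF unit_intervalD(2)[OF aU]]
      by (simp add: unit_interval_def diff ident unit_intervalD(1)[OF aU])
    obtain c where c: "c \<in> unit_interval" "c \<preceq> id_blinfun - a" "c \<noteq> 0" "compressible c"
      by (rule compressible_below[OF bU]) (use ne in auto)
    have "a + c \<preceq> id_blinfun" using op_le_cancel(1)[OF c(2), of a] by simp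
    then have "a + c \<in> S"
      using op_le_cancel(5)[OF unit_intervalD(2)[OF aU] unit_intervalD(2)[OF c(1)]]
      by (simp add: S_def unit_interval_def add unit_intervalD(1)[OF aU] unit_intervalD(1)[OF c(1)]
          compressible_add aC c(4))
    then have "a + c = a" by (rule max) (rule op_le_add_right[OF unit_intervalD(2)[OF c(1)]])
    with c(3) show False by simp
  qed
  then show ?thesis
    using aC linear by (simp add: predual_iff_dominated compressible_def blinfun_compose_simps)
qed

end

section \<open>Tensor products of operators\<close>

lemma sum_lessThan_add: "(\<Sum>i<n + m. f i) = (\<Sum>i<n. f i) + (\<Sum>i<m. f (n + i))"
  for f :: "nat \<Rightarrow> 'a::comm_monoid_add"
  by (induction m) (auto simp: add.assoc)

locale hilbert_tensor_product =
  fixes t :: "'h::chilbert_space \<Rightarrow> 'k::chilbert_space \<Rightarrow> 'l::chilbert_space"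
  assumes hilbert_tensor: "hilbert_tensor t"
begin

lemma t_add_left: "t (\<xi> + \<xi>') \<eta> = t \<xi> \<eta> + t \<xi>' \<eta>"
  and t_add_right: "t \<xi> (\<eta> + \<eta>') = t \<xi> \<eta> + t \<xi> \<eta>'"
  and t_scaleC_left: "t (c *\<^sub>C \<xi>) \<eta> = c *\<^sub>C t \<xi> \<eta>"
  and t_scaleC_right: "t \<xi> (c *\<^sub>C \<eta>) = c *\<^sub>C t \<xi> \<eta>"
  and t_inner: "cinner (t \<xi> \<eta>) (t \<xi>' \<eta>') = cinner \<xi> \<xi>' * cinner \<eta> \<eta>'"
  and t_dense: "closure (span {t \<xi> \<eta> | \<xi> \<eta>. True}) = UNIV"
  using hilbert_tensor unfolding hilbert_tensor_def by blast+

text \<open>With the factors exchanged, the norm estimate for operators on the left factor also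
  covers the right one.\<close>

lemma t_swap: "hilbert_tensor_product (\<lambda>\<eta> \<xi>. t \<xi> \<eta>)"
proof
  have "{t \<eta> \<xi> | \<xi> \<eta>. True} = {t \<xi> \<eta> | \<xi> \<eta>. True}" by blast
  then show "hilbert_tensor (\<lambda>\<eta> \<xi>. t \<xi> \<eta>)"
    using t_dense unfolding hilbert_tensor_def
    by (simp add: t_add_left t_add_right t_scaleC_left t_scaleC_right t_inner)
qed

lemma norm_t: "norm (t \<xi> \<eta>) = norm \<xi> * norm \<eta>"
proof -
  have "complex_of_real ((norm (t \<xi> \<eta>))\<^sup>2) = complex_of_real ((norm \<xi> * norm \<eta>)\<^sup>2)"
    by (simp only: cinner_self[symmetric] t_inner) (simp only: cinner_self of_real_mult[symmetric] power_mult_distrib)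
  then have "(norm (t \<xi> \<eta>))\<^sup>2 = (norm \<xi> * norm \<eta>)\<^sup>2" by (simp only: of_real_eq_iff)
  then show ?thesis by (rule power2_eq_imp_eq) simp_all
qed

lemma bounded_linear_t_right: "bounded_linear (t \<xi>)"
  by (rule bounded_linear_intro[where K = "norm \<xi>"])
    (simp_all add: t_add_right scaleR_scaleC t_scaleC_right norm_t mult.commute)

lemma closed_subspace_UNIV:
  assumes V: "subspace V" "closed V" "\<And>\<xi> \<eta>. t \<xi> \<eta> \<in> V"
  shows "v \<in> V"
proof -
  have "span {t \<xi> \<eta> | \<xi> \<eta>. True} \<subseteq> V" by (rule span_minimal) (use V in auto)
  then have "closure (span {t \<xi> \<eta> | \<xi> \<eta>. True}) \<subseteq> V" by (rule closure_minimal) (rule V(2))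
  then show ?thesis unfolding t_dense by blast
qed

lemma tensor_op_eqI:
  assumes "\<And>\<xi> \<eta>. blinfun_apply z (t \<xi> \<eta>) = blinfun_apply z' (t \<xi> \<eta>)"
  shows "z = z'"
proof (rule blinfun_eqI)
  fix v
  have "v \<in> {v. blinfun_apply z v = blinfun_apply z' v}"
  proof (rule closed_subspace_UNIV)
    show "subspace {v. blinfun_apply z v = blinfun_apply z' v}"
      by (auto simp: subspace_def blinfun.bilinear_simps)
    show "closed {v. blinfun_apply z v = blinfun_apply z' v}"
      by (intro closed_Collect_eq linear_continuous_on blinfun.bounded_linear_right)
  qed (use assms in simp)
  then show "blinfun_apply z v = blinfun_apply z' v" by simp
qed

text \<open>The defect \<open>|x|\<^sup>2 |\<Sum> \<xi>\<^sub>i \<otimes> \<eta>\<^sub>i|\<^sup>2 - |\<Sum> x \<xi>\<^sub>i \<otimes> \<eta>\<^sub>i|\<^sup>2\<close> is \<open>|\<Sum> r \<xi>\<^sub>i \<otimes> \<eta>\<^sub>i|\<^sup>2\<close> with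
  \<open>r = (|x|\<^sup>2 - x\<^sup>* x)\<^sup>1\<^sup>/\<^sup>2\<close>.\<close>

lemma norm_tensor_sum_left:
  assumes x: "x \<in> bounded_ops"
  shows "norm (\<Sum>i\<in>I. t (blinfun_apply x (\<xi> i)) (\<eta> i)) \<le> norm x * norm (\<Sum>i\<in>I. t (\<xi> i) (\<eta> i))"
proof -
  define X where "X = (norm x)\<^sup>2 *\<^sub>R id_blinfun - (adj x o\<^sub>L x)"
  have X: "X \<in> bounded_ops" unfolding X_def by (intro bounded_ops_intros x)
  have "(norm (blinfun_apply x v))\<^sup>2 \<le> (norm x)\<^sup>2 * (norm v)\<^sup>2" for v
    unfolding power_mult_distrib[symmetric] by (intro power_mono norm_blinfun) simp
  then have "positive_op X"
    using x by (simp add: X_def positive_op_iff blinfun.diff_left blinfun.scaleR_left cinner.diff_left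
        cinner_scaleR_left cinner_adj_left cinner_self)
  then obtain r where r: "r \<in> bounded_ops" "positive_op r" "r o\<^sub>L r = X"
    using op_sqrt[OF X] by metis
  \<comment> \<open>The squared norm is linear in \<open>adj y o\<^sub>L y\<close>, which is why the
    defect is again a squared norm.\<close>
  have norm_sq: "cinner (\<Sum>i\<in>I. t (blinfun_apply y (\<xi> i)) (\<eta> i)) (\<Sum>i\<in>I. t (blinfun_apply y (\<xi> i)) (\<eta> i)) =
      (\<Sum>i\<in>I. \<Sum>j\<in>I. cinner (blinfun_apply (adj y o\<^sub>L y) (\<xi> j)) (\<xi> i) * cinner (\<eta> j) (\<eta> i))"
    if "y \<in> bounded_ops" for y
    using that by (simp add: cinner.sum_left cinner.sum_right t_inner cinner_adj_left)
  have "adj r o\<^sub>L r = X" using r positive_op_adj by metis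
  then have "cinner (\<Sum>i\<in>I. t (blinfun_apply r (\<xi> i)) (\<eta> i)) (\<Sum>i\<in>I. t (blinfun_apply r (\<xi> i)) (\<eta> i)) =
      (norm x)\<^sup>2 *\<^sub>R cinner (\<Sum>i\<in>I. t (\<xi> i) (\<eta> i)) (\<Sum>i\<in>I. t (\<xi> i) (\<eta> i)) -
      cinner (\<Sum>i\<in>I. t (blinfun_apply x (\<xi> i)) (\<eta> i)) (\<Sum>i\<in>I. t (blinfun_apply x (\<xi> i)) (\<eta> i))"
    using norm_sq[OF bounded_ops_id]
    by (simp add: norm_sq r(1) x adj_id X_def blinfun.diff_left blinfun.scaleR_left cinner.diff_left
        cinner_scaleR_left left_diff_distrib sum_subtractf scaleR_sum_right)
  then have "Re (cinner (\<Sum>i\<in>I. t (blinfun_apply r (\<xi> i)) (\<eta> i)) (\<Sum>i\<in>I. t (blinfun_apply r (\<xi> i)) (\<eta> i))) =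
      (norm x)\<^sup>2 * (norm (\<Sum>i\<in>I. t (\<xi> i) (\<eta> i)))\<^sup>2 - (norm (\<Sum>i\<in>I. t (blinfun_apply x (\<xi> i)) (\<eta> i)))\<^sup>2"
    by (simp add: Re_cinner_self)
  then have "(norm (\<Sum>i\<in>I. t (blinfun_apply x (\<xi> i)) (\<eta> i)))\<^sup>2 \<le> (norm x * norm (\<Sum>i\<in>I. t (\<xi> i) (\<eta> i)))\<^sup>2"
    by (simp add: Re_cinner_self power_mult_distrib)
      (metis (no_types, lifting) add_increasing2 diff_add_cancel order_refl zero_le_power2 add.commute)
  then show ?thesis by (rule power2_le_imp_le) simp
qed

lemma norm_tensor_sum:
  assumes "x \<in> bounded_ops" "y \<in> bounded_ops"
  shows "norm (\<Sum>i\<in>I. t (blinfun_apply x (\<xi> i)) (blinfun_apply y (\<eta> i))) \<le>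
    (norm x * norm y) * norm (\<Sum>i\<in>I. t (\<xi> i) (\<eta> i))"
proof -
  interpret swap: hilbert_tensor_product "\<lambda>\<eta> \<xi>. t \<xi> \<eta>" by (rule t_swap)
  have "norm (\<Sum>i\<in>I. t (blinfun_apply x (\<xi> i)) (blinfun_apply y (\<eta> i))) \<le>
      norm x * norm (\<Sum>i\<in>I. t (\<xi> i) (blinfun_apply y (\<eta> i)))"
    by (rule norm_tensor_sum_left[OF assms(1)])
  also have "\<dots> \<le> norm x * (norm y * norm (\<Sum>i\<in>I. t (\<xi> i) (\<eta> i)))"
    by (intro mult_left_mono swap.norm_tensor_sum_left assms(2)) simp
  finally show ?thesis by (simp add: mult.assoc)
qed

text \<open>The relation takes a finite sum of tensors to the sum of their images.
  \<open>norm_tensor_sum\<close> bounds it, which also makes the image independent of the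
  representation; \<open>graph_operator\<close> then returns the adjoint of the wanted operator,
  whence the final \<open>adj\<close>.\<close>

lemma op_tensor_exists:
  assumes xy: "x \<in> bounded_ops" "y \<in> bounded_ops"
  obtains z where "z \<in> bounded_ops" "norm z \<le> norm x * norm y"
    "\<And>\<xi> \<eta>. blinfun_apply z (t \<xi> \<eta>) = t (blinfun_apply x \<xi>) (blinfun_apply y \<eta>)"
proof -
  define g where "g n \<xi> \<eta> = (\<Sum>i<n. t (\<xi> i) (\<eta> i))" for n :: nat and \<xi> \<eta>
  define h where "h n \<xi> \<eta> = (\<Sum>i<n. t (blinfun_apply x (\<xi> i)) (blinfun_apply y (\<eta> i)))" for n :: nat and \<xi> \<eta>
  define G where "G = {(g n \<xi> \<eta>, h n \<xi> \<eta>) | n \<xi> \<eta>. True}"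
  have "(0, 0) \<in> G"
    unfolding G_def by (intro CollectI exI[of _ 0]) (simp add: g_def h_def)
  moreover have "(v + w, a + b) \<in> G" if va: "(v, a) \<in> G" and wb: "(w, b) \<in> G" for v a w b
  proof -
    obtain n \<xi> \<eta> where 1: "v = g n \<xi> \<eta>" "a = h n \<xi> \<eta>"
      using va unfolding G_def by blast
    obtain m \<xi>' \<eta>' where 2: "w = g m \<xi>' \<eta>'" "b = h m \<xi>' \<eta>'"
      using wb unfolding G_def by blast
    let ?\<xi> = "\<lambda>i. if i < n then \<xi> i else \<xi>' (i - n)" and ?\<eta> = "\<lambda>i. if i < n then \<eta> i else \<eta>' (i - n)"
    have "v + w = g (n + m) ?\<xi> ?\<eta>" "a + b = h (n + m) ?\<xi> ?\<eta>"
      unfolding 1 2 g_def h_def sum_lessThan_add by simp_all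
    then show ?thesis unfolding G_def by blast
  qed
  moreover have "(c *\<^sub>C v, c *\<^sub>C a) \<in> G" if va: "(v, a) \<in> G" for c v a
  proof -
    obtain n \<xi> \<eta> where *: "v = g n \<xi> \<eta>" "a = h n \<xi> \<eta>"
      using va unfolding G_def by blast
    have "c *\<^sub>C v = g n (\<lambda>i. c *\<^sub>C \<xi> i) \<eta>" "c *\<^sub>C a = h n (\<lambda>i. c *\<^sub>C \<xi> i) \<eta>"
      unfolding * g_def h_def by (simp_all add: scaleC_sum_right t_scaleC_left bounded_ops_apply_scaleC xy)
    then show ?thesis unfolding G_def by blast
  qed
  moreover have "0 \<le> norm x * norm y" by simp
  moreover have "norm a \<le> (norm x * norm y) * norm v" if "(v, a) \<in> G" for v a
    using that norm_tensor_sum[OF xy] by (auto simp: G_def g_def h_def)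
  ultimately obtain S where S: "S \<in> bounded_ops" "norm S \<le> norm x * norm y"
    "\<And>v a w. (v, a) \<in> G \<Longrightarrow> cinner a w = cinner v (blinfun_apply S w)"
    by (rule graph_operator) (assumption | rule that)+
  show ?thesis
  proof (rule that[of "adj S"])
    show "adj S \<in> bounded_ops" "norm (adj S) \<le> norm x * norm y"
      using adj_exists(1,2)[OF S(1)] S(2) by auto
    fix \<xi> \<eta>
    have "(t \<xi> \<eta>, t (blinfun_apply x \<xi>) (blinfun_apply y \<eta>)) \<in> G"
      unfolding G_def by (intro CollectI exI[of _ 1] exI[of _ "\<lambda>_. \<xi>"] exI[of _ "\<lambda>_. \<eta>"]) (simp add: g_def h_def)
    then show "blinfun_apply (adj S) (t \<xi> \<eta>) = t (blinfun_apply x \<xi>) (blinfun_apply y \<eta>)"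
      using S(3) by (intro cinner_ext) (metis cinner_adj_right cinner_commute S(1))
  qed
qed

lemma op_tensor:
  assumes xy: "x \<in> bounded_ops" "y \<in> bounded_ops"
  shows op_tensor_bounded_ops: "op_tensor t x y \<in> bounded_ops"
    and op_tensor_apply: "blinfun_apply (op_tensor t x y) (t \<xi> \<eta>) = t (blinfun_apply x \<xi>) (blinfun_apply y \<eta>)"
    and norm_op_tensor: "norm (op_tensor t x y) \<le> norm x * norm y"
proof -
  obtain z where z: "z \<in> bounded_ops" "norm z \<le> norm x * norm y"
    "\<And>\<xi> \<eta>. blinfun_apply z (t \<xi> \<eta>) = t (blinfun_apply x \<xi>) (blinfun_apply y \<eta>)"
    by (rule op_tensor_exists[OF xy]) blast
  have "op_tensor t x y = z"
    unfolding op_tensor_def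
  proof (rule the_equality)
    fix z' assume "z' \<in> bounded_ops \<and> (\<forall>\<xi> \<eta>. blinfun_apply z' (t \<xi> \<eta>) = t (blinfun_apply x \<xi>) (blinfun_apply y \<eta>))"
    then show "z' = z" by (intro tensor_op_eqI) (simp add: z(3))
  qed (simp add: z)
  with z show "op_tensor t x y \<in> bounded_ops"
    "blinfun_apply (op_tensor t x y) (t \<xi> \<eta>) = t (blinfun_apply x \<xi>) (blinfun_apply y \<eta>)"
    "norm (op_tensor t x y) \<le> norm x * norm y" by auto
qed

lemma op_tensor_add_left:
  "x \<in> bounded_ops \<Longrightarrow> x' \<in> bounded_ops \<Longrightarrow> y \<in> bounded_ops \<Longrightarrow> op_tensor t (x + x') y = op_tensor t x y + op_tensor t x' y"
  by (rule tensor_op_eqI) (simp add: op_tensor_apply bounded_ops_intros blinfun.add_left t_add_left)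

lemma op_tensor_add_right:
  "x \<in> bounded_ops \<Longrightarrow> y \<in> bounded_ops \<Longrightarrow> y' \<in> bounded_ops \<Longrightarrow> op_tensor t x (y + y') = op_tensor t x y + op_tensor t x y'"
  by (rule tensor_op_eqI) (simp add: op_tensor_apply bounded_ops_intros blinfun.add_left t_add_right)

lemma op_tensor_scaleC_left:
  "x \<in> bounded_ops \<Longrightarrow> y \<in> bounded_ops \<Longrightarrow> op_tensor t (c *\<^sub>C x) y = c *\<^sub>C op_tensor t x y"
  by (rule tensor_op_eqI) (simp add: op_tensor_apply bounded_ops_intros blinfun_apply_scaleC t_scaleC_left)

lemma op_tensor_scaleC_right:
  "x \<in> bounded_ops \<Longrightarrow> y \<in> bounded_ops \<Longrightarrow> op_tensor t x (c *\<^sub>C y) = c *\<^sub>C op_tensor t x y"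
  by (rule tensor_op_eqI) (simp add: op_tensor_apply bounded_ops_intros blinfun_apply_scaleC t_scaleC_right)

lemma op_tensor_zero:
  "y \<in> bounded_ops \<Longrightarrow> op_tensor t 0 y = 0" "x \<in> bounded_ops \<Longrightarrow> op_tensor t x 0 = 0"
  using op_tensor_scaleC_left[of 0 y 0] op_tensor_scaleC_right[of x 0 0] by (simp_all add: bounded_ops_zero)

lemma op_tensor_sum_left:
  "(\<And>i. i \<in> I \<Longrightarrow> x i \<in> bounded_ops) \<Longrightarrow> y \<in> bounded_ops \<Longrightarrow>
    op_tensor t (\<Sum>i\<in>I. x i) y = (\<Sum>i\<in>I. op_tensor t (x i) y)"
  by (induction I rule: infinite_finite_induct) (simp_all add: op_tensor_zero op_tensor_add_left bounded_ops_sum)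

lemma op_tensor_sum_right:
  "x \<in> bounded_ops \<Longrightarrow> (\<And>i. i \<in> I \<Longrightarrow> y i \<in> bounded_ops) \<Longrightarrow>
    op_tensor t x (\<Sum>i\<in>I. y i) = (\<Sum>i\<in>I. op_tensor t x (y i))"
  by (induction I rule: infinite_finite_induct) (simp_all add: op_tensor_zero op_tensor_add_right bounded_ops_sum)

lemma op_tensor_compose:
  "x \<in> bounded_ops \<Longrightarrow> x' \<in> bounded_ops \<Longrightarrow> y \<in> bounded_ops \<Longrightarrow> y' \<in> bounded_ops \<Longrightarrow>
    op_tensor t x y o\<^sub>L op_tensor t x' y' = op_tensor t (x o\<^sub>L x') (y o\<^sub>L y')"
  by (rule tensor_op_eqI) (simp add: op_tensor_apply bounded_ops_intros)

lemma op_tensor_id: "op_tensor t id_blinfun id_blinfun = id_blinfun"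
  by (rule tensor_op_eqI) (simp add: op_tensor_apply bounded_ops_intros)

lemma op_tensor_adj:
  assumes xy: "x \<in> bounded_ops" "y \<in> bounded_ops"
  shows "adj (op_tensor t x y) = op_tensor t (adj x) (adj y)"
proof (rule tensor_op_eqI, rule cinner_ext)
  fix \<xi> \<eta> v
  have "v \<in> {v. cinner v (blinfun_apply (adj (op_tensor t x y)) (t \<xi> \<eta>)) =
      cinner v (blinfun_apply (op_tensor t (adj x) (adj y)) (t \<xi> \<eta>))}"
  proof (rule closed_subspace_UNIV)
    show "subspace {v. cinner v (blinfun_apply (adj (op_tensor t x y)) (t \<xi> \<eta>)) =
        cinner v (blinfun_apply (op_tensor t (adj x) (adj y)) (t \<xi> \<eta>))}"
      by (auto simp: subspace_def cinner_add_left cinner_scaleR_left cinner.zero_left)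
    show "closed {v. cinner v (blinfun_apply (adj (op_tensor t x y)) (t \<xi> \<eta>)) =
        cinner v (blinfun_apply (op_tensor t (adj x) (adj y)) (t \<xi> \<eta>))}"
      by (intro closed_Collect_eq linear_continuous_on cinner.bounded_linear_left)
  qed (use xy in \<open>simp add: cinner_adj_right op_tensor_apply op_tensor_bounded_ops adj_exists(1) t_inner\<close>)
  then show "cinner v (blinfun_apply (adj (op_tensor t x y)) (t \<xi> \<eta>)) =
      cinner v (blinfun_apply (op_tensor t (adj x) (adj y)) (t \<xi> \<eta>))" by simp
qed

end

section \<open>Amplification and the bicommutant\<close>

lemma l2_entry_apply:
  assumes "bounded_linear T"
  shows "blinfun_apply (Blinfun (\<lambda>v. l2_nth (T (l2_single k v)) j)) v = l2_nth (T (l2_single k v)) j"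
proof -
  have "bounded_linear (\<lambda>v. l2_nth (T (l2_single k v)) j)"
    by (intro bounded_linear_compose[OF bounded_linear_l2_nth] bounded_linear_compose[OF assms] bounded_linear_single)
  then show ?thesis by (simp add: bounded_linear_Blinfun_apply)
qed

definition l2_entry :: "('h::chilbert_space l2 \<Rightarrow>\<^sub>L 'h l2) \<Rightarrow> nat \<Rightarrow> nat \<Rightarrow> 'h \<Rightarrow>\<^sub>L 'h" where
  "l2_entry T j k = Blinfun (\<lambda>v. l2_nth (blinfun_apply T (l2_single k v)) j)"

lemma l2_entry: "blinfun_apply (l2_entry T j k) v = l2_nth (blinfun_apply T (l2_single k v)) j"
  unfolding l2_entry_def by (rule l2_entry_apply) (rule blinfun.bounded_linear_right)

lemma l2_entry_bounded_ops: "T \<in> bounded_ops \<Longrightarrow> l2_entry T j k \<in> bounded_ops"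
  by (rule bounded_opsI) (simp add: l2_entry l2_single_scaleC bounded_ops_apply_scaleC l2_nth_simps)

lemma l2_entry_sums: "(\<lambda>k. blinfun_apply (l2_entry T j k) (l2_nth v k)) sums l2_nth (blinfun_apply T v) j"
  unfolding l2_entry
  by (rule bounded_linear.sums[OF bounded_linear_compose[OF bounded_linear_l2_nth blinfun.bounded_linear_right] l2_sums_single])

text \<open>\<open>amp z\<close> is diagonal with constant entry \<open>z\<close>, so commuting with
  it is a condition on each matrix entry. Operators on \<open>l2\<close> that commute with an
  amplified algebra are thus matrices over its commutant.\<close>

lemma commute_amp_iff:
  "amp z o\<^sub>L T = T o\<^sub>L amp z \<longleftrightarrow> (\<forall>j k. z o\<^sub>L l2_entry T j k = l2_entry T j k o\<^sub>L z)"
proof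
  assume eq: "amp z o\<^sub>L T = T o\<^sub>L amp z"
  have "blinfun_apply z (blinfun_apply (l2_entry T j k) v) = blinfun_apply (l2_entry T j k) (blinfun_apply z v)" for j k v
  proof -
    have "blinfun_apply z (blinfun_apply (l2_entry T j k) v) = l2_nth (blinfun_apply (amp z o\<^sub>L T) (l2_single k v)) j"
      by (simp add: l2_entry l2_nth_amp)
    also have "\<dots> = blinfun_apply (l2_entry T j k) (blinfun_apply z v)"
      unfolding eq by (simp add: l2_entry amp_single)
    finally show ?thesis .
  qed
  then show "\<forall>j k. z o\<^sub>L l2_entry T j k = l2_entry T j k o\<^sub>L z"
    by (intro allI blinfun_eqI) simp
next
  assume eq: "\<forall>j k. z o\<^sub>L l2_entry T j k = l2_entry T j k o\<^sub>L z"
  have comm: "blinfun_apply z (blinfun_apply (l2_entry T j k) v) = blinfun_apply (l2_entry T j k) (blinfun_apply z v)" for j k v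
    using eq[THEN spec, THEN spec, of j k] by (metis blinfun_apply_blinfun_compose)
  show "amp z o\<^sub>L T = T o\<^sub>L amp z"
  proof (intro blinfun_eqI l2_eqI)
    fix v j
    have "(\<lambda>k. blinfun_apply z (blinfun_apply (l2_entry T j k) (l2_nth v k))) sums blinfun_apply z (l2_nth (blinfun_apply T v) j)"
      by (rule bounded_linear.sums[OF blinfun.bounded_linear_right l2_entry_sums])
    moreover have "(\<lambda>k. blinfun_apply z (blinfun_apply (l2_entry T j k) (l2_nth v k))) sums l2_nth (blinfun_apply T (blinfun_apply (amp z) v)) j"
      using l2_entry_sums[of T j "blinfun_apply (amp z) v"] by (simp add: comm l2_nth_amp)
    ultimately show "l2_nth (blinfun_apply (amp z o\<^sub>L T) v) j = l2_nth (blinfun_apply (T o\<^sub>L amp z) v) j"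
      by (simp add: l2_nth_amp sums_unique2)
  qed
qed

text \<open>Von Neumann's density argument: the projection onto the closure of
  \<open>{a \<zeta>}\<close> commutes with the amplified algebra, so its matrix entries lie in the commutant.\<close>

theorem bicommutant_density:
  fixes S :: "('h::chilbert_space \<Rightarrow>\<^sub>L 'h) set"
  assumes S: "S \<subseteq> bounded_ops" "\<And>a. a \<in> S \<Longrightarrow> adj a \<in> S" "\<And>a b. a \<in> S \<Longrightarrow> b \<in> S \<Longrightarrow> a o\<^sub>L b \<in> S"
    "\<And>c a. a \<in> S \<Longrightarrow> c *\<^sub>C a \<in> S" "id_blinfun \<in> S"
    and z: "z \<in> commutant (commutant S)" and e: "0 < e"
  obtains a where "a \<in> span S" "norm (blinfun_apply (amp (z - a)) \<zeta>) < e"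
proof -
  define g where "g a = blinfun_apply (amp a) \<zeta>" for a
  define D where "D = g ` span S"
  have g_simps: "g (a + b) = g a + g b" "g (c *\<^sub>C a) = c *\<^sub>C g a" "g (a o\<^sub>L b) = blinfun_apply (amp a) (g b)" "g 0 = 0" for a b c
    by (auto simp: g_def amp_simps blinfun.add_left blinfun_apply_scaleC)
  \<comment> \<open>\<open>span\<close> is the real span; it is complex because \<open>S\<close> is
    closed under complex multiples.\<close>
  have span_scaleC: "c *\<^sub>C a \<in> span S" if "a \<in> span S" for c a
  proof -
    have "span S \<subseteq> {a. c *\<^sub>C a \<in> span S}"
    proof (rule span_minimal)
      show "S \<subseteq> {a. c *\<^sub>C a \<in> span S}" using S(4) span_base by blast
      show "subspace {a. c *\<^sub>C a \<in> span S}"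
        by (auto simp: subspace_def scaleC_add_right scaleC_scaleR_commute span_add span_zero span_scale)
    qed
    with that show ?thesis by blast
  qed
  have span_compose: "s o\<^sub>L a \<in> span S" if s: "s \<in> S" and a: "a \<in> span S" for s a
  proof -
    have "span S \<subseteq> {a. s o\<^sub>L a \<in> span S}"
    proof (rule span_minimal)
      show "S \<subseteq> {a. s o\<^sub>L a \<in> span S}" using S(3) s span_base by blast
      show "subspace {a. s o\<^sub>L a \<in> span S}"
        by (auto simp: subspace_def blinfun_compose_simps(2,6) span_add span_zero span_scale)
    qed
    with a show ?thesis by blast
  qed
  have D: "v + w \<in> D" "c *\<^sub>C v \<in> D" if "v \<in> D" "w \<in> D" for v w c
    using that by (auto simp: D_def g_simps[symmetric] intro!: imageI span_add span_scaleC)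
  have D0: "0 \<in> D" unfolding D_def by (rule image_eqI[of _ _ 0]) (simp_all add: g_simps span_zero)
  have D': "\<And>v w. v \<in> D \<Longrightarrow> w \<in> D \<Longrightarrow> v + w \<in> D" "\<And>c v. v \<in> D \<Longrightarrow> c *\<^sub>C v \<in> D" using D by blast+
  have ampD: "blinfun_apply (amp s) v \<in> closure D" if s: "s \<in> S" and v: "v \<in> closure D" for s v
  proof -
    obtain h where h: "\<And>n. h n \<in> D" "h \<longlonglongrightarrow> v" using v by (auto simp: closure_sequential)
    have "blinfun_apply (amp s) (h n) \<in> D" for n
      using h(1)[of n] by (auto simp: D_def g_simps[symmetric] intro!: imageI span_compose[OF s])
    moreover have "(\<lambda>n. blinfun_apply (amp s) (h n)) \<longlonglongrightarrow> blinfun_apply (amp s) v"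
      by (intro blinfun.tendsto tendsto_const h)
    ultimately show ?thesis unfolding closure_sequential by (intro exI conjI allI)
  qed
  obtain P where P: "P \<in> bounded_ops" "\<And>v. blinfun_apply P v \<in> closure D"
    "\<And>v d. d \<in> closure D \<Longrightarrow> cinner d (v - blinfun_apply P v) = 0"
    by (rule projection[of D]) (rule D0 D' that | assumption)+
  have P_eq: "blinfun_apply P v = w" if "w \<in> closure D" "\<And>d. d \<in> closure D \<Longrightarrow> cinner d (v - w) = 0" for v w
  proof (rule closure_subspace_eqI[OF D' P(2) that(1)])
    fix d assume "d \<in> D"
    then have "d \<in> closure D" using closure_subset by blast
    then show "cinner d (blinfun_apply P v) = cinner d w"
      using P(3)[of d v] that(2)[of d] by (simp add: cinner.diff_right)
  qed
  have "amp s o\<^sub>L P = P o\<^sub>L amp s" if s: "s \<in> S" for s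
  proof (rule blinfun_eqI)
    fix v
    have sb: "s \<in> bounded_ops" "adj s \<in> S" using s S(1,2) by auto
    have "blinfun_apply P (blinfun_apply (amp s) v) = blinfun_apply (amp s) (blinfun_apply P v)"
    proof (rule P_eq)
      fix d assume d: "d \<in> closure D"
      have "cinner d (blinfun_apply (amp s) (v - blinfun_apply P v)) =
          cinner (blinfun_apply (amp (adj s)) d) (v - blinfun_apply P v)"
        by (simp add: amp_adj[symmetric] sb cinner_adj_left amp_bounded_ops)
      also have "\<dots> = 0" by (rule P(3)[OF ampD[OF sb(2) d]])
      finally show "cinner d (blinfun_apply (amp s) v - blinfun_apply (amp s) (blinfun_apply P v)) = 0"
        by (simp add: blinfun.diff_right)
    qed (rule ampD[OF s P(2)])
    then show "blinfun_apply (amp s o\<^sub>L P) v = blinfun_apply (P o\<^sub>L amp s) v" by simp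
  qed
  then have "l2_entry P j k \<in> commutant S" for j k
    by (intro commutantI l2_entry_bounded_ops P(1)) (metis commute_amp_iff)
  then have "amp z o\<^sub>L P = P o\<^sub>L amp z"
    unfolding commute_amp_iff using commutantD(1)[OF z] by blast
  \<comment> \<open>The identity puts \<open>\<zeta>\<close> into \<open>D\<close>; commutation with
    \<open>P\<close> then keeps the image of \<open>\<zeta>\<close> under \<open>amp z\<close> in
    the closure of \<open>D\<close>.\<close>
  moreover have "blinfun_apply P \<zeta> = \<zeta>"
  proof (rule P_eq)
    have "\<zeta> = g id_blinfun" by (simp add: g_def amp_simps)
    then have "\<zeta> \<in> D" using span_base[OF S(5)] by (auto simp: D_def)
    then show "\<zeta> \<in> closure D" using closure_subset by blast
  qed (simp add: cinner.zero_right)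
  ultimately have "blinfun_apply (amp z) \<zeta> = blinfun_apply P (blinfun_apply (amp z) \<zeta>)"
    by (metis blinfun_apply_blinfun_compose)
  then have "blinfun_apply (amp z) \<zeta> \<in> closure D" using P(2) by metis
  then obtain d where "d \<in> D" "dist d (blinfun_apply (amp z) \<zeta>) < e"
    using e by (auto simp: closure_approachable)
  then obtain a where "a \<in> span S" "dist (g a) (blinfun_apply (amp z) \<zeta>) < e"
    by (auto simp: D_def)
  then show ?thesis
    by (intro that[of a]) (simp_all add: g_def dist_norm norm_minus_commute amp_simps blinfun.diff_left)
qed

context von_neumann
begin

text \<open>\<open>r\<close> is cut out of the square root of the extension of \<open>x\<close> by zero to \<open>l2\<close>.\<close>

lemma mat_pos_factorization:
  assumes x: "x \<in> mat_pos n A"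
  obtains r where "\<And>k j. r k j \<in> A" "\<And>i j. i < n \<Longrightarrow> j < n \<Longrightarrow> x i j = (\<Sum>k<n. adj (r k i) o\<^sub>L r k j)"
proof -
  have xA: "x i j \<in> A" if "i < n" "j < n" for i j using x that by (auto simp: mat_pos_def)
  have xpos: "(\<Sum>i<n. \<Sum>j<n. cinner (blinfun_apply (x i j) (\<xi> j)) (\<xi> i)) \<in> \<real>\<^sub>\<ge>\<^sub>0" for \<xi>
    using x by (simp add: mat_pos_def)
  define h where "h v = (\<Sum>i<n. \<Sum>j<n. l2_single i (blinfun_apply (x i j) (l2_nth v j)))" for v
  have "bounded_linear h"
    unfolding h_def
    by (intro bounded_linear_sum bounded_linear_compose[OF bounded_linear_single]
        bounded_linear_compose[OF blinfun.bounded_linear_right] bounded_linear_l2_nth)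
  then have X: "blinfun_apply (Blinfun h) = h" by (rule bounded_linear_Blinfun_apply)
  define X where "X = Blinfun h"
  have Xh: "blinfun_apply X v = h v" for v by (simp add: X_def X)
  have Xb: "X \<in> bounded_ops"
  proof (rule bounded_opsI)
    fix c v
    have "l2_single i (blinfun_apply (x i j) (l2_nth (c *\<^sub>C v) j)) = c *\<^sub>C l2_single i (blinfun_apply (x i j) (l2_nth v j))"
      if "i < n" "j < n" for i j
      by (simp add: l2_nth_simps bounded_ops_apply_scaleC[OF bounded[OF xA[OF that]]] l2_single_scaleC)
    then show "blinfun_apply X (c *\<^sub>C v) = c *\<^sub>C blinfun_apply X v"
      by (simp add: Xh h_def scaleC_sum_right)
  qed
  have Xinner: "cinner (blinfun_apply X v) w = (\<Sum>i<n. \<Sum>j<n. cinner (blinfun_apply (x i j) (l2_nth v j)) (l2_nth w i))" for v w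
    by (simp add: Xh h_def cinner.sum_left cinner_single_left)
  have "positive_op X" unfolding positive_op_def Xinner using xpos by blast
  then obtain Y where Y: "Y \<in> bounded_ops" "positive_op Y" "Y o\<^sub>L Y = X"
    "\<forall>T. T o\<^sub>L X = X o\<^sub>L T \<longrightarrow> T o\<^sub>L Y = Y o\<^sub>L T"
    using op_sqrt[OF Xb] by metis
  have YX: "cinner (blinfun_apply Y v) (blinfun_apply Y w) = cinner (blinfun_apply X v) w" for v w
    using positive_op_symmetric[OF Y(1,2), of "blinfun_apply Y v" w] Y(3) by (metis blinfun_apply_blinfun_compose)
  \<comment> \<open>The squared norm of \<open>Y\<close> at a vector of coordinate \<open>k\<close>
    is the form of \<open>X\<close> there, which is zero for \<open>n \<le> k\<close>. By symmetry
    the range of \<open>Y\<close> avoids these coordinates too, which cuts the sum over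
    \<open>k\<close> down to \<open>n\<close> terms.\<close>
  have Y0: "l2_nth (blinfun_apply Y v) k = 0" if "n \<le> k" for v k
  proof (rule cinner_eq_zero_imp)
    fix w
    have "cinner (blinfun_apply Y (l2_single k w)) (blinfun_apply Y (l2_single k w)) = 0"
      unfolding YX Xinner using that by (simp add: l2_nth_single cinner.zero_right)
    then have "blinfun_apply Y (l2_single k w) = 0" by (simp add: cinner_self)
    then show "cinner w (l2_nth (blinfun_apply Y v) k) = 0"
      using positive_op_symmetric[OF Y(1,2), of "l2_single k w" v] by (simp add: cinner_single_left cinner.zero_left)
  qed
  have rA: "l2_entry Y k j \<in> A" for k j
  proof -
    have "l2_entry Y k j \<in> commutant (commutant A)"
    proof (rule commutantI[OF l2_entry_bounded_ops[OF Y(1)]])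
      fix T assume T: "T \<in> commutant A"
      \<comment> \<open>The entries of \<open>X\<close> commute with \<open>T\<close>, so
        \<open>amp T\<close> commutes with \<open>X\<close> and hence with its root; read entrywise,
        the entries of the root commute with \<open>T\<close>.\<close>
      have "amp T o\<^sub>L X = X o\<^sub>L amp T"
      proof (rule blinfun_eqI)
        fix v
        have "blinfun_apply T (blinfun_apply (x i j) u) = blinfun_apply (x i j) (blinfun_apply T u)" if "i < n" "j < n" for i j u
          using commutantD(1)[OF T xA[OF that]] by (metis blinfun_apply_blinfun_compose)
        then show "blinfun_apply (amp T o\<^sub>L X) v = blinfun_apply (X o\<^sub>L amp T) v"
          by (simp add: Xh h_def blinfun.sum_right amp_single l2_nth_amp)
      qed
      then have "amp T o\<^sub>L Y = Y o\<^sub>L amp T" by (rule Y(4)[THEN spec, THEN mp])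
      then show "l2_entry Y k j o\<^sub>L T = T o\<^sub>L l2_entry Y k j"
        unfolding commute_amp_iff by simp
    qed
    then show ?thesis using bicommutant by blast
  qed
  show ?thesis
  proof (rule that[OF rA])
    fix i j assume ij: "i < n" "j < n"
    show "x i j = (\<Sum>k<n. adj (l2_entry Y k i) o\<^sub>L l2_entry Y k j)"
    proof (rule blinfun_eqI)
      fix v
      have "cinner (blinfun_apply (x i j) v) w = cinner (blinfun_apply (\<Sum>k<n. adj (l2_entry Y k i) o\<^sub>L l2_entry Y k j) v) w" for w
      proof -
        have "cinner (blinfun_apply (x i j) v) w = cinner (blinfun_apply X (l2_single j v)) (l2_single i w)"
        proof -
          have "cinner (blinfun_apply (x i' j') (l2_nth (l2_single j v) j')) (l2_nth (l2_single i w) i') =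
              (if j' = j then if i' = i then cinner (blinfun_apply (x i' j') v) w else 0 else 0)" for i' j'
            by (simp add: l2_nth_single cinner.zero_left cinner.zero_right)
          then show ?thesis unfolding Xinner using ij by simp
        qed
        also have "\<dots> = cinner (blinfun_apply Y (l2_single j v)) (blinfun_apply Y (l2_single i w))"
          by (rule YX[symmetric])
        also have "\<dots> = (\<Sum>k<n. cinner (blinfun_apply (l2_entry Y k j) v) (blinfun_apply (l2_entry Y k i) w))"
          unfolding cinner_l2_def l2_entry
          by (rule suminf_finite) (auto simp: Y0 cinner.zero_left)
        also have "\<dots> = cinner (blinfun_apply (\<Sum>k<n. adj (l2_entry Y k i) o\<^sub>L l2_entry Y k j) v) w"
          by (simp add: blinfun.sum_left cinner.sum_left cinner_adj_left bounded[OF rA])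
        finally show ?thesis .
      qed
      then show "blinfun_apply (x i j) v = blinfun_apply (\<Sum>k<n. adj (l2_entry Y k i) o\<^sub>L l2_entry Y k j) v"
        by (intro cinner_ext) (metis cinner_commute)
    qed
  qed
qed

end

text \<open>Under an eventual uniform bound, strong convergence on a total set extends to the whole
  space. Closedness is the usual estimate by three terms.\<close>

lemma strong_convergence_subspace:
  fixes T :: "'i \<Rightarrow> 'a::real_normed_vector \<Rightarrow>\<^sub>L 'b::real_normed_vector"
  assumes K: "\<forall>\<^sub>F i in F. norm (T i) \<le> K"
  shows "subspace {v. ((\<lambda>i. blinfun_apply (T i) v) \<longlongrightarrow> blinfun_apply T' v) F}"
    and "closed {v. ((\<lambda>i. blinfun_apply (T i) v) \<longlongrightarrow> blinfun_apply T' v) F}"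
proof -
  let ?V = "{v. ((\<lambda>i. blinfun_apply (T i) v) \<longlongrightarrow> blinfun_apply T' v) F}"
  show "subspace ?V"
    by (auto simp: subspace_def blinfun.bilinear_simps intro!: tendsto_intros)
  have "v \<in> ?V" if v: "v \<in> closure ?V" for v
  proof -
    have "((\<lambda>i. blinfun_apply (T i) v) \<longlongrightarrow> blinfun_apply T' v) F"
    proof (rule tendstoI)
      fix e :: real assume e: "0 < e"
      \<comment> \<open>A trivial filter leaves the sign of \<open>K\<close> open, hence the
        absolute value; the summand 1 keeps \<open>L\<close> positive.\<close>
      define L where "L = \<bar>K\<bar> + norm T' + 1"
      have L: "0 < L" by (simp add: L_def add_nonneg_pos)
      obtain u where u: "u \<in> ?V" "dist u v < e / (2 * L)"
        using v e L unfolding closure_approachable by (meson divide_pos_pos mult_pos_pos zero_less_numeral)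
      have "\<forall>\<^sub>F i in F. dist (blinfun_apply (T i) u) (blinfun_apply T' u) < e / 2"
        using u(1) e by (intro tendstoD) auto
      then show "\<forall>\<^sub>F i in F. dist (blinfun_apply (T i) v) (blinfun_apply T' v) < e"
        using K
      proof eventually_elim
        case (elim i)
        have 1: "norm (blinfun_apply (T i) (v - u)) \<le> \<bar>K\<bar> * norm (v - u)"
          using elim(2) by (intro order_trans[OF norm_blinfun] mult_right_mono) auto
        have 2: "norm (blinfun_apply T' (v - u)) \<le> norm T' * norm (v - u)" by (rule norm_blinfun)
        have "(\<bar>K\<bar> + norm T') * norm (v - u) \<le> L * norm (v - u)"
          by (intro mult_right_mono) (simp_all add: L_def)
        also have "\<dots> < L * (e / (2 * L))"
          using u(2) L by (intro mult_strict_left_mono) (simp_all add: dist_norm norm_minus_commute)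
        also have "\<dots> = e / 2" using L by simp
        finally have 3: "\<bar>K\<bar> * norm (v - u) + norm T' * norm (v - u) < e / 2" by (simp add: distrib_right)
        have "blinfun_apply (T i) v - blinfun_apply T' v =
            blinfun_apply (T i) (v - u) + (blinfun_apply (T i) u - blinfun_apply T' u) - blinfun_apply T' (v - u)"
          by (simp add: blinfun.diff_right)
        then have "norm (blinfun_apply (T i) v - blinfun_apply T' v) \<le>
            norm (blinfun_apply (T i) (v - u)) + norm (blinfun_apply (T i) u - blinfun_apply T' u) + norm (blinfun_apply T' (v - u))"
          by (simp only:) (intro order_trans[OF norm_triangle_ineq4] add_right_mono norm_triangle_ineq)
        then show ?case using 1 2 3 elim(1) unfolding dist_norm by linarith
      qed
    qed
    then show ?thesis by simp
  qed
  then have "closure ?V \<subseteq> ?V" by (rule subsetI)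
  then show "closed ?V" unfolding closure_subset_eq .
qed

lemma adj_sum:
  "(\<And>i. i \<in> I \<Longrightarrow> a i \<in> bounded_ops) \<Longrightarrow> adj (\<Sum>i\<in>I. a i) = (\<Sum>i\<in>I. adj (a i))"
  by (rule adj_eqI) (simp add: blinfun.sum_left cinner.sum_left cinner.sum_right cinner_adj_right)

lemma blinfun_compose_sum:
  "(\<Sum>i\<in>I. a i) o\<^sub>L (\<Sum>j\<in>J. b j) = (\<Sum>i\<in>I. \<Sum>j\<in>J. a i o\<^sub>L b j)"
  by (rule blinfun_eqI) (simp only: blinfun_apply_blinfun_compose blinfun.sum_left, simp only: blinfun.sum_right)

lemma nonneg_Reals_sum: "(\<And>i. i \<in> I \<Longrightarrow> f i \<in> \<real>\<^sub>\<ge>\<^sub>0) \<Longrightarrow> (\<Sum>i\<in>I. f i) \<in> \<real>\<^sub>\<ge>\<^sub>0"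
  by (induction I rule: infinite_finite_induct) auto

lemma sum_swap_pairs:
  "(\<Sum>i\<in>A. \<Sum>j\<in>B. \<Sum>k\<in>C. \<Sum>l\<in>D. f i j k l) = (\<Sum>k\<in>C. \<Sum>l\<in>D. \<Sum>i\<in>A. \<Sum>j\<in>B. f i j k l)"
  for f :: "_ \<Rightarrow> _ \<Rightarrow> _ \<Rightarrow> _ \<Rightarrow> 'a::comm_monoid_add"
proof -
  have "(\<Sum>i\<in>A. \<Sum>j\<in>B. \<Sum>k\<in>C. \<Sum>l\<in>D. f i j k l) = (\<Sum>i\<in>A. \<Sum>k\<in>C. \<Sum>j\<in>B. \<Sum>l\<in>D. f i j k l)"
    by (intro sum.cong[OF refl] sum.swap)
  also have "\<dots> = (\<Sum>k\<in>C. \<Sum>i\<in>A. \<Sum>j\<in>B. \<Sum>l\<in>D. f i j k l)" by (rule sum.swap)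
  also have "\<dots> = (\<Sum>k\<in>C. \<Sum>i\<in>A. \<Sum>l\<in>D. \<Sum>j\<in>B. f i j k l)" by (intro sum.cong[OF refl] sum.swap)
  also have "\<dots> = (\<Sum>k\<in>C. \<Sum>l\<in>D. \<Sum>i\<in>A. \<Sum>j\<in>B. f i j k l)" by (intro sum.cong[OF refl] sum.swap)
  finally show ?thesis .
qed

context star_algebra
begin

lemma gram_mat_pos:
  assumes a: "\<And>i. i < n \<Longrightarrow> a i \<in> A"
  shows "(\<lambda>i j. adj (a i) o\<^sub>L a j) \<in> mat_pos n A"
  unfolding mat_pos_def
proof (intro CollectI conjI allI impI)
  fix \<xi>
  let ?w = "\<Sum>j<n. blinfun_apply (a j) (\<xi> j)"
  have "(\<Sum>i<n. \<Sum>j<n. cinner (blinfun_apply (adj (a i) o\<^sub>L a j) (\<xi> j)) (\<xi> i)) =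
      (\<Sum>i<n. \<Sum>j<n. cinner (blinfun_apply (a j) (\<xi> j)) (blinfun_apply (a i) (\<xi> i)))"
    by (intro sum.cong refl) (simp add: cinner_adj_left bounded a)
  also have "\<dots> = cinner ?w ?w"
    by (subst cinner.sum_right) (simp only: cinner.sum_left)
  finally show "(\<Sum>i<n. \<Sum>j<n. cinner (blinfun_apply (adj (a i) o\<^sub>L a j) (\<xi> j)) (\<xi> i)) \<in> \<real>\<^sub>\<ge>\<^sub>0"
    by (simp add: cinner_self complex_nonneg_Reals_iff)
qed (intro closed a)

lemma predual_add: "\<psi> \<in> predual A \<Longrightarrow> \<theta> \<in> predual A \<Longrightarrow> (\<lambda>a. \<psi> a + \<theta> a) \<in> predual A"
  unfolding predual_iff_dominated
proof (elim conjE exE, intro conjI)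
  fix \<zeta> \<zeta>' assume "linear_on A \<psi>" "linear_on A \<theta>"
  then show "linear_on A (\<lambda>a. \<psi> a + \<theta> a)" by (simp add: linear_on_def algebra_simps)
  assume z: "dominated A \<psi> \<zeta>" "dominated A \<theta> \<zeta>'"
  obtain z where p: "\<And>a. norm (blinfun_apply (amp a) \<zeta>) \<le> norm (blinfun_apply (amp a) z)"
    "\<And>a. norm (blinfun_apply (amp a) \<zeta>') \<le> norm (blinfun_apply (amp a) z)"
    by (rule l2_pack_two[of \<zeta> \<zeta>']) blast
  have "dominated A (\<lambda>a. \<psi> a + \<theta> a) (2 *\<^sub>R z)"
    unfolding dominated_def
  proof
    fix a assume a: "a \<in> A"
    have "cmod (\<psi> a) \<le> norm (blinfun_apply (amp a) z)" "cmod (\<theta> a) \<le> norm (blinfun_apply (amp a) z)"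
      using z a p[of a] by (auto simp: dominated_def intro: order_trans)
    then show "cmod (\<psi> a + \<theta> a) \<le> norm (blinfun_apply (amp a) (2 *\<^sub>R z))"
      using norm_triangle_ineq[of "\<psi> a" "\<theta> a"] by (simp add: blinfun.scaleR_right)
  qed
  then show "\<exists>\<zeta>. dominated A (\<lambda>a. \<psi> a + \<theta> a) \<zeta>" by blast
qed

lemma predual_mult: "\<psi> \<in> predual A \<Longrightarrow> (\<lambda>a. c * \<psi> a) \<in> predual A"
  unfolding predual_iff_dominated
proof (elim conjE exE, intro conjI)
  fix \<zeta> assume "linear_on A \<psi>" and z: "dominated A \<psi> \<zeta>"
  then show "linear_on A (\<lambda>a. c * \<psi> a)" by (simp add: linear_on_def algebra_simps)
  have "dominated A (\<lambda>a. c * \<psi> a) (cmod c *\<^sub>R \<zeta>)"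
    using z by (auto simp: dominated_def norm_mult blinfun.scaleR_right intro!: mult_left_mono)
  then show "\<exists>\<zeta>. dominated A (\<lambda>a. c * \<psi> a) \<zeta>" by blast
qed

lemma predual_cong:
  assumes "\<And>a. a \<in> A \<Longrightarrow> \<psi> a = \<theta> a"
  shows "\<psi> \<in> predual A \<longleftrightarrow> \<theta> \<in> predual A"
proof -
  have "linear_on A \<psi> \<longleftrightarrow> linear_on A \<theta>" using assms add scaleC by (simp add: linear_on_def)
  moreover have "dominated A \<psi> = dominated A \<theta>" using assms by (simp add: dominated_def fun_eq_iff)
  ultimately show ?thesis by (simp add: predual_iff_dominated)
qed

end

section \<open>Anti-automorphisms\<close>

locale anti_automorphism = von_neumann A for A :: "('h::chilbert_space \<Rightarrow>\<^sub>L 'h) set" +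
  fixes \<tau> :: "('h \<Rightarrow>\<^sub>L 'h) \<Rightarrow> ('h \<Rightarrow>\<^sub>L 'h)"
  assumes anti_aut: "star_anti_automorphism A \<tau>"
begin

abbreviation \<sigma> where "\<sigma> \<equiv> the_inv_into A \<tau>"

lemma tau_bij: "bij_betw \<tau> A A"
  and tau_add: "a \<in> A \<Longrightarrow> b \<in> A \<Longrightarrow> \<tau> (a + b) = \<tau> a + \<tau> b"
  and tau_scaleC: "a \<in> A \<Longrightarrow> \<tau> (c *\<^sub>C a) = c *\<^sub>C \<tau> a"
  and tau_adj: "a \<in> A \<Longrightarrow> \<tau> (adj a) = adj (\<tau> a)"
  and tau_compose: "a \<in> A \<Longrightarrow> b \<in> A \<Longrightarrow> \<tau> (a o\<^sub>L b) = \<tau> b o\<^sub>L \<tau> a"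
  using anti_aut unfolding star_anti_automorphism_def by blast+

lemma tau_mem: "a \<in> A \<Longrightarrow> \<tau> a \<in> A"
  using tau_bij by (rule bij_betwE[rule_format])

lemma sigma_tau: "a \<in> A \<Longrightarrow> \<sigma> (\<tau> a) = a"
  using tau_bij by (intro the_inv_into_f_f) (simp add: bij_betw_def)

lemma tau_sigma: "a \<in> A \<Longrightarrow> \<tau> (\<sigma> a) = a"
  using f_the_inv_into_f_bij_betw[OF tau_bij] by blast

lemma sigma_bij: "bij_betw \<sigma> A A"
  using tau_bij by (rule bij_betw_the_inv_into)

lemma sigma_mem: "a \<in> A \<Longrightarrow> \<sigma> a \<in> A"
  using sigma_bij by (rule bij_betwE[rule_format])

lemma sigma_eqI: "b \<in> A \<Longrightarrow> \<tau> b = a \<Longrightarrow> \<sigma> a = b"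
  using sigma_tau by blast

text \<open>What is proved for \<open>\<tau>\<close> thereby holds for \<open>\<sigma>\<close>, the
  map that occurs in \<open>Lambda_map\<close>.\<close>

lemma anti_automorphism_inv: "anti_automorphism A \<sigma>"
proof
  show "star_anti_automorphism A \<sigma>"
    unfolding star_anti_automorphism_def
  proof (intro conjI ballI allI)
    fix a b c assume ab: "a \<in> A" "b \<in> A"
    show "\<sigma> (a + b) = \<sigma> a + \<sigma> b"
      by (rule sigma_eqI) (simp_all add: ab sigma_mem add tau_add tau_sigma)
    show "\<sigma> (a o\<^sub>L b) = \<sigma> b o\<^sub>L \<sigma> a"
      by (rule sigma_eqI) (simp_all add: ab sigma_mem compose tau_compose tau_sigma)
  next
    fix a c assume a: "a \<in> A"
    show "\<sigma> (c *\<^sub>C a) = c *\<^sub>C \<sigma> a"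
      by (rule sigma_eqI) (simp_all add: a sigma_mem scaleC tau_scaleC tau_sigma)
    show "\<sigma> (adj a) = adj (\<sigma> a)"
      by (rule sigma_eqI) (simp_all add: a sigma_mem star tau_adj tau_sigma)
  qed (rule sigma_bij)
qed

lemma tau_zero: "\<tau> 0 = 0"
  using tau_scaleC[OF zero, of 0] by simp

lemma tau_diff: "a \<in> A \<Longrightarrow> b \<in> A \<Longrightarrow> \<tau> (a - b) = \<tau> a - \<tau> b"
  using tau_add[of a "(-1) *\<^sub>C b"] tau_scaleC[of b "-1"] scaleC[of b "-1"] by (simp add: scaleC_minus1)

lemma tau_sum: "(\<And>i. i \<in> I \<Longrightarrow> a i \<in> A) \<Longrightarrow> \<tau> (\<Sum>i\<in>I. a i) = (\<Sum>i\<in>I. \<tau> (a i))"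
  by (induction I rule: infinite_finite_induct) (simp_all add: tau_zero tau_add sum)

text \<open>Reversing products does no harm to squares: if \<open>a = r o\<^sub>L r\<close> with
  \<open>r\<close> self-adjoint, then the image of \<open>a\<close> is
  \<open>adj (\<tau> r) o\<^sub>L \<tau> r\<close>.\<close>

lemma tau_nonneg: "a \<in> A \<Longrightarrow> 0 \<preceq> a \<Longrightarrow> 0 \<preceq> \<tau> a"
proof -
  assume a: "a \<in> A" "0 \<preceq> a"
  then obtain r where r: "r \<in> A" "positive_op r" "adj r = r" "r o\<^sub>L r = a"
    by (metis sqrt op_le_def diff_zero)
  have "\<tau> a = adj (\<tau> r) o\<^sub>L \<tau> r"
    using r by (metis tau_adj tau_compose)
  then show ?thesis
    using positive_op_adj_compose[OF bounded[OF tau_mem[OF r(1)]]] by (simp add: op_le_def)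
qed

lemma tau_mono: "a \<in> A \<Longrightarrow> b \<in> A \<Longrightarrow> a \<preceq> b \<Longrightarrow> \<tau> a \<preceq> \<tau> b"
  using tau_nonneg[of "b - a"] by (simp add: op_le_def diff tau_diff)

lemma tau_id: "\<tau> id_blinfun = id_blinfun"
proof -
  have "id_blinfun = \<tau> (\<sigma> id_blinfun)" by (simp add: tau_sigma ident)
  also have "\<dots> = \<tau> (id_blinfun o\<^sub>L \<sigma> id_blinfun)" by (simp add: blinfun_compose_simps)
  also have "\<dots> = \<tau> (\<sigma> id_blinfun) o\<^sub>L \<tau> id_blinfun"
    by (rule tau_compose[OF ident sigma_mem[OF ident]])
  also have "\<dots> = \<tau> id_blinfun"
    by (simp add: tau_sigma ident blinfun_compose_simps)
  finally show ?thesis by simp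
qed

lemma tau_unit_interval: "a \<in> unit_interval \<Longrightarrow> \<tau> a \<in> unit_interval"
  using tau_mono[of a id_blinfun] by (simp add: unit_interval_def tau_mem tau_nonneg tau_id ident)

text \<open>An upper bound of the image is pulled back by the inverse, which is monotone as
  well.\<close>

lemma tau_is_lub:
  assumes "C \<subseteq> A" "is_lub C s"
  shows "is_lub (\<tau> ` C) (\<tau> s)"
  unfolding is_lub_def
proof (intro conjI ballI impI)
  interpret inv: anti_automorphism A \<sigma> by (rule anti_automorphism_inv)
  have s: "s \<in> A" "\<And>c. c \<in> C \<Longrightarrow> c \<preceq> s" "\<And>u. u \<in> A \<Longrightarrow> (\<And>c. c \<in> C \<Longrightarrow> c \<preceq> u) \<Longrightarrow> s \<preceq> u"
    using assms(2) by (auto simp: is_lub_def)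
  show "\<tau> s \<in> A" by (rule tau_mem[OF s(1)])
  show "d \<preceq> \<tau> s" if "d \<in> \<tau> ` C" for d
    using that assms(1) s by (auto intro!: tau_mono)
  fix u assume u: "u \<in> A" "\<forall>d\<in>\<tau> ` C. d \<preceq> u"
  have "s \<preceq> \<sigma> u"
  proof (rule s(3)[OF sigma_mem[OF u(1)]])
    fix c assume c: "c \<in> C"
    then have cA: "c \<in> A" using assms(1) by blast
    have "\<tau> c \<preceq> u" using u(2) c by blast
    from inv.tau_mono[OF tau_mem[OF cA] u(1) this] show "c \<preceq> \<sigma> u" by (simp add: sigma_tau cA)
  qed
  from tau_mono[OF s(1) sigma_mem[OF u(1)] this] show "\<tau> s \<preceq> u" by (simp add: tau_sigma u(1))
qed

lemma tau_chain:
  assumes C: "C \<subseteq> A" "op_chain C"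
  shows "op_chain (\<tau> ` C)"
  unfolding op_chain_def
proof (intro conjI ballI)
  show "\<tau> ` C \<noteq> {}" using C(2) by (simp add: op_chain_def)
  fix a b assume "a \<in> \<tau> ` C" "b \<in> \<tau> ` C"
  then obtain c d where cd: "c \<in> C" "d \<in> C" "a = \<tau> c" "b = \<tau> d" by blast
  moreover have "c \<preceq> d \<or> d \<preceq> c" using C(2) cd(1,2) unfolding op_chain_def by blast
  moreover have "c \<in> A" "d \<in> A" using C(1) cd(1,2) by blast+
  ultimately show "a \<preceq> b \<or> b \<preceq> a" using tau_mono[of c d] tau_mono[of d c] by blast
qed

end

section \<open>Functionals on the tensor product\<close>

locale tensor_functional = hilbert_tensor_product t + M: von_neumann M + N: anti_automorphism N \<tau>
  for t :: "'h::chilbert_space \<Rightarrow> 'k::chilbert_space \<Rightarrow> 'l::chilbert_space"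
    and M :: "('h \<Rightarrow>\<^sub>L 'h) set" and N :: "('k \<Rightarrow>\<^sub>L 'k) set" and \<tau> :: "('k \<Rightarrow>\<^sub>L 'k) \<Rightarrow> ('k \<Rightarrow>\<^sub>L 'k)" +
  fixes \<omega> :: "('l \<Rightarrow>\<^sub>L 'l) \<Rightarrow> complex"
  assumes omega_predual: "\<omega> \<in> predual (vn_tensor t M N)"
begin

text \<open>Under the prefix \<open>S\<close> the lemmas on \<open>\<tau>\<close> speak of its
  inverse.\<close>

interpretation S: anti_automorphism N "the_inv_into N \<tau>"
  by (rule N.anti_automorphism_inv)

definition elementary :: "('l \<Rightarrow>\<^sub>L 'l) set" where
  "elementary = {op_tensor t x y | x y. x \<in> M \<and> y \<in> N}"

lemma elementaryI: "x \<in> M \<Longrightarrow> y \<in> N \<Longrightarrow> op_tensor t x y \<in> elementary"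
  by (auto simp: elementary_def)

lemma elementaryE:
  assumes "a \<in> elementary"
  obtains x y where "a = op_tensor t x y" "x \<in> M" "y \<in> N"
  using assms by (auto simp: elementary_def)

lemma elementary_bounded_ops: "elementary \<subseteq> bounded_ops"
  by (auto elim!: elementaryE intro!: op_tensor_bounded_ops M.bounded N.bounded)

lemma elementary_adj: "a \<in> elementary \<Longrightarrow> adj a \<in> elementary"
  by (auto elim!: elementaryE simp: op_tensor_adj M.bounded N.bounded intro!: elementaryI M.star N.star)

lemma elementary_compose: "a \<in> elementary \<Longrightarrow> b \<in> elementary \<Longrightarrow> a o\<^sub>L b \<in> elementary"
  by (auto elim!: elementaryE simp: op_tensor_compose M.bounded N.bounded intro!: elementaryI M.compose N.compose)

lemma elementary_scaleC: "a \<in> elementary \<Longrightarrow> c *\<^sub>C a \<in> elementary"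
  by (auto elim!: elementaryE simp: M.bounded N.bounded simp flip: op_tensor_scaleC_left intro!: elementaryI M.scaleC)

lemma elementary_id: "id_blinfun \<in> elementary"
  using elementaryI[OF M.ident N.ident] by (simp add: op_tensor_id)

lemma vn_tensor_eq: "vn_tensor t M N = commutant (commutant elementary)"
  by (simp add: vn_tensor_def elementary_def)

interpretation B: von_neumann "vn_tensor t M N"
  unfolding vn_tensor_eq by (rule von_neumann_bicommutant[OF elementary_bounded_ops elementary_adj])

lemma op_tensor_mem: "x \<in> M \<Longrightarrow> y \<in> N \<Longrightarrow> op_tensor t x y \<in> vn_tensor t M N"
  unfolding vn_tensor_eq using subset_bicommutant[OF elementary_bounded_ops] elementaryI by blast

lemma omega_linear: "linear_on (vn_tensor t M N) \<omega>"
  using omega_predual by (simp add: B.predual_iff_dominated)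

lemma omega_representation:
  obtains \<zeta> \<eta> where "\<And>a. a \<in> vn_tensor t M N \<Longrightarrow> \<omega> a = cinner (blinfun_apply (amp a) \<zeta>) \<eta>"
proof -
  obtain \<zeta> where "dominated (vn_tensor t M N) \<omega> \<zeta>"
    using omega_predual by (auto simp: B.predual_iff_dominated)
  then show ?thesis
    by (rule B.dominated_representation[OF omega_linear]) (rule that)
qed

text \<open>The positive elements \<open>(x + c)\<^sup>* (x + c)\<close>, \<open>c\<^sup>4 = 1\<close>, span \<open>x\<close> by polarization.\<close>

lemma slice_polarization:
  assumes x: "x \<in> M" and y: "y \<in> N"
  defines "F \<equiv> \<lambda>c. \<omega> (op_tensor t (adj (x + c *\<^sub>C id_blinfun) o\<^sub>L (x + c *\<^sub>C id_blinfun)) y)"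
  shows "\<omega> (op_tensor t x y) = (1/4) * F 1 + ((\<i>/4) * F \<i> + ((-1/4) * F (-1) + (-\<i>/4) * F (-\<i>)))"
proof -
  let ?w = "\<lambda>a. \<omega> (op_tensor t a y)"
  have w_add: "?w (a + b) = ?w a + ?w b" if "a \<in> M" "b \<in> M" for a b
    using that y by (simp add: op_tensor_add_left M.bounded N.bounded linear_onD(1)[OF omega_linear] op_tensor_mem)
  have w_scaleC: "?w (c *\<^sub>C a) = c * ?w a" if "a \<in> M" for a c
    using that y by (simp add: op_tensor_scaleC_left M.bounded N.bounded linear_onD(2)[OF omega_linear] op_tensor_mem)
  \<comment> \<open>Summed over the fourth roots of unity with weights \<open>c / 4\<close>, only
    the coefficient of \<open>cnj c\<close> survives, because the values of \<open>c\<close> and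
    those of \<open>c\<^sup>2\<close> sum to zero.\<close>
  have "F c = ?w (adj x o\<^sub>L x) + c * ?w (adj x) + (cnj c * ?w x + c * cnj c * ?w id_blinfun)" for c
  proof -
    have "adj (x + c *\<^sub>C id_blinfun) o\<^sub>L (x + c *\<^sub>C id_blinfun) =
        ((adj x o\<^sub>L x) + c *\<^sub>C adj x) + (cnj c *\<^sub>C x + (c * cnj c) *\<^sub>C id_blinfun)"
      using x by (simp add: adj_add adj_scaleC adj_id M.bounded bounded_ops_intros blinfun_compose_simps(1,2,7,8)
          blinfun_compose_scaleC_left blinfun_compose_scaleC_right scaleC_scaleC scaleC_add_right mult.commute)
    then show ?thesis
      unfolding F_def using x by (simp add: w_add w_scaleC M.closed)
  qed
  then show ?thesis by (simp add: field_simps)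
qed

text \<open>\<open>\<omega>\<close> is a vector functional of the amplification, so strong
  convergence at \<open>\<zeta>\<close> is enough. It is clear on elementary tensors in one
  coordinate, and the uniform bound \<open>norm p\<close> carries it to the closed span of these,
  which contains \<open>\<zeta>\<close>.\<close>

lemma normal_slice:
  assumes C: "op_chain C" "C \<subseteq> N.unit_interval" and p: "p \<in> M"
    and s: "s \<in> N.unit_interval" "\<And>v. ((\<lambda>c. blinfun_apply c v) \<longlongrightarrow> blinfun_apply s v) (chain_filter C)"
  shows "((\<lambda>c. \<omega> (op_tensor t p c)) \<longlongrightarrow> \<omega> (op_tensor t p s)) (chain_filter C)"
proof -
  obtain \<zeta> \<eta> where \<omega>: "\<And>a. a \<in> vn_tensor t M N \<Longrightarrow> \<omega> a = cinner (blinfun_apply (amp a) \<zeta>) \<eta>"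
    by (rule omega_representation) (rule that)
  have mem: "\<forall>\<^sub>F c in chain_filter C. c \<in> N.unit_interval"
    using eventually_chain_filter_mem[OF C(1)] by eventually_elim (use C(2) in blast)
  have bound: "norm (amp (op_tensor t p c)) \<le> norm p" if "c \<in> N.unit_interval" for c
  proof -
    have "norm c \<le> 1"
      by (rule norm_blinfun_bound) (simp_all add: norm_le_one_if_contraction N.unit_intervalD[OF that])
    have "norm (amp (op_tensor t p c)) \<le> norm p * norm c"
      using norm_amp norm_op_tensor[OF M.bounded[OF p] N.unit_intervalD(4)[OF that]] by (rule order_trans)
    also have "\<dots> \<le> norm p" using \<open>norm c \<le> 1\<close> by (simp add: mult_left_le)
    finally show ?thesis .
  qed
  define V where "V = {v. ((\<lambda>c. blinfun_apply (amp (op_tensor t p c)) v) \<longlongrightarrow>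
    blinfun_apply (amp (op_tensor t p s)) v) (chain_filter C)}"
  have K: "\<forall>\<^sub>F c in chain_filter C. norm (amp (op_tensor t p c)) \<le> norm p"
    using mem by eventually_elim (rule bound)
  have V: "subspace V" "closed V"
    unfolding V_def by (rule strong_convergence_subspace[OF K])+
  have single: "l2_single k w \<in> V" for k w
  proof -
    have "w \<in> l2_single k -` V"
    proof (rule closed_subspace_UNIV)
      show "closed (l2_single k -` V)"
        by (intro closed_vimage V linear_continuous_on bounded_linear_single)
      show "subspace (l2_single k -` V)"
        by (rule linear_subspace_vimage[OF bounded_linear.linear[OF bounded_linear_single] V(1)])
      fix \<xi> \<eta>
      have "((\<lambda>c. l2_single k (t (blinfun_apply p \<xi>) (blinfun_apply c \<eta>))) \<longlongrightarrow>
          l2_single k (t (blinfun_apply p \<xi>) (blinfun_apply s \<eta>))) (chain_filter C)"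
        by (intro bounded_linear.tendsto[OF bounded_linear_single] bounded_linear.tendsto[OF bounded_linear_t_right] s(2))
      moreover have "\<forall>\<^sub>F c in chain_filter C. l2_single k (t (blinfun_apply p \<xi>) (blinfun_apply c \<eta>)) =
          blinfun_apply (amp (op_tensor t p c)) (l2_single k (t \<xi> \<eta>))"
        using mem by eventually_elim (simp add: amp_single op_tensor_apply M.bounded p N.unit_intervalD(4))
      ultimately show "t \<xi> \<eta> \<in> l2_single k -` V"
        by (simp add: V_def amp_single op_tensor_apply M.bounded p N.unit_intervalD(4)[OF s(1)] Lim_transform_eventually)
    qed
    then show ?thesis by simp
  qed
  have "\<zeta> \<in> V"
  proof (rule closed_sequentially[OF V(2)])
    show "(\<lambda>n. \<Sum>k<n. l2_single k (l2_nth \<zeta> k)) \<longlonglongrightarrow> \<zeta>"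
      using l2_sums_single[of \<zeta>] by (simp add: sums_def)
    show "(\<Sum>k<n. l2_single k (l2_nth \<zeta> k)) \<in> V" for n
      by (intro subspace_sum V single)
  qed
  then have "((\<lambda>c. cinner (blinfun_apply (amp (op_tensor t p c)) \<zeta>) \<eta>) \<longlongrightarrow>
      cinner (blinfun_apply (amp (op_tensor t p s)) \<zeta>) \<eta>) (chain_filter C)"
    unfolding V_def by (intro tendsto_cinner tendsto_const) simp
  moreover have "\<forall>\<^sub>F c in chain_filter C. cinner (blinfun_apply (amp (op_tensor t p c)) \<zeta>) \<eta> = \<omega> (op_tensor t p c)"
    using mem by eventually_elim (simp add: \<omega> op_tensor_mem p N.unit_intervalD(1))
  ultimately show ?thesis
    by (simp add: \<omega> op_tensor_mem p N.unit_intervalD(1)[OF s(1)] Lim_transform_eventually)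
qed

lemma slice_predual:
  assumes pos: "\<And>z. z \<in> vn_tensor t M N \<Longrightarrow> \<omega> (adj z o\<^sub>L z) \<in> \<real>\<^sub>\<ge>\<^sub>0" and r: "r \<in> M"
  shows "(\<lambda>y. \<omega> (op_tensor t (adj r o\<^sub>L r) (N.\<sigma> y))) \<in> predual N"
proof -
  define f where "f y = \<omega> (op_tensor t (adj r o\<^sub>L r) (N.\<sigma> y))" for y
  have p: "adj r o\<^sub>L r \<in> M" by (intro M.closed r)
  interpret f: normal_positive N f
  proof
    show "linear_on N f"
      unfolding linear_on_def f_def using p
      by (simp add: S.tau_add S.tau_scaleC op_tensor_add_right op_tensor_scaleC_right M.bounded N.bounded
          N.sigma_mem linear_onD[OF omega_linear] op_tensor_mem)
    show "f (adj y o\<^sub>L y) \<in> \<real>\<^sub>\<ge>\<^sub>0" if y: "y \<in> N" for y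
    proof -
      \<comment> \<open>The inverse of \<open>\<tau>\<close> turns \<open>adj y o\<^sub>L y\<close>
        into the product of \<open>N.\<sigma> y\<close> with its own adjoint, in this order, which
        is \<open>adj u o\<^sub>L u\<close>.\<close>
      define u where "u = adj (N.\<sigma> y)"
      have u: "u \<in> N" unfolding u_def by (intro N.star N.sigma_mem y)
      have "N.\<sigma> (adj y o\<^sub>L y) = adj u o\<^sub>L u"
        by (simp add: u_def S.tau_compose S.tau_adj N.star y adj_adj N.bounded N.sigma_mem)
      then have "op_tensor t (adj r o\<^sub>L r) (N.\<sigma> (adj y o\<^sub>L y)) = adj (op_tensor t r u) o\<^sub>L op_tensor t r u"
        by (simp add: op_tensor_adj op_tensor_compose M.bounded N.bounded r u M.star N.star)
      then show ?thesis unfolding f_def using pos[OF op_tensor_mem[OF r u]] by simp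
    qed
    fix C s and e :: real
    assume C: "op_chain C" "C \<subseteq> N.unit_interval" and s: "N.is_lub C s" "s \<in> N.unit_interval" and e: "0 < e"
    have CN: "C \<subseteq> N" using C(2) N.unit_intervalD(1) by blast
    let ?C = "N.\<sigma> ` C"
    have C': "op_chain ?C" "?C \<subseteq> N.unit_interval" "N.is_lub ?C (N.\<sigma> s)"
      using S.tau_chain[OF CN C(1)] S.tau_unit_interval C(2) S.tau_is_lub[OF CN s(1)] by auto
    obtain s' where s': "s' \<in> N.unit_interval" "\<And>c. c \<in> ?C \<Longrightarrow> c \<preceq> s'"
      "\<And>u. (\<And>c. c \<in> ?C \<Longrightarrow> c \<preceq> u) \<Longrightarrow> s' \<preceq> u"
      "\<And>v. ((\<lambda>c. blinfun_apply c v) \<longlongrightarrow> blinfun_apply s' v) (chain_filter ?C)"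
      by (rule N.chain_lub[OF C'(1,2)]) blast
    have "N.is_lub ?C s'" using s' N.unit_intervalD(1)[OF s'(1)] unfolding N.is_lub_def by blast
    \<comment> \<open>The supremum transported by order is identified with the strong limit of the
      transported chain, along which \<open>\<omega>\<close> is continuous.\<close>
    then have eq: "s' = N.\<sigma> s" using C'(3) by (rule N.is_lub_unique)
    have "((\<lambda>c. Re (\<omega> (op_tensor t (adj r o\<^sub>L r) c))) \<longlongrightarrow> Re (f s)) (chain_filter ?C)"
      unfolding f_def eq[symmetric] by (intro tendsto_Re normal_slice[OF C'(1,2) p s'(1,4)])
    then have "\<forall>\<^sub>F c in chain_filter ?C. Re (f s) - e < Re (\<omega> (op_tensor t (adj r o\<^sub>L r) c))"
      by (rule order_tendstoD(1)) (use e in simp)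
    then have "\<exists>c\<in>?C. Re (f s) - e < Re (\<omega> (op_tensor t (adj r o\<^sub>L r) c))"
      unfolding eventually_chain_filter[OF C'(1)] using op_le_refl by blast
    then show "\<exists>c\<in>C. Re (f s) - e < Re (f c)" by (auto simp: f_def)
  qed
  show ?thesis using f.in_predual by (simp add: f_def[abs_def])
qed

lemma Lambda_map_in_predual:
  assumes pos: "\<And>z. z \<in> vn_tensor t M N \<Longrightarrow> \<omega> (adj z o\<^sub>L z) \<in> \<real>\<^sub>\<ge>\<^sub>0" and x: "x \<in> M"
  shows "Lambda_map t N \<tau> \<omega> x \<in> predual N"
proof -
  let ?r = "\<lambda>c. x + c *\<^sub>C id_blinfun"
  let ?F = "\<lambda>c y. \<omega> (op_tensor t (adj (?r c) o\<^sub>L ?r c) (N.\<sigma> y))"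
  have F: "?F c \<in> predual N" for c by (intro slice_predual pos M.closed x)
  have "(\<lambda>y. (1/4) * ?F 1 y + ((\<i>/4) * ?F \<i> y + ((-1/4) * ?F (-1) y + (-\<i>/4) * ?F (-\<i>) y))) \<in> predual N"
    by (intro N.predual_add N.predual_mult F)
  also have "?this \<longleftrightarrow> ?thesis"
    by (rule N.predual_cong) (simp only: Lambda_map_def slice_polarization[OF x N.sigma_mem])
  finally show ?thesis .
qed

section \<open>Positivity versus complete positivity\<close>

lemma omega_gram:
  assumes r: "\<And>k j. r k j \<in> M" and u: "\<And>l j. u l j \<in> N"
  shows "(\<Sum>i<n. \<Sum>j<n. \<omega> (op_tensor t (\<Sum>k<m. adj (r k i) o\<^sub>L r k j) (\<Sum>l<m'. u l i o\<^sub>L adj (u l j)))) =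
    (\<Sum>k<m. \<Sum>l<m'. \<omega> (adj (\<Sum>j<n. op_tensor t (r k j) (adj (u l j))) o\<^sub>L (\<Sum>j<n. op_tensor t (r k j) (adj (u l j)))))"
proof -
  note mem = M.closed N.closed M.bounded N.bounded r u
  let ?f = "\<lambda>i j k l. \<omega> (op_tensor t (adj (r k i) o\<^sub>L r k j) (u l i o\<^sub>L adj (u l j)))"
  have "(\<Sum>i<n. \<Sum>j<n. \<omega> (op_tensor t (\<Sum>k<m. adj (r k i) o\<^sub>L r k j) (\<Sum>l<m'. u l i o\<^sub>L adj (u l j)))) =
      (\<Sum>i<n. \<Sum>j<n. \<Sum>k<m. \<Sum>l<m'. ?f i j k l)"
    by (simp add: op_tensor_sum_left op_tensor_sum_right mem B.linear_on_sum[OF omega_linear] B.sum op_tensor_mem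
        bounded_ops_sum)
      (rule sum.cong[OF refl], rule sum.cong[OF refl], rule sum.swap)
  \<comment> \<open>For fixed \<open>k\<close> and \<open>l\<close> the double sum over
    \<open>i\<close> and \<open>j\<close> is the expansion of a single square.\<close>
  also have "\<dots> = (\<Sum>k<m. \<Sum>l<m'. \<Sum>i<n. \<Sum>j<n. ?f i j k l)" by (rule sum_swap_pairs)
  also have "\<dots> = (\<Sum>k<m. \<Sum>l<m'. \<omega> (adj (\<Sum>j<n. op_tensor t (r k j) (adj (u l j))) o\<^sub>L (\<Sum>j<n. op_tensor t (r k j) (adj (u l j)))))"
    by (simp add: adj_sum op_tensor_bounded_ops op_tensor_adj adj_adj mem blinfun_compose_sum op_tensor_compose
        B.linear_on_sum[OF omega_linear] B.sum op_tensor_mem)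
  finally show ?thesis .
qed

lemma completely_positive_if_positive:
  assumes pos: "\<And>z. z \<in> vn_tensor t M N \<Longrightarrow> \<omega> (adj z o\<^sub>L z) \<in> \<real>\<^sub>\<ge>\<^sub>0"
  shows "completely_positive M N (Lambda_map t N \<tau> \<omega>)"
  unfolding completely_positive_def linear_to_predual_def predual_mat_pos_def
proof (intro conjI ballI allI CollectI impI)
  show "Lambda_map t N \<tau> \<omega> x \<in> predual N" if "x \<in> M" for x
    by (rule Lambda_map_in_predual[OF pos that])
  show "Lambda_map t N \<tau> \<omega> (x + x') y = Lambda_map t N \<tau> \<omega> x y + Lambda_map t N \<tau> \<omega> x' y"
    if "x \<in> M" "x' \<in> M" "y \<in> N" for x x' y
    using that by (simp add: Lambda_map_def op_tensor_add_left M.bounded N.bounded N.sigma_mem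
        linear_onD(1)[OF omega_linear] op_tensor_mem)
  show "Lambda_map t N \<tau> \<omega> (c *\<^sub>C x) y = c * Lambda_map t N \<tau> \<omega> x y" if "x \<in> M" "y \<in> N" for c x y
    using that by (simp add: Lambda_map_def op_tensor_scaleC_left M.bounded N.bounded N.sigma_mem
        linear_onD(2)[OF omega_linear] op_tensor_mem)
  fix n x assume x: "x \<in> mat_pos n M"
  show "Lambda_map t N \<tau> \<omega> (x i j) \<in> predual N" if "i < n" "j < n" for i j
    by (rule Lambda_map_in_predual[OF pos]) (use x that in \<open>auto simp: mat_pos_def\<close>)
  fix b assume b: "b \<in> mat_pos n N"
  obtain r where r: "\<And>k j. r k j \<in> M" "\<And>i j. i < n \<Longrightarrow> j < n \<Longrightarrow> x i j = (\<Sum>k<n. adj (r k i) o\<^sub>L r k j)"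
    by (rule M.mat_pos_factorization[OF x]) (rule that)
  obtain s where s: "\<And>k j. s k j \<in> N" "\<And>i j. i < n \<Longrightarrow> j < n \<Longrightarrow> b i j = (\<Sum>k<n. adj (s k i) o\<^sub>L s k j)"
    by (rule N.mat_pos_factorization[OF b]) (rule that)
  define u where "u l j = N.\<sigma> (s l j)" for l j
  have u: "u l j \<in> N" for l j unfolding u_def by (intro N.sigma_mem s)
  \<comment> \<open>The trace pairing matches \<open>x i j\<close> with the transposed entry
    \<open>b j i\<close>; the reversal of products undoes the transposition, so both factors carry
    \<open>i\<close> on the left and \<open>j\<close> on the right.\<close>
  have "N.\<sigma> (b j i) = (\<Sum>l<n. u l i o\<^sub>L adj (u l j))" if "i < n" "j < n" for i j
    using that by (simp add: s S.tau_sum N.closed S.tau_compose S.tau_adj u_def)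
  then have "trace_pairing n (\<lambda>i j. Lambda_map t N \<tau> \<omega> (x i j)) b =
      (\<Sum>i<n. \<Sum>j<n. \<omega> (op_tensor t (\<Sum>k<n. adj (r k i) o\<^sub>L r k j) (\<Sum>l<n. u l i o\<^sub>L adj (u l j))))"
    by (simp add: trace_pairing_def Lambda_map_def r(2))
  also have "\<dots> = (\<Sum>k<n. \<Sum>l<n. \<omega> (adj (\<Sum>j<n. op_tensor t (r k j) (adj (u l j))) o\<^sub>L
      (\<Sum>j<n. op_tensor t (r k j) (adj (u l j)))))"
    by (rule omega_gram[OF r(1) u])
  also have "\<dots> \<in> \<real>\<^sub>\<ge>\<^sub>0"
    by (intro nonneg_Reals_sum pos B.sum op_tensor_mem r N.star u)
  finally show "trace_pairing n (\<lambda>i j. Lambda_map t N \<tau> \<omega> (x i j)) b \<in> \<real>\<^sub>\<ge>\<^sub>0" .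
qed

lemma span_elementary_nonneg:
  assumes cp: "completely_positive M N (Lambda_map t N \<tau> \<omega>)" and a: "a \<in> span elementary"
  shows "\<omega> (adj a o\<^sub>L a) \<in> \<real>\<^sub>\<ge>\<^sub>0"
proof -
  \<comment> \<open>Real coefficients of the span are absorbed into the left factor; the entries
    from \<open>n\<close> on are mere placeholders in \<open>M\<close> and \<open>N\<close>.\<close>
  have "\<exists>n x y. (\<forall>i::nat. x i \<in> M \<and> y i \<in> N) \<and> a = (\<Sum>i<n. op_tensor t (x i) (y i))"
    using a
  proof (induction rule: span_induct_alt)
    case base
    show ?case using M.zero N.zero by (intro exI[of _ 0] exI[of _ "\<lambda>_. 0"]) simp
  next
    case (step c g a)
    then obtain n x y where IH: "\<forall>i::nat. x i \<in> M \<and> y i \<in> N" "a = (\<Sum>i<n. op_tensor t (x i) (y i))" by blast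
    from step(1) obtain x' y' where g: "g = op_tensor t x' y'" "x' \<in> M" "y' \<in> N" by (auto simp: elementary_def)
    have "c *\<^sub>R g = op_tensor t (c *\<^sub>R x') y'"
      by (simp add: g scaleR_scaleC op_tensor_scaleC_left M.bounded N.bounded)
    then have "c *\<^sub>R g + a = (\<Sum>i<Suc n. op_tensor t ((x(n := c *\<^sub>R x')) i) ((y(n := y')) i))"
      by (simp add: IH(2) add.commute)
    moreover have "\<forall>i. (x(n := c *\<^sub>R x')) i \<in> M \<and> (y(n := y')) i \<in> N"
      using IH(1) g M.scaleR by simp
    ultimately show ?case by blast
  qed
  then obtain n x y where xy: "\<And>i::nat. x i \<in> M" "\<And>i. y i \<in> N" "a = (\<Sum>i<n. op_tensor t (x i) (y i))" by blast
  define X where "X i j = adj (x i) o\<^sub>L x j" for i j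
  \<comment> \<open>The Gram matrix of the elements \<open>adj (\<tau> (y i))\<close>, chosen so
    that the inverse of \<open>\<tau>\<close> takes \<open>b j i\<close> to
    \<open>adj (y i) o\<^sub>L y j\<close>.\<close>
  define b where "b i j = adj (adj (\<tau> (y i))) o\<^sub>L adj (\<tau> (y j))" for i j
  have X: "X \<in> mat_pos n M"
    unfolding X_def[abs_def] by (rule M.gram_mat_pos) (rule xy)
  have b: "b \<in> mat_pos n N"
    unfolding b_def[abs_def] by (rule N.gram_mat_pos) (intro N.star N.tau_mem xy)
  have sigma_b: "N.\<sigma> (b j i) = adj (y i) o\<^sub>L y j" for i j
  proof (rule N.sigma_eqI)
    show "\<tau> (adj (y i) o\<^sub>L y j) = b j i"
      by (simp add: b_def N.tau_compose N.tau_adj N.closed xy adj_adj N.bounded N.tau_mem)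
  qed (intro N.closed xy)
  have "trace_pairing n (\<lambda>i j. Lambda_map t N \<tau> \<omega> (X i j)) b \<in> \<real>\<^sub>\<ge>\<^sub>0"
    using cp X b by (auto simp: completely_positive_def predual_mat_pos_def)
  also have "trace_pairing n (\<lambda>i j. Lambda_map t N \<tau> \<omega> (X i j)) b =
      (\<Sum>i<n. \<Sum>j<n. \<omega> (op_tensor t (adj (x i) o\<^sub>L x j) (adj (y i) o\<^sub>L y j)))"
    by (simp add: trace_pairing_def Lambda_map_def sigma_b X_def)
  also have "\<dots> = \<omega> (adj a o\<^sub>L a)"
    by (simp add: xy(3) adj_sum op_tensor_bounded_ops op_tensor_adj M.bounded N.bounded xy(1,2) blinfun_compose_sum
        op_tensor_compose M.closed N.closed B.linear_on_sum[OF omega_linear] B.sum op_tensor_mem)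
  finally show ?thesis .
qed

lemma positive_if_completely_positive:
  assumes cp: "completely_positive M N (Lambda_map t N \<tau> \<omega>)"
  shows "positive_functional (vn_tensor t M N) \<omega>"
  unfolding positive_functional_def
proof (intro ballI impI)
  fix w assume w: "w \<in> vn_tensor t M N" "positive_op w"
  obtain z where z: "z \<in> vn_tensor t M N" "adj z = z" "z o\<^sub>L z = w"
    by (rule B.sqrt[OF w]) (rule that)
  obtain \<zeta> \<eta> where \<omega>: "\<And>a. a \<in> vn_tensor t M N \<Longrightarrow> \<omega> a = cinner (blinfun_apply (amp a) \<zeta>) \<eta>"
    by (rule omega_representation) (rule that)
  \<comment> \<open>With one factor moved to each vector,
    \<open>\<omega> (adj a o\<^sub>L a)\<close> depends continuously on the values of
    \<open>amp a\<close> at \<open>\<zeta>\<close> and \<open>\<eta>\<close>, whatever the norm of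
    \<open>a\<close>.\<close>
  have square: "\<omega> (adj a o\<^sub>L a) = cinner (blinfun_apply (amp a) \<zeta>) (blinfun_apply (amp a) \<eta>)"
    if "a \<in> vn_tensor t M N" for a
    using that by (simp add: \<omega> B.closed amp_simps amp_adj[symmetric] B.bounded cinner_adj_left amp_bounded_ops)
  \<comment> \<open>The density theorem approximates at one vector, so a single \<open>v\<close> has
    to control both \<open>\<zeta>\<close> and \<open>\<eta>\<close>.\<close>
  obtain v where v: "\<And>a. norm (blinfun_apply (amp a) \<zeta>) \<le> norm (blinfun_apply (amp a) v)"
    "\<And>a. norm (blinfun_apply (amp a) \<eta>) \<le> norm (blinfun_apply (amp a) v)"
    by (rule l2_pack_two[of \<zeta> \<eta>]) (rule that)
  have "\<exists>a. a \<in> span elementary \<and> norm (blinfun_apply (amp (z - a)) v) < 1 / Suc n" for n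
    by (rule bicommutant_density[OF elementary_bounded_ops elementary_adj elementary_compose elementary_scaleC
          elementary_id z(1)[unfolded vn_tensor_eq], of "1 / Suc n" v]) auto
  then obtain a where a: "\<And>n. a n \<in> span elementary" "\<And>n. norm (blinfun_apply (amp (z - a n)) v) < 1 / Suc n"
    by metis
  have lim: "(\<lambda>n. blinfun_apply (amp (a n)) u) \<longlonglongrightarrow> blinfun_apply (amp z) u"
    if u: "\<And>a. norm (blinfun_apply (amp a) u) \<le> norm (blinfun_apply (amp a) v)" for u
  proof (rule LIM_zero_cancel, rule Lim_null_comparison)
    show "\<forall>\<^sub>F n in sequentially. norm (blinfun_apply (amp (a n)) u - blinfun_apply (amp z) u) \<le> 1 / Suc n"
    proof (rule always_eventually, rule allI)
      fix n
      have "norm (blinfun_apply (amp (a n)) u - blinfun_apply (amp z) u) = norm (blinfun_apply (amp (z - a n)) u)"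
        by (simp add: amp_simps blinfun.diff_left norm_minus_commute)
      also have "\<dots> \<le> 1 / Suc n" using u[of "z - a n"] a(2)[of n] by linarith
      finally show "norm (blinfun_apply (amp (a n)) u - blinfun_apply (amp z) u) \<le> 1 / Suc n" .
    qed
    show "(\<lambda>n. 1 / real (Suc n)) \<longlonglongrightarrow> 0"
      using LIMSEQ_inverse_real_of_nat by (simp add: inverse_eq_divide)
  qed
  have "span elementary \<subseteq> vn_tensor t M N"
  proof (rule span_minimal)
    show "elementary \<subseteq> vn_tensor t M N" unfolding vn_tensor_eq by (rule subset_bicommutant[OF elementary_bounded_ops])
    show "subspace (vn_tensor t M N)" by (simp add: subspace_def B.closed)
  qed
  then have aB: "a n \<in> vn_tensor t M N" for n using a(1) by blast
  have "(\<lambda>n. \<omega> (adj (a n) o\<^sub>L a n)) \<longlonglongrightarrow> \<omega> (adj z o\<^sub>L z)"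
    unfolding square[OF aB] square[OF z(1)] by (intro tendsto_cinner lim v)
  then have "\<omega> (adj z o\<^sub>L z) \<in> \<real>\<^sub>\<ge>\<^sub>0"
    by (rule Lim_in_closed_set[OF closed_nonneg_Reals_complex, rotated 2])
      (simp_all add: span_elementary_nonneg[OF cp a(1)])
  then show "\<omega> w \<in> \<real>\<^sub>\<ge>\<^sub>0" by (simp add: z)
qed

lemma positive_functional_iff_completely_positive:
  "positive_functional (vn_tensor t M N) \<omega> \<longleftrightarrow> completely_positive M N (Lambda_map t N \<tau> \<omega>)"
proof
  assume pos: "positive_functional (vn_tensor t M N) \<omega>"
  show "completely_positive M N (Lambda_map t N \<tau> \<omega>)"
  proof (rule completely_positive_if_positive)
    show "\<omega> (adj z o\<^sub>L z) \<in> \<real>\<^sub>\<ge>\<^sub>0" if "z \<in> vn_tensor t M N" for z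
      using pos that positive_op_adj_compose[OF B.bounded[OF that]]
      by (simp add: positive_functional_def B.closed)
  qed
qed (rule positive_if_completely_positive)

end

theorem theorem2p14:
  fixes M :: "('h::chilbert_space \<Rightarrow>\<^sub>L 'h) set"
    and N :: "('k::chilbert_space \<Rightarrow>\<^sub>L 'k) set"
    and t :: "'h \<Rightarrow> 'k \<Rightarrow> 'l::chilbert_space"
    and \<tau> :: "('k \<Rightarrow>\<^sub>L 'k) \<Rightarrow> ('k \<Rightarrow>\<^sub>L 'k)"
    and \<omega> :: "('l \<Rightarrow>\<^sub>L 'l) \<Rightarrow> complex"
  assumes "von_neumann_algebra M"
    and "von_neumann_algebra N"
    and "hilbert_tensor t"
    and "star_anti_automorphism N \<tau>"
    and "\<omega> \<in> predual (vn_tensor t M N)"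
  shows "positive_functional (vn_tensor t M N) \<omega> \<longleftrightarrow>
         completely_positive M N (Lambda_map t N \<tau> \<omega>)"
proof -
  interpret M: von_neumann M by (rule von_neumann_if_von_neumann_algebra[OF assms(1)])
  interpret N: von_neumann N by (rule von_neumann_if_von_neumann_algebra[OF assms(2)])
  interpret tensor_functional t M N \<tau> \<omega> by unfold_locales (rule assms)+
  show ?thesis by (rule positive_functional_iff_completely_positive)
qed

end
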